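(* Let $a_1,a_2,d_1,d_2$ be positive integers and let $\Lambda$ be a $2$-graph with vertex set $\Lambda^0=\{u,v\}$ such that, for $i=1,2$, $|u\Lambda^{e_i}u|=d_i$, $|u\Lambda^{e_i}v|=a_i$ and $v\Lambda^{e_i}=\emptyset$. Let $r=(r_1,r_2)\in(0,\infty)^2$ be such that $r_i\ge\ln d_i$ for $i=1,2$, $r_i=\ln d_i$ for at least one $i$, and $\{r_1,r_2\}$ are rationally independent. Then $(\mathcal{T}C^*(\Lambda\setminus\{v\}),\alpha^r)$ has a unique KMS$_1$ state $\phi$, and $\phi\circ q_{\{v\}}$ is the only KMS$_1$ state of $(\mathcal{T}C^*(\Lambda),\alpha^r)$.
   Context: $\mathbb{N}=\{0,1,2,\dots\}$, and $e_1,e_2$ are the standard generators of $\mathbb{N}^2$. A $2$-graph is a countable category $\Lambda$ with a degree functor $d:\Lambda\to\mathbb{N}^2$ such that whenever $d(\lambda)=m+n$ there are unique $\mu,\nu$ with $\lambda=\mu\nu$, $d(\mu)=m$, $d(\nu)=n$. Elements are called paths; $r(\lambda)$ and $s(\lambda)$ are the codomain and domain; $\mu\nu$ is defined when $s(\mu)=r(\nu)$. $\Lambda^n=d^{-1}(n)$; $\Lambda^0$ is identified with the objects (vertices). $z\Lambda^n=\{\lambda\in\Lambda^n:r(\lambda)=z\}$, $z\Lambda^nx=\{\lambda\in z\Lambda^n:s(\lambda)=x\}$. For $r(\mu)=r(\nu)$, $\Lambda^{\min}(\mu,\nu)=\{(\alpha,\beta)\in\Lambda\times\Lambda:\mu\alpha=\nu\beta,\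 d(\mu\alpha)=d(\mu)\vee d(\nu)\}$ (empty if $r(\mu)\neq r(\nu)$). The Toeplitz algebra $\mathcal{T}C^*(\Lambda)$ is the universal $C^*$-algebra generated by partial isometries $\{t_\lambda:\lambda\in\Lambda\}$ such that: (T1) $\{t_z:z\in\Lambda^0\}$ are mutually orthogonal projections; (T2) $t_\lambda t_\mu=t_{\lambda\mu}$ if $s(\lambda)=r(\mu)$; (T3) $t_\lambda^*t_\lambda=t_{s(\lambda)}$; (T4) $t_z\ge\sum_{\lambda\in z\Lambda^n}t_\lambda t_\lambda^*$ for $z\in\Lambda^0$, $n\in\mathbb{N}^2$; (T5) $t_\mu^*t_\nu=\sum_{(\alpha,\beta)\in\Lambda^{\min}(\mu,\nu)}t_\alpha t_\beta^*$ (empty sums are $0$). The dynamics $\alpha^r:\mathbb{R}\to\operatorname{Aut}\mathcal{T}C^*(\Lambda)$ is given by $\alpha^r_t(t_\mu t_\nu^* )=e^{it\,r\cdot(d(\mu)-d(\nu))}t_\mu t_\nu^*$ (and similarly for $\Lambda\setminus\{v\}$). A KMS$_\beta$ state is a state $\phi$ with $\phi(ab)=\phi(b\,\alpha^r_{i\beta}(a))$ for all analytic $a,b$. Rationally independent means linearly independent over $\mathbb{Q}$. $\Lambda\setminus\{v\}=\{\mu\in\Lambda:s(\mu)\neq v\}=u\Lambda u$ is the sub-$2$-graph with vertex $u$, and $q_{\{v\}}:\mathcal{T}C^*(\Lambda)\to\mathcal{T}C^*(\Lambda\setminus\{v\})$ is the surjective homomorphism with $q_{\{v\}}(t_\mu)=t_\mu$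 if $s(\mu)\ne v$ and $q_{\{v\}}(t_\mu)=0$ if $s(\mu)=v$; its kernel is the ideal generated by $t_v$. *)

theory Defs
  imports "HOL-Analysis.Analysis" "HOL-Library.Poly_Mapping" "HOL-Library.Product_Order"
begin

section \<open>2-graphs\<close>

text \<open>
  A small category is given by its morphisms alone: an object is identified with its identity
  morphism, so range and source are maps from morphisms to (identity) morphisms.
  The composite \<open>pcomp \<Lambda> \<mu> \<nu>\<close> is meaningful only if \<open>src \<Lambda> \<mu> = rng \<Lambda> \<nu>\<close>.
\<close>

record 'p two_graph_data =
  paths :: "'p set"
  rng :: "'p \<Rightarrow> 'p"
  src :: "'p \<Rightarrow> 'p"
  pcomp :: "'p \<Rightarrow> 'p \<Rightarrow> 'p"
  deg :: "'p \<Rightarrow> nat \<times> nat"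

locale two_graph =
  fixes \<Lambda> :: "'p two_graph_data"
  assumes countable_paths: "countable (paths \<Lambda>)"
    and rng_closed: "\<kappa> \<in> paths \<Lambda> \<Longrightarrow> rng \<Lambda> \<kappa> \<in> paths \<Lambda>"
    and src_closed: "\<kappa> \<in> paths \<Lambda> \<Longrightarrow> src \<Lambda> \<kappa> \<in> paths \<Lambda>"
    and rng_rng: "\<kappa> \<in> paths \<Lambda> \<Longrightarrow> rng \<Lambda> (rng \<Lambda> \<kappa>) = rng \<Lambda> \<kappa>"
    and src_rng: "\<kappa> \<in> paths \<Lambda> \<Longrightarrow> src \<Lambda> (rng \<Lambda> \<kappa>) = rng \<Lambda> \<kappa>"
    and rng_src: "\<kappa> \<in> paths \<Lambda> \<Longrightarrow> rng \<Lambda> (src \<Lambda> \<kappa>) = src \<Lambda> \<kappa>"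
    and src_src: "\<kappa> \<in> paths \<Lambda> \<Longrightarrow> src \<Lambda> (src \<Lambda> \<kappa>) = src \<Lambda> \<kappa>"
    and comp_closed: "\<lbrakk>\<mu> \<in> paths \<Lambda>; \<nu> \<in> paths \<Lambda>; src \<Lambda> \<mu> = rng \<Lambda> \<nu>\<rbrakk> \<Longrightarrow> pcomp \<Lambda> \<mu> \<nu> \<in> paths \<Lambda>"
    and rng_comp: "\<lbrakk>\<mu> \<in> paths \<Lambda>; \<nu> \<in> paths \<Lambda>; src \<Lambda> \<mu> = rng \<Lambda> \<nu>\<rbrakk> \<Longrightarrow> rng \<Lambda> (pcomp \<Lambda> \<mu> \<nu>) = rng \<Lambda> \<mu>"
    and src_comp: "\<lbrakk>\<mu> \<in> paths \<Lambda>; \<nu> \<in> paths \<Lambda>; src \<Lambda> \<mu> = rng \<Lambda> \<nu>\<rbrakk> \<Longrightarrow> src \<Lambda> (pcomp \<Lambda> \<mu> \<nu>) = src \<Lambda> \<nu>"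
    and comp_rng: "\<kappa> \<in> paths \<Lambda> \<Longrightarrow> pcomp \<Lambda> (rng \<Lambda> \<kappa>) \<kappa> = \<kappa>"
    and comp_src: "\<kappa> \<in> paths \<Lambda> \<Longrightarrow> pcomp \<Lambda> \<kappa> (src \<Lambda> \<kappa>) = \<kappa>"
    and comp_assoc: "\<lbrakk>\<kappa> \<in> paths \<Lambda>; \<mu> \<in> paths \<Lambda>; \<nu> \<in> paths \<Lambda>; src \<Lambda> \<kappa> = rng \<Lambda> \<mu>; src \<Lambda> \<mu> = rng \<Lambda> \<nu>\<rbrakk>
      \<Longrightarrow> pcomp \<Lambda> (pcomp \<Lambda> \<kappa> \<mu>) \<nu> = pcomp \<Lambda> \<kappa> (pcomp \<Lambda> \<mu> \<nu>)"
    and deg_rng: "\<kappa> \<in> paths \<Lambda> \<Longrightarrow> deg \<Lambda> (rng \<Lambda> \<kappa>) = 0"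
    and deg_comp: "\<lbrakk>\<mu> \<in> paths \<Lambda>; \<nu> \<in> paths \<Lambda>; src \<Lambda> \<mu> = rng \<Lambda> \<nu>\<rbrakk>
      \<Longrightarrow> deg \<Lambda> (pcomp \<Lambda> \<mu> \<nu>) = deg \<Lambda> \<mu> + deg \<Lambda> \<nu>"
    and factorisation: "\<lbrakk>\<kappa> \<in> paths \<Lambda>; deg \<Lambda> \<kappa> = m + n\<rbrakk>
      \<Longrightarrow> \<exists>!(\<mu>, \<nu>). \<mu> \<in> paths \<Lambda> \<and> \<nu> \<in> paths \<Lambda> \<and> src \<Lambda> \<mu> = rng \<Lambda> \<nu> \<and>
            \<kappa> = pcomp \<Lambda> \<mu> \<nu> \<and> deg \<Lambda> \<mu> = m \<and> deg \<Lambda> \<nu> = n"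

definition paths_deg :: "'p two_graph_data \<Rightarrow> nat \<times> nat \<Rightarrow> 'p set" where
  "paths_deg \<Lambda> n = {\<kappa> \<in> paths \<Lambda>. deg \<Lambda> \<kappa> = n}"

definition paths_to :: "'p two_graph_data \<Rightarrow> 'p \<Rightarrow> nat \<times> nat \<Rightarrow> 'p set" where
  "paths_to \<Lambda> z n = {\<kappa> \<in> paths_deg \<Lambda> n. rng \<Lambda> \<kappa> = z}"

definition paths_between :: "'p two_graph_data \<Rightarrow> 'p \<Rightarrow> nat \<times> nat \<Rightarrow> 'p \<Rightarrow> 'p set" where
  "paths_between \<Lambda> z n x = {\<kappa> \<in> paths_to \<Lambda> z n. src \<Lambda> \<kappa> = x}"

text \<open>The join in \<open>\<nat>\<^sup>2\<close> is \<^const>\<open>sup\<close> for the componentwise order.\<close>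

definition min_ext :: "'p two_graph_data \<Rightarrow> 'p \<Rightarrow> 'p \<Rightarrow> ('p \<times> 'p) set" where
  "min_ext \<Lambda> \<mu> \<nu> = {(\<alpha>, \<beta>). \<alpha> \<in> paths \<Lambda> \<and> \<beta> \<in> paths \<Lambda> \<and> rng \<Lambda> \<mu> = rng \<Lambda> \<nu> \<and>
     src \<Lambda> \<mu> = rng \<Lambda> \<alpha> \<and> src \<Lambda> \<nu> = rng \<Lambda> \<beta> \<and>
     pcomp \<Lambda> \<mu> \<alpha> = pcomp \<Lambda> \<nu> \<beta> \<and> deg \<Lambda> (pcomp \<Lambda> \<mu> \<alpha>) = sup (deg \<Lambda> \<mu>) (deg \<Lambda> \<nu>)}"

definition remove_vertex :: "'p two_graph_data \<Rightarrow> 'p \<Rightarrow> 'p two_graph_data" where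
  "remove_vertex \<Lambda> v = \<Lambda>\<lparr>paths := {\<mu> \<in> paths \<Lambda>. src \<Lambda> \<mu> \<noteq> v}\<rparr>"


section \<open>Normed *-algebras\<close>

text \<open>
  A record of the operations of a complex, not necessarily unital, *-algebra with a (semi)norm.
\<close>

record 'a star_algebra =
  carrier :: "'a set"
  add :: "'a \<Rightarrow> 'a \<Rightarrow> 'a"  (infixl \<open>\<oplus>\<index>\<close> 65)
  zero :: 'a  (\<open>\<zero>\<index>\<close>)
  mult :: "'a \<Rightarrow> 'a \<Rightarrow> 'a"  (infixl \<open>\<otimes>\<index>\<close> 70)
  scale :: "complex \<Rightarrow> 'a \<Rightarrow> 'a"  (infixr \<open>\<odot>\<index>\<close> 75)
  adj :: "'a \<Rightarrow> 'a"
  nrm :: "'a \<Rightarrow> real"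

definition diff :: "'a star_algebra \<Rightarrow> 'a \<Rightarrow> 'a \<Rightarrow> 'a" where
  "diff A x y = x \<oplus>\<^bsub>A\<^esub> (-1) \<odot>\<^bsub>A\<^esub> y"

text \<open>The order of summation is irrelevant wherever addition is associative and commutative.\<close>

definition fsum :: "'a star_algebra \<Rightarrow> ('i \<Rightarrow> 'a) \<Rightarrow> 'i set \<Rightarrow> 'a" where
  "fsum A f I = (if finite I
     then foldr (\<lambda>i y. f i \<oplus>\<^bsub>A\<^esub> y) (SOME is. distinct is \<and> set is = I) \<zero>\<^bsub>A\<^esub> else \<zero>\<^bsub>A\<^esub>)"

definition positive :: "'a star_algebra \<Rightarrow> 'a \<Rightarrow> bool" where
  "positive A x \<longleftrightarrow> (\<exists>b\<in>carrier A. x = adj A b \<otimes>\<^bsub>A\<^esub> b)"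

definition cstar_seminorm :: "'a star_algebra \<Rightarrow> bool" where
  "cstar_seminorm A \<longleftrightarrow>
     (\<forall>x\<in>carrier A. 0 \<le> nrm A x) \<and>
     (\<forall>x\<in>carrier A. \<forall>y\<in>carrier A. nrm A (x \<oplus>\<^bsub>A\<^esub> y) \<le> nrm A x + nrm A y) \<and>
     (\<forall>c. \<forall>x\<in>carrier A. nrm A (c \<odot>\<^bsub>A\<^esub> x) = cmod c * nrm A x) \<and>
     (\<forall>x\<in>carrier A. \<forall>y\<in>carrier A. nrm A (x \<otimes>\<^bsub>A\<^esub> y) \<le> nrm A x * nrm A y) \<and>
     (\<forall>x\<in>carrier A. nrm A (adj A x \<otimes>\<^bsub>A\<^esub> x) = (nrm A x)\<^sup>2)"

text \<open>
  *-homomorphisms of C*-algebras, as functions that are \<^const>\<open>undefined\<close> off the carrier.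
  Contractivity is automatic between C*-algebras.
\<close>

definition star_hom :: "'a star_algebra \<Rightarrow> 'b star_algebra \<Rightarrow> ('a \<Rightarrow> 'b) \<Rightarrow> bool" where
  "star_hom A B \<pi> \<longleftrightarrow>
     \<pi> \<in> carrier A \<rightarrow>\<^sub>E carrier B \<and>
     (\<forall>x\<in>carrier A. \<forall>y\<in>carrier A. \<pi> (x \<oplus>\<^bsub>A\<^esub> y) = \<pi> x \<oplus>\<^bsub>B\<^esub> \<pi> y) \<and>
     (\<forall>c. \<forall>x\<in>carrier A. \<pi> (c \<odot>\<^bsub>A\<^esub> x) = c \<odot>\<^bsub>B\<^esub> \<pi> x) \<and>
     (\<forall>x\<in>carrier A. \<forall>y\<in>carrier A. \<pi> (x \<otimes>\<^bsub>A\<^esub> y) = \<pi> x \<otimes>\<^bsub>B\<^esub> \<pi> y) \<and>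
     (\<forall>x\<in>carrier A. \<pi> (adj A x) = adj B (\<pi> x)) \<and>
     (\<forall>x\<in>carrier A. nrm B (\<pi> x) \<le> nrm A x)"

subsection \<open>Hausdorff completion\<close>

text \<open>
  Cauchy sequences modulo sequences of seminorm tending to 0; elements of seminorm 0 become 0.
\<close>

definition cauchy_seqs :: "'a star_algebra \<Rightarrow> (nat \<Rightarrow> 'a) set" where
  "cauchy_seqs A = {x. (\<forall>n. x n \<in> carrier A) \<and>
     (\<forall>e>0. \<exists>N. \<forall>m\<ge>N. \<forall>n\<ge>N. nrm A (diff A (x m) (x n)) < e)}"

definition null_rel :: "'a star_algebra \<Rightarrow> ((nat \<Rightarrow> 'a) \<times> (nat \<Rightarrow> 'a)) set" where
  "null_rel A = {(x, y). x \<in> cauchy_seqs A \<and> y \<in> cauchy_seqs A \<and>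
     (\<lambda>n. nrm A (diff A (x n) (y n))) \<longlonglongrightarrow> 0}"

definition seq_class :: "'a star_algebra \<Rightarrow> (nat \<Rightarrow> 'a) \<Rightarrow> (nat \<Rightarrow> 'a) set" where
  "seq_class A x = null_rel A `` {x}"

definition completion :: "'a star_algebra \<Rightarrow> (nat \<Rightarrow> 'a) set star_algebra" where
  "completion A = \<lparr>
     carrier = cauchy_seqs A // null_rel A,
     add = (\<lambda>X Y. \<Union>x\<in>X. \<Union>y\<in>Y. seq_class A (\<lambda>n. x n \<oplus>\<^bsub>A\<^esub> y n)),
     zero = seq_class A (\<lambda>n. \<zero>\<^bsub>A\<^esub>),
     mult = (\<lambda>X Y. \<Union>x\<in>X. \<Union>y\<in>Y. seq_class A (\<lambda>n. x n \<otimes>\<^bsub>A\<^esub> y n)),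
     scale = (\<lambda>c X. \<Union>x\<in>X. seq_class A (\<lambda>n. c \<odot>\<^bsub>A\<^esub> x n)),
     adj = (\<lambda>X. \<Union>x\<in>X. seq_class A (\<lambda>n. adj A (x n))),
     nrm = (\<lambda>X. THE l. \<forall>x\<in>X. (\<lambda>n. nrm A (x n)) \<longlonglongrightarrow> l)\<rparr>"

definition embed :: "'a star_algebra \<Rightarrow> 'a \<Rightarrow> (nat \<Rightarrow> 'a) set" where
  "embed A a = seq_class A (\<lambda>n. a)"

subsection \<open>The free *-algebra\<close>

text \<open>
  A letter \<open>(g, False)\<close> stands for the generator \<open>g\<close> and \<open>(g, True)\<close> for its formal adjoint.
  Words form an additive monoid under concatenation, so that the multiplication of
  finitely supported functions \<open>'g star_word \<Rightarrow>\<^sub>0 complex\<close> is that of noncommutative polynomials.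
\<close>

datatype 'g star_word = Word (letters: "('g \<times> bool) list")

instantiation star_word :: (type) monoid_add
begin
definition "0 = Word []"
definition "v + w = Word (letters v @ letters w)"
instance by standard (simp_all add: zero_star_word_def plus_star_word_def)
end

type_synonym 'g star_poly = "'g star_word \<Rightarrow>\<^sub>0 complex"

definition word_adj :: "'g star_word \<Rightarrow> 'g star_word" where
  "word_adj w = Word (rev (map (\<lambda>(g, b). (g, \<not> b)) (letters w)))"

definition gen :: "'g \<Rightarrow> 'g star_poly" where
  "gen g = Poly_Mapping.single (Word [(g, False)]) 1"

text \<open>
  The free *-algebra without unit: the empty word does not occur. (With a unit, the universal
  algebra below would acquire an additional unit.)
\<close>

definition free_star_algebra :: "'g set \<Rightarrow> ('g star_poly \<Rightarrow> real) \<Rightarrow> 'g star_poly star_algebra" where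
  "free_star_algebra G p = \<lparr>
     carrier = {x. \<forall>w\<in>Poly_Mapping.keys x. letters w \<noteq> [] \<and> fst ` set (letters w) \<subseteq> G},
     add = (+),
     zero = 0,
     mult = (*),
     scale = (\<lambda>c x. Poly_Mapping.single 0 c * x),
     adj = (\<lambda>x. Poly_Mapping.map cnj (Poly_Mapping.map_key word_adj x)),
     nrm = p\<rparr>"


section \<open>The Toeplitz algebra of a 2-graph\<close>

text \<open>
  The relation \<open>t\<^sub>z \<ge> \<Sum>\<^bsub>\<kappa> \<in> z\<Lambda>\<^sup>n\<^esub> t\<^sub>\<kappa> t\<^sub>\<kappa>\<^sup>*\<close> is imposed for the sums over finite subsets of \<open>z\<Lambda>\<^sup>n\<close>;
  if \<open>z\<Lambda>\<^sup>n\<close> is finite this amounts to the whole sum. The sum over \<^const>\<open>min_ext\<close> is finite whenever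
  all \<open>z\<Lambda>\<^sup>n\<close> are finite.
\<close>

definition toeplitz_family :: "'p two_graph_data \<Rightarrow> 'a star_algebra \<Rightarrow> ('p \<Rightarrow> 'a) \<Rightarrow> bool" where
  "toeplitz_family \<Lambda> A t \<longleftrightarrow>
     (\<forall>\<kappa>\<in>paths \<Lambda>. t \<kappa> \<in> carrier A \<and> t \<kappa> \<otimes>\<^bsub>A\<^esub> adj A (t \<kappa>) \<otimes>\<^bsub>A\<^esub> t \<kappa> = t \<kappa>) \<and>
     (\<forall>z\<in>paths_deg \<Lambda> 0. adj A (t z) = t z \<and> t z \<otimes>\<^bsub>A\<^esub> t z = t z) \<and>
     (\<forall>z\<in>paths_deg \<Lambda> 0. \<forall>x\<in>paths_deg \<Lambda> 0. z \<noteq> x \<longrightarrow> t z \<otimes>\<^bsub>A\<^esub> t x = \<zero>\<^bsub>A\<^esub>) \<and>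
     (\<forall>\<kappa>\<in>paths \<Lambda>. \<forall>\<mu>\<in>paths \<Lambda>. src \<Lambda> \<kappa> = rng \<Lambda> \<mu> \<longrightarrow> t \<kappa> \<otimes>\<^bsub>A\<^esub> t \<mu> = t (pcomp \<Lambda> \<kappa> \<mu>)) \<and>
     (\<forall>\<kappa>\<in>paths \<Lambda>. adj A (t \<kappa>) \<otimes>\<^bsub>A\<^esub> t \<kappa> = t (src \<Lambda> \<kappa>)) \<and>
     (\<forall>z\<in>paths_deg \<Lambda> 0. \<forall>n. \<forall>F. finite F \<and> F \<subseteq> paths_to \<Lambda> z n \<longrightarrow>
        positive A (diff A (t z) (fsum A (\<lambda>\<kappa>. t \<kappa> \<otimes>\<^bsub>A\<^esub> adj A (t \<kappa>)) F))) \<and>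
     (\<forall>\<mu>\<in>paths \<Lambda>. \<forall>\<nu>\<in>paths \<Lambda>.
        adj A (t \<mu>) \<otimes>\<^bsub>A\<^esub> t \<nu> = fsum A (\<lambda>(\<alpha>, \<beta>). t \<alpha> \<otimes>\<^bsub>A\<^esub> adj A (t \<beta>)) (min_ext \<Lambda> \<mu> \<nu>))"

text \<open>
  The universal C*-algebra generated by a Toeplitz family: a C*-algebra generated by a
  Toeplitz family is the completion of the free *-algebra in the C*-seminorm that it induces, and
  the universal one belongs to the supremum of all these seminorms.
\<close>

definition toeplitz_seminorms :: "'p two_graph_data \<Rightarrow> ('p star_poly \<Rightarrow> real) set" where
  "toeplitz_seminorms \<Lambda> = {p. let F = free_star_algebra (paths \<Lambda>) p in
     cstar_seminorm F \<and> toeplitz_family \<Lambda> (completion F) (\<lambda>\<mu>. embed F (gen \<mu>))}"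

definition toeplitz_free :: "'p two_graph_data \<Rightarrow> 'p star_poly star_algebra" where
  "toeplitz_free \<Lambda> = free_star_algebra (paths \<Lambda>) (\<lambda>x. SUP p\<in>toeplitz_seminorms \<Lambda>. p x)"

definition toeplitz_algebra :: "'p two_graph_data \<Rightarrow> (nat \<Rightarrow> 'p star_poly) set star_algebra" where
  "toeplitz_algebra \<Lambda> = completion (toeplitz_free \<Lambda>)"

definition toeplitz_gen :: "'p two_graph_data \<Rightarrow> 'p \<Rightarrow> (nat \<Rightarrow> 'p star_poly) set" where
  "toeplitz_gen \<Lambda> \<mu> = embed (toeplitz_free \<Lambda>) (gen \<mu>)"

definition remove_vertex_hom ::
    "'p two_graph_data \<Rightarrow> 'p \<Rightarrow> (nat \<Rightarrow> 'p star_poly) set \<Rightarrow> (nat \<Rightarrow> 'p star_poly) set" where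
  "remove_vertex_hom \<Lambda> v =
     (let A = toeplitz_algebra \<Lambda>; B = toeplitz_algebra (remove_vertex \<Lambda> v) in
      THE q. star_hom A B q \<and>
        (\<forall>\<mu>\<in>paths \<Lambda>. q (toeplitz_gen \<Lambda> \<mu>) =
           (if src \<Lambda> \<mu> = v then \<zero>\<^bsub>B\<^esub> else toeplitz_gen (remove_vertex \<Lambda> v) \<mu>)))"

definition deg_weight :: "real \<times> real \<Rightarrow> nat \<times> nat \<Rightarrow> real" where
  "deg_weight r n = fst r * real (fst n) + snd r * real (snd n)"

definition toeplitz_dynamics :: "'p two_graph_data \<Rightarrow> real \<times> real \<Rightarrow> real \<Rightarrow>
    (nat \<Rightarrow> 'p star_poly) set \<Rightarrow> (nat \<Rightarrow> 'p star_poly) set" where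
  "toeplitz_dynamics \<Lambda> r t =
     (let A = toeplitz_algebra \<Lambda>; T = toeplitz_gen \<Lambda> in
      THE \<alpha>. star_hom A A \<alpha> \<and> bij_betw \<alpha> (carrier A) (carrier A) \<and>
        (\<forall>\<mu>\<in>paths \<Lambda>. \<forall>\<nu>\<in>paths \<Lambda>. \<alpha> (T \<mu> \<otimes>\<^bsub>A\<^esub> adj A (T \<nu>)) =
           exp (\<i> * of_real (t * (deg_weight r (deg \<Lambda> \<mu>) - deg_weight r (deg \<Lambda> \<nu>)))) \<odot>\<^bsub>A\<^esub>
             (T \<mu> \<otimes>\<^bsub>A\<^esub> adj A (T \<nu>))))"


section \<open>KMS states\<close>

text \<open>States are positive linear functionals of norm 1, \<^const>\<open>undefined\<close> off the carrier.\<close>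

definition state :: "'a star_algebra \<Rightarrow> ('a \<Rightarrow> complex) \<Rightarrow> bool" where
  "state A \<phi> \<longleftrightarrow>
     \<phi> \<in> extensional (carrier A) \<and>
     (\<forall>x\<in>carrier A. \<forall>y\<in>carrier A. \<phi> (x \<oplus>\<^bsub>A\<^esub> y) = \<phi> x + \<phi> y) \<and>
     (\<forall>c. \<forall>x\<in>carrier A. \<phi> (c \<odot>\<^bsub>A\<^esub> x) = c * \<phi> x) \<and>
     (\<forall>x. x \<in> carrier A \<and> positive A x \<longrightarrow> \<phi> x \<in> \<real>\<^sub>\<ge>\<^sub>0) \<and>
     bdd_above ((\<lambda>x. cmod (\<phi> x)) ` {x \<in> carrier A. nrm A x \<le> 1}) \<and>
     (SUP x\<in>{x \<in> carrier A. nrm A x \<le> 1}. cmod (\<phi> x)) = 1"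

definition entire :: "'a star_algebra \<Rightarrow> (complex \<Rightarrow> 'a) \<Rightarrow> bool" where
  "entire A f \<longleftrightarrow> (\<forall>z. f z \<in> carrier A) \<and>
     (\<forall>z. \<exists>D\<in>carrier A.
        ((\<lambda>h. nrm A (diff A ((1 / h) \<odot>\<^bsub>A\<^esub> diff A (f (z + h)) (f z)) D)) \<longlongrightarrow> 0) (at 0))"

text \<open>\<open>f\<close> is the entire function \<open>z \<mapsto> \<alpha>\<^sub>z(a)\<close>.\<close>

definition analytic_extension ::
    "'a star_algebra \<Rightarrow> (real \<Rightarrow> 'a \<Rightarrow> 'a) \<Rightarrow> 'a \<Rightarrow> (complex \<Rightarrow> 'a) \<Rightarrow> bool" where
  "analytic_extension A \<alpha> a f \<longleftrightarrow>
     a \<in> carrier A \<and> entire A f \<and> (\<forall>t. f (of_real t) = \<alpha> t a)"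

definition analytic_element :: "'a star_algebra \<Rightarrow> (real \<Rightarrow> 'a \<Rightarrow> 'a) \<Rightarrow> 'a \<Rightarrow> bool" where
  "analytic_element A \<alpha> a \<longleftrightarrow> (\<exists>f. analytic_extension A \<alpha> a f)"

definition kms_state ::
    "'a star_algebra \<Rightarrow> (real \<Rightarrow> 'a \<Rightarrow> 'a) \<Rightarrow> real \<Rightarrow> ('a \<Rightarrow> complex) \<Rightarrow> bool" where
  "kms_state A \<alpha> \<beta> \<phi> \<longleftrightarrow> state A \<phi> \<and>
     (\<forall>a b f. analytic_extension A \<alpha> a f \<and> analytic_element A \<alpha> b \<longrightarrow>
        \<phi> (a \<otimes>\<^bsub>A\<^esub> b) = \<phi> (b \<otimes>\<^bsub>A\<^esub> f (\<i> * of_real \<beta>)))"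

text \<open>As a family: in particular \<open>x \<noteq> y\<close>.\<close>

definition rationally_independent :: "real \<Rightarrow> real \<Rightarrow> bool" where
  "rationally_independent x y \<longleftrightarrow>
     (\<forall>p q :: rat. of_rat p * x + of_rat q * y = 0 \<longrightarrow> p = 0 \<and> q = 0)"

end

theory Submission
  imports Defs "HOL-Complex_Analysis.Complex_Analysis" "HOL-Real_Asymp.Real_Asymp"
begin

text \<open>
  The elements \<open>t\<^sub>\<mu> t\<^sub>\<nu>\<^sup>*\<close> span a dense subspace. The KMS condition for \<open>t\<^sub>\<mu>\<close> and \<open>t\<^sub>\<nu>\<^sup>*\<close>, together with
  rational independence, forces \<open>\<phi>(t\<^sub>\<mu> t\<^sub>\<nu>\<^sup>*) = \<delta>\<^sub>\<mu>\<^sub>\<nu> e\<^bsup>-r\<sqdot>d(\<mu>)\<^esup> \<phi>(t\<^bsub>s(\<mu>)\<^esub>)\<close>, so a KMS state is determined by its values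
  on the vertices. If \<open>r\<^sub>i = ln d\<^sub>i\<close>, then \<open>t\<^sub>u \<ge> \<Sum> t\<^sub>\<kappa> t\<^sub>\<kappa>\<^sup>*\<close> over \<open>\<kappa> \<in> u\<Lambda>\<^bsup>e\<^sub>i\<^esup>\<close> reads
  \<open>\<phi>(t\<^sub>u) \<ge> \<phi>(t\<^sub>u) + (a\<^sub>i / d\<^sub>i) \<phi>(t\<^sub>v)\<close>, whence \<open>\<phi>(t\<^sub>v) = 0\<close>. Existence on the subgraph at \<open>u\<close> comes from averaging
  the vector states of the path representation over growing boxes of paths; a *-homomorphism
  then pulls the resulting state back to the whole graph. All maps and functionals are constructed on
  the free *-algebra and extended to the completion by contractivity.
\<close>

section \<open>The free *-algebra\<close>

text \<open>The universal norm is a supremum over all Toeplitz seminorms and comes with no concrete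
  model, so contractivity is the recurring obstacle. It has two sources. A map of generators along
  which every Toeplitz seminorm pulls back to a Toeplitz seminorm is bounded by the supremum. A
  functional dominated by one particular Toeplitz seminorm, the operator norm of the path
  representation, is dominated by the universal one. When r_i = ln d_i the Gibbs sum over all paths
  diverges, which is why it is truncated and normalised; the averages become KMS in the limit
  because geometric sums of ratio at most 1 grow too slowly for the boundary to matter. No
  compactness is involved: distinct degrees have distinct weights by rational independence, and this
  makes the averages of every spanning element converge. The algebra is not presented with a unit,
  so in the uniqueness proof the value at t_u is fixed by comparing norms of functionals. Finally, v
  receives no edges, hence every path with range v has source v; this makes the indicator of the
  paths with source other than v multiplicative, and that indicator induces the quotient
  map.\<close>

abbreviation (input) "lookup \<equiv> Poly_Mapping.lookup"
abbreviation (input) "single \<equiv> Poly_Mapping.single"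
abbreviation (input) "keys \<equiv> Poly_Mapping.keys"

text \<open>The empty word is the zero of the monoid of words, so \<open>single 0 c\<close> is the
  constant polynomial c. For nonzero c it lies outside \<open>polys G\<close>, but multiplication by
  it maps \<open>polys G\<close> into itself.\<close>

abbreviation smul :: "complex \<Rightarrow> 'g star_poly \<Rightarrow> 'g star_poly" (infixr \<open>\<cdot>\<close> 75)
  where "c \<cdot> x \<equiv> single 0 c * x"

definition words :: "'g set \<Rightarrow> 'g star_word set" where
  "words G = {w. letters w \<noteq> [] \<and> fst ` set (letters w) \<subseteq> G}"

definition polys :: "'g set \<Rightarrow> 'g star_poly set" where
  "polys G = {x. keys x \<subseteq> words G}"

definition padj :: "'g star_poly \<Rightarrow> 'g star_poly" where
  "padj x = Poly_Mapping.map cnj (Poly_Mapping.map_key word_adj x)"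

lemma free_star_algebra_simps [simp]:
  "carrier (free_star_algebra G p) = polys G"
  "add (free_star_algebra G p) = (+)"
  "zero (free_star_algebra G p) = 0"
  "mult (free_star_algebra G p) = (*)"
  "scale (free_star_algebra G p) = (\<lambda>c x. c \<cdot> x)"
  "adj (free_star_algebra G p) = padj"
  "nrm (free_star_algebra G p) = p"
  by (auto simp: free_star_algebra_def polys_def words_def padj_def fun_eq_iff)

lemma lookup_smul: "lookup (c \<cdot> x) w = c * lookup x w"
  by (auto simp: mult_map_scale_conv_mult [symmetric] Poly_Mapping.map.rep_eq when_def)

lemma smul_minus_one: "(-1) \<cdot> x = - x"
  by (rule poly_mapping_eqI) (simp add: lookup_smul)

lemma diff_free [simp]: "diff (free_star_algebra G p) x y = x - y"
  by (simp add: diff_def smul_minus_one)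

lemma word_adj_invol [simp]: "word_adj (word_adj w) = w"
  by (cases w) (simp add: word_adj_def rev_map o_def case_prod_beta)

lemma inj_word_adj: "inj word_adj"
  by (metis injI word_adj_invol)

lemma lookup_padj: "lookup (padj x) w = cnj (lookup x (word_adj w))"
  by (auto simp: padj_def Poly_Mapping.map.rep_eq Poly_Mapping.map_key.rep_eq[OF inj_word_adj] when_def)

lemma word_adj_add: "word_adj (v + w) = word_adj w + word_adj v"
  by (simp add: word_adj_def plus_star_word_def)

lemma padj_add: "padj (x + y) = padj x + padj y"
  by (rule poly_mapping_eqI) (simp add: lookup_padj lookup_add)

lemma padj_0 [simp]: "padj 0 = 0"
  by (rule poly_mapping_eqI) (simp add: lookup_padj)

lemma padj_diff: "padj (x - y) = padj x - padj y"
  by (rule poly_mapping_eqI) (simp add: lookup_padj lookup_minus)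

lemma padj_sum: "padj (sum f I) = (\<Sum>i\<in>I. padj (f i))"
  by (induction I rule: infinite_finite_induct) (auto simp: padj_add)

lemma padj_invol [simp]: "padj (padj x) = x"
  by (rule poly_mapping_eqI) (simp add: lookup_padj)

lemma padj_single: "padj (single w a) = single (word_adj w) (cnj a)"
  by (rule poly_mapping_eqI) (auto simp: lookup_padj lookup_single when_def)

section \<open>Monomial expansions and induction over monomials\<close>

lemma poly_expansion: "(x :: 'g star_poly) = (\<Sum>w\<in>keys x. single w (lookup x w))"
proof (rule poly_mapping_eqI)
  fix k
  have "lookup (\<Sum>w\<in>keys x. single w (lookup x w)) k = (\<Sum>w\<in>keys x. if w = k then lookup x k else 0)"
    unfolding lookup_sum by (rule sum.cong) (auto simp: lookup_single when_def)
  also have "\<dots> = lookup x k"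
    by (auto simp: in_keys_iff)
  finally show "lookup x k = lookup (\<Sum>w\<in>keys x. single w (lookup x w)) k" by simp
qed

lemma poly_induct [consumes 1, case_names zero add]:
  assumes "x \<in> polys G" and "P 0"
    and "\<And>x w a. x \<in> polys G \<Longrightarrow> P x \<Longrightarrow> w \<in> words G \<Longrightarrow> P (x + single w a)"
  shows "P x"
proof -
  have "(\<Sum>w\<in>S. single w (lookup x w)) \<in> polys G \<and> P (\<Sum>w\<in>S. single w (lookup x w))"
    if "finite S" "S \<subseteq> words G" for S
    using that
  proof (induction S rule: finite_induct)
    case (insert w S)
    have "y + single w a \<in> polys G" if "y \<in> polys G" for y :: "'a star_poly" and a
    proof -
      have "keys (y + single w a) \<subseteq> keys y \<union> {w}"
        using keys_add[of y "single w a"] by (auto split: if_splits)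
      then show ?thesis using that insert.prems by (auto simp: polys_def)
    qed
    then show ?case
      using insert assms(3)[of "\<Sum>w\<in>S. single w (lookup x w)" w]
      by (simp add: add.commute[of "single _ _"])
  qed (use assms in \<open>simp_all add: polys_def\<close>)
  from this[of "keys x"] show ?thesis using assms(1) by (simp add: polys_def poly_expansion[symmetric])
qed

text \<open>Unlike \<open>poly_induct\<close> this ranges over polynomials with a constant term as
  well, as is needed for identities in which a scalar \<open>single 0 c\<close> occurs as a
  factor.\<close>

lemma poly_induct_all [case_names zero add]:
  fixes x :: "'g star_poly"
  assumes "P 0" and "\<And>x w a. P x \<Longrightarrow> P (x + single w a)"
  shows "P x"
proof -
  have "P (\<Sum>w\<in>S. single w (lookup x w))" if "finite S" for S
    using that by (induction S rule: finite_induct) (auto simp: assms add.commute[of "single _ _"])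
  then show ?thesis by (subst poly_expansion) simp
qed

text \<open>Both sides are additive in \<open>x\<close> and in \<open>y\<close>, so two inductions
  over monomials reduce the claim to products of single words. The multiplicativity of
  \<open>padj\<close>, \<open>twist\<close> and \<open>rep\<close> is obtained this way.\<close>

lemma poly_mult_eqI:
  fixes h :: "'g star_poly \<Rightarrow> 'b::ab_group_add"
  assumes h: "\<And>x y. h (x + y) = h x + h y"
    and k1: "\<And>x y z. k (x + y) z = k x z + k y z"
    and k2: "\<And>x y z. k z (x + y) = k z x + k z y"
    and s: "\<And>v w a b. h (single v a * single w b) = k (single v a) (single w b)"
  shows "h (x * y) = k x y"
proof -
  have h0: "h 0 = 0" using h[of 0 0] by simp
  have k01: "k 0 z = 0" for z using k1[of 0 0 z] by simp
  have k02: "k z 0 = 0" for z using k2[of z 0 0] by simp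
  have "h (single v a * y) = k (single v a) y" for v a
    by (induction y rule: poly_induct_all) (auto simp: h0 k02 h k2 s distrib_left)
  then show ?thesis
    by (induction x rule: poly_induct_all) (auto simp: h0 k01 h k1 distrib_right)
qed

lemma padj_mult: "padj (x * y) = padj y * padj x"
  by (rule poly_mult_eqI)
    (auto simp: padj_add distrib_left distrib_right padj_single mult_single word_adj_add mult.commute)

text \<open>Constants are central: the empty word is neutral on both sides and the coefficients
  commute.\<close>

lemma mult_scalar_commute: "x * single 0 c = c \<cdot> x"
  by (rule poly_mult_eqI[of "\<lambda>x. x" "\<lambda>x y. y * x" x "single 0 c", THEN trans]
      poly_induct_all[of "\<lambda>x. x * single 0 c = single 0 c * x"])
    (auto simp: distrib_left distrib_right mult_single mult.commute)

lemma mult_smul: "x * (c \<cdot> y) = c \<cdot> (x * y)"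
  by (metis mult_scalar_commute mult.assoc)

lemma smul_smul: "c \<cdot> d \<cdot> x = (c * d) \<cdot> x"
  by (simp add: mult.assoc[symmetric] mult_single)

lemma smul_one [simp]: "1 \<cdot> x = x"
  by (rule poly_mapping_eqI) (simp add: lookup_smul)

lemma smul_zero [simp]: "0 \<cdot> x = 0"
  by simp

lemma smul_diff_left: "(c - d) \<cdot> x = c \<cdot> x - d \<cdot> x"
  by (simp add: single_diff left_diff_distrib)

lemma smul_single: "c \<cdot> single w a = single w (c * a)"
  by (simp add: mult_single)

lemma padj_smul: "padj (c \<cdot> x) = cnj c \<cdot> padj x"
  by (rule poly_mapping_eqI) (simp add: lookup_padj lookup_smul)

section \<open>Closure properties of the polynomials without constant term\<close>

lemma zero_polys [simp, intro]: "0 \<in> polys G"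
  by (simp add: polys_def)

lemma add_polys [simp, intro]: "x \<in> polys G \<Longrightarrow> y \<in> polys G \<Longrightarrow> x + y \<in> polys G"
  using keys_add[of x y] by (auto simp: polys_def)

lemma uminus_polys [simp, intro]: "x \<in> polys G \<Longrightarrow> - x \<in> polys G"
  by (auto simp: polys_def in_keys_iff)

lemma diff_polys [simp, intro]: "x \<in> polys G \<Longrightarrow> y \<in> polys G \<Longrightarrow> x - y \<in> polys G"
  using add_polys[of x G "- y"] by simp

lemma smul_polys [simp, intro]: "x \<in> polys G \<Longrightarrow> c \<cdot> x \<in> polys G"
  by (auto simp: polys_def in_keys_iff lookup_smul)

lemma sum_polys [simp, intro]: "(\<And>i. i \<in> I \<Longrightarrow> f i \<in> polys G) \<Longrightarrow> sum f I \<in> polys G"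
  by (induction I rule: infinite_finite_induct) auto

lemma words_add: "v \<in> words G \<Longrightarrow> w \<in> words G \<Longrightarrow> v + w \<in> words G"
  by (auto simp: words_def plus_star_word_def)

lemma mult_polys [simp, intro]:
  assumes "x \<in> polys G" "y \<in> polys G"
  shows "x * y \<in> polys G"
proof -
  have "keys (x * y) \<subseteq> {a + b |a b. a \<in> keys x \<and> b \<in> keys y}" by (rule keys_mult)
  then show ?thesis using assms by (auto simp: polys_def intro!: words_add)
qed

lemma word_adj_words [simp]: "word_adj w \<in> words G \<longleftrightarrow> w \<in> words G"
  by (force simp: words_def word_adj_def)

lemma padj_polys [simp, intro]: "x \<in> polys G \<Longrightarrow> padj x \<in> polys G"
  by (auto simp: polys_def in_keys_iff lookup_padj subset_iff) 

lemma single_polys [simp, intro]: "w \<in> words G \<Longrightarrow> single w a \<in> polys G"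
  by (auto simp: polys_def)

lemma gen_polys [simp, intro]: "g \<in> G \<Longrightarrow> gen g \<in> polys G"
  by (auto simp: gen_def words_def)

lemma padj_gen: "padj (gen g) = single (Word [(g, True)]) 1"
  by (simp add: gen_def padj_single word_adj_def)

section \<open>Hausdorff completions\<close>

text \<open>The operations of \<open>completion\<close> are unions over representatives; once the
  choice of representative is seen not to matter, the union collapses to a single class.\<close>

lemma UN_eq_const: "x \<in> X \<Longrightarrow> (\<And>y. y \<in> X \<Longrightarrow> f y = c) \<Longrightarrow> (\<Union>y\<in>X. f y) = c"
  by auto

text \<open>Only values on the carrier are constrained, so that maps obtained by composition, such
  as X \<mapsto> L (A X), qualify without being restricted first; the bound K is existential because
  such compositions change it.\<close>

definition bounded_functional :: "'a star_algebra \<Rightarrow> ('a \<Rightarrow> complex) \<Rightarrow> bool" where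
  "bounded_functional A L \<longleftrightarrow>
     (\<forall>x\<in>carrier A. \<forall>y\<in>carrier A. L (x \<oplus>\<^bsub>A\<^esub> y) = L x + L y) \<and>
     (\<forall>c. \<forall>x\<in>carrier A. L (c \<odot>\<^bsub>A\<^esub> x) = c * L x) \<and>
     (\<exists>K\<ge>0. \<forall>x\<in>carrier A. cmod (L x) \<le> K * nrm A x)"

locale cstar_seminormed =
  fixes G :: "'g set" and p :: "'g star_poly \<Rightarrow> real"
  assumes cstar: "cstar_seminorm (free_star_algebra G p)"
begin

abbreviation "F \<equiv> free_star_algebra G p"
abbreviation "C \<equiv> completion F"
abbreviation "emb \<equiv> embed F"

section \<open>Arithmetic of a C*-seminorm\<close>

lemma nonneg: "x \<in> polys G \<Longrightarrow> 0 \<le> p x"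
  and triangle: "x \<in> polys G \<Longrightarrow> y \<in> polys G \<Longrightarrow> p (x + y) \<le> p x + p y"
  and smul: "x \<in> polys G \<Longrightarrow> p (c \<cdot> x) = cmod c * p x"
  and submult: "x \<in> polys G \<Longrightarrow> y \<in> polys G \<Longrightarrow> p (x * y) \<le> p x * p y"
  and cstar_identity: "x \<in> polys G \<Longrightarrow> p (padj x * x) = (p x)\<^sup>2"
  using cstar by (auto simp: cstar_seminorm_def)

lemma zero [simp]: "p 0 = 0"
  using smul[of 0 0] by simp

lemma minus: "x \<in> polys G \<Longrightarrow> p (- x) = p x"
  using smul[of x "-1"] by (simp add: smul_minus_one)

lemma diff_commute: "x \<in> polys G \<Longrightarrow> y \<in> polys G \<Longrightarrow> p (x - y) = p (y - x)"
  using minus[of "x - y"] by simp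

lemma triangle3:
  "x \<in> polys G \<Longrightarrow> y \<in> polys G \<Longrightarrow> z \<in> polys G \<Longrightarrow> p (x - z) \<le> p (x - y) + p (y - z)"
  using triangle[of "x - y" "y - z"] by simp

lemma abs_diff_le: "x \<in> polys G \<Longrightarrow> y \<in> polys G \<Longrightarrow> \<bar>p x - p y\<bar> \<le> p (x - y)"
  using triangle[of "x - y" y] triangle[of "y - x" x] diff_commute[of x y] by simp

text \<open>The C*-identity and submultiplicativity give p(x)^2 \<le> p(\<open>padj x\<close>) p(x).
  Applied to \<open>x\<close> and to \<open>padj x\<close> this shows that the adjoint is
  isometric.\<close>

lemma padj_le: "x \<in> polys G \<Longrightarrow> p x \<le> p (padj x)"
proof -
  assume x: "x \<in> polys G"
  have "(p x)\<^sup>2 \<le> p (padj x) * p x"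
    using submult[of "padj x" x] cstar_identity[of x] x by simp
  then show ?thesis
    using nonneg[OF x] nonneg[OF padj_polys[OF x]]
    by (cases "p x = 0") (auto simp: power2_eq_square)
qed

lemma norm_padj: "x \<in> polys G \<Longrightarrow> p (padj x) = p x"
  using padj_le[of x] padj_le[of "padj x"] by simp

lemma sum_le: "(\<And>i. i \<in> I \<Longrightarrow> f i \<in> polys G) \<Longrightarrow> p (sum f I) \<le> (\<Sum>i\<in>I. p (f i))"
proof (induction I rule: infinite_finite_induct)
  case (insert i I)
  then show ?case using triangle[of "f i" "sum f I"] by fastforce
qed simp_all

section \<open>Cauchy sequences of polynomials\<close>

lemma cauchy_iff:
  "x \<in> cauchy_seqs F \<longleftrightarrow>
     (\<forall>n. x n \<in> polys G) \<and> (\<forall>e>0. \<exists>N. \<forall>m\<ge>N. \<forall>n\<ge>N. p (x m - x n) < e)"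
  by (simp add: cauchy_seqs_def)

lemma cauchy_polys: "x \<in> cauchy_seqs F \<Longrightarrow> x n \<in> polys G"
  by (simp add: cauchy_iff)

lemma cauchy_const [simp, intro]: "a \<in> polys G \<Longrightarrow> (\<lambda>n. a) \<in> cauchy_seqs F"
  by (auto simp: cauchy_iff)

lemma cauchy_convergent_nrm:
  assumes "x \<in> cauchy_seqs F"
  shows "convergent (\<lambda>n. p (x n))"
proof -
  have "Cauchy (\<lambda>n. p (x n))"
  proof (rule metric_CauchyI)
    fix e :: real assume "e > 0"
    then obtain N where N: "\<forall>m\<ge>N. \<forall>n\<ge>N. p (x m - x n) < e"
      using assms unfolding cauchy_iff by blast
    have "dist (p (x m)) (p (x n)) < e" if "m \<ge> N" "n \<ge> N" for m n
      using abs_diff_le[of "x m" "x n"] N that cauchy_polys[OF assms] by (fastforce simp: dist_real_def)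
    then show "\<exists>M. \<forall>m\<ge>M. \<forall>n\<ge>M. dist (p (x m)) (p (x n)) < e" by blast
  qed
  then show ?thesis by (simp add: Cauchy_convergent_iff)
qed

lemma cauchy_bounded:
  assumes "x \<in> cauchy_seqs F"
  obtains K where "K > 0" "\<And>n. p (x n) \<le> K"
proof -
  have "Bseq (\<lambda>n. p (x n))"
    using cauchy_convergent_nrm[OF assms] by (simp add: convergent_imp_Bseq)
  then obtain K where "K > 0" "\<forall>n. norm (p (x n)) \<le> K" by (auto elim: BseqE)
  then show ?thesis using that[of K] by (auto simp: abs_le_iff)
qed

text \<open>The operations of the algebra are Lipschitz along bounded sequences, so each closure
  property of Cauchy sequences amounts to a choice of the constant \<open>K\<close> and of the
  double sequence \<open>b\<close>.\<close>

lemma cauchyI_dominated: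
  assumes "\<And>n. y n \<in> polys G" and "0 \<le> K"
    and "\<And>m n. p (y m - y n) \<le> K * (b m n)"
    and "\<And>e. e > 0 \<Longrightarrow> \<exists>N. \<forall>m\<ge>N. \<forall>n\<ge>N. b m n < (e::real)"
  shows "y \<in> cauchy_seqs F"
  unfolding cauchy_iff
proof (intro conjI allI impI)
  fix e :: real assume e: "e > 0"
  \<comment> \<open>Dividing by \<open>K + 1\<close> instead of \<open>K\<close> covers the case
    \<open>K = 0\<close>.\<close>
  then obtain N where N: "\<forall>m\<ge>N. \<forall>n\<ge>N. b m n < e / (K + 1)"
    using assms(2) assms(4)[of "e / (K + 1)"] by auto
  have "p (y m - y n) < e" if "m \<ge> N" "n \<ge> N" for m n
  proof -
    have *: "b m n < e / (K + 1)" using N that by blast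
    have "p (y m - y n) \<le> K * b m n" by (rule assms(3))
    also have "\<dots> \<le> K * (e / (K + 1))" using * assms(2) by (intro mult_left_mono) auto
    also have "\<dots> < e" using e assms(2) by (simp add: field_simps)
    finally show ?thesis .
  qed
  then show "\<exists>N. \<forall>m\<ge>N. \<forall>n\<ge>N. p (y m - y n) < e" by blast
qed (use assms in auto)

lemma cauchy_sum_small:
  assumes "x \<in> cauchy_seqs F" "y \<in> cauchy_seqs F" "e > 0"
  shows "\<exists>N. \<forall>m\<ge>N. \<forall>n\<ge>N. p (x m - x n) + p (y m - y n) < e"
proof -
  obtain N M where N: "\<forall>m\<ge>N. \<forall>n\<ge>N. p (x m - x n) < e / 2" and M: "\<forall>m\<ge>M. \<forall>n\<ge>M. p (y m - y n) < e / 2"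
    using assms unfolding cauchy_iff by (meson half_gt_zero)
  have "p (x m - x n) + p (y m - y n) < e" if "m \<ge> max N M" "n \<ge> max N M" for m n
    using that N[rule_format, of m n] M[rule_format, of m n] by simp
  then show ?thesis by blast
qed

lemma cauchy_add:
  assumes "x \<in> cauchy_seqs F" "y \<in> cauchy_seqs F"
  shows "(\<lambda>n. x n + y n) \<in> cauchy_seqs F"
proof (rule cauchyI_dominated[where K = 1 and b = "\<lambda>m n. p (x m - x n) + p (y m - y n)"])
  fix m n
  show "p (x m + y m - (x n + y n)) \<le> 1 * (p (x m - x n) + p (y m - y n))"
    using triangle[of "x m - x n" "y m - y n"] assms by (simp add: cauchy_polys algebra_simps)
qed (use assms cauchy_sum_small in \<open>auto intro: cauchy_polys\<close>)

lemma cauchy_smul: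
  assumes "x \<in> cauchy_seqs F"
  shows "(\<lambda>n. c \<cdot> x n) \<in> cauchy_seqs F"
proof (rule cauchyI_dominated[where K = "cmod c" and b = "\<lambda>m n. p (x m - x n)"])
  fix m n
  show "p (c \<cdot> x m - c \<cdot> x n) \<le> cmod c * p (x m - x n)"
    using smul[of "x m - x n" c] assms by (simp add: cauchy_polys right_diff_distrib)
qed (use assms in \<open>auto simp: cauchy_iff\<close>)

lemma cauchy_padj:
  assumes "x \<in> cauchy_seqs F"
  shows "(\<lambda>n. padj (x n)) \<in> cauchy_seqs F"
proof (rule cauchyI_dominated[where K = 1 and b = "\<lambda>m n. p (x m - x n)"])
  fix m n
  show "p (padj (x m) - padj (x n)) \<le> 1 * p (x m - x n)"
    using norm_padj[of "x m - x n"] assms by (simp add: cauchy_polys padj_diff)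
qed (use assms in \<open>auto simp: cauchy_iff\<close>)

text \<open>Write ab - a'b' = a(b - b') + (a - a')b'. Only \<open>a\<close> and \<open>b'\<close>
  survive undifferenced, so these two are the factors that need a bound.\<close>

lemma mult_diff_le:
  assumes "a \<in> polys G" "b \<in> polys G" "a' \<in> polys G" "b' \<in> polys G"
    and "p a \<le> K" "p b' \<le> K"
  shows "p (a * b - a' * b') \<le> K * (p (a - a') + p (b - b'))"
proof -
  have "a * b - a' * b' = a * (b - b') + (a - a') * b'" by (simp add: algebra_simps)
  then have "p (a * b - a' * b') \<le> p (a * (b - b')) + p ((a - a') * b')"
    using triangle[of "a * (b - b')" "(a - a') * b'"] assms by simp
  also have "\<dots> \<le> p a * p (b - b') + p (a - a') * p b'"
    using assms by (intro add_mono submult) auto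
  also have "\<dots> \<le> K * p (b - b') + p (a - a') * K"
    using assms by (intro add_mono mult_right_mono mult_left_mono nonneg) auto
  finally show ?thesis by (simp add: algebra_simps)
qed

lemma cauchy_bounded2:
  assumes "x \<in> cauchy_seqs F" "y \<in> cauchy_seqs F"
  obtains K where "K > 0" "\<And>n. p (x n) \<le> K" "\<And>n. p (y n) \<le> K"
proof -
  obtain K where K: "K > 0" "\<And>n. p (x n) \<le> K" using cauchy_bounded[OF assms(1)] by blast
  obtain L where L: "L > 0" "\<And>n. p (y n) \<le> L" using cauchy_bounded[OF assms(2)] by blast
  show ?thesis
  proof (rule that[of "max K L"])
    show "p (x n) \<le> max K L" "p (y n) \<le> max K L" for n
      using K(2)[of n] L(2)[of n] by auto
  qed (use K in auto)
qed

lemma cauchy_mult: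
  assumes "x \<in> cauchy_seqs F" "y \<in> cauchy_seqs F"
  shows "(\<lambda>n. x n * y n) \<in> cauchy_seqs F"
proof -
  obtain K where "K > 0" "\<And>n. p (x n) \<le> K" "\<And>n. p (y n) \<le> K"
    using cauchy_bounded2[OF assms] by blast
  then show ?thesis
    using assms cauchy_sum_small
    by (intro cauchyI_dominated[where K = K and b = "\<lambda>m n. p (x m - x n) + p (y m - y n)"]
        mult_diff_le) (auto intro: cauchy_polys)
qed

section \<open>Classes of Cauchy sequences and the operations on them\<close>

lemma null_rel_iff:
  "(x, y) \<in> null_rel F \<longleftrightarrow> x \<in> cauchy_seqs F \<and> y \<in> cauchy_seqs F \<and> (\<lambda>n. p (x n - y n)) \<longlonglongrightarrow> 0"
  by (simp add: null_rel_def)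

lemma tendsto_zero_le:
  assumes "\<And>n. 0 \<le> f n" "\<And>n. f n \<le> g n" "g \<longlonglongrightarrow> (0::real)"
  shows "f \<longlonglongrightarrow> 0"
  by (rule tendsto_sandwich[OF _ _ tendsto_const assms(3)]) (use assms in auto)

lemma equiv_null_rel: "equiv (cauchy_seqs F) (null_rel F)"
proof (rule equivI)
  show "null_rel F \<subseteq> cauchy_seqs F \<times> cauchy_seqs F" by (auto simp: null_rel_iff)
  show "refl_on (cauchy_seqs F) (null_rel F)"
    by (auto simp: refl_on_def null_rel_iff)
  show "sym (null_rel F)"
    by (auto simp: sym_def null_rel_iff diff_commute cauchy_polys)
  show "trans (null_rel F)"
  proof (rule transI)
    fix x y z assume "(x, y) \<in> null_rel F" "(y, z) \<in> null_rel F"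
    then have *: "x \<in> cauchy_seqs F" "y \<in> cauchy_seqs F" "z \<in> cauchy_seqs F"
      "(\<lambda>n. p (x n - y n)) \<longlonglongrightarrow> 0" "(\<lambda>n. p (y n - z n)) \<longlonglongrightarrow> 0"
      by (auto simp: null_rel_iff)
    have "(\<lambda>n. p (x n - z n)) \<longlonglongrightarrow> 0"
      by (rule tendsto_zero_le[OF _ _ tendsto_add_zero[OF *(4,5)]])
        (use * in \<open>auto intro!: nonneg triangle3 intro: cauchy_polys\<close>)
    then show "(x, z) \<in> null_rel F" using * by (simp add: null_rel_iff)
  qed
qed

lemma class_eq_iff:
  assumes "x \<in> cauchy_seqs F" "y \<in> cauchy_seqs F"
  shows "seq_class F x = seq_class F y \<longleftrightarrow> (\<lambda>n. p (x n - y n)) \<longlonglongrightarrow> 0"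
  using eq_equiv_class_iff[OF equiv_null_rel assms] assms by (simp add: seq_class_def null_rel_iff)

lemma class_self: "x \<in> cauchy_seqs F \<Longrightarrow> x \<in> seq_class F x"
  by (simp add: seq_class_def null_rel_iff)

lemma class_memD:
  assumes "y \<in> seq_class F x"
  shows "y \<in> cauchy_seqs F" "(\<lambda>n. p (x n - y n)) \<longlonglongrightarrow> 0" "(\<lambda>n. p (y n - x n)) \<longlonglongrightarrow> 0"
proof -
  have *: "(x, y) \<in> null_rel F" "(y, x) \<in> null_rel F"
    using assms equiv_null_rel by (auto simp: seq_class_def equiv_def sym_def)
  then show "y \<in> cauchy_seqs F" "(\<lambda>n. p (x n - y n)) \<longlonglongrightarrow> 0" "(\<lambda>n. p (y n - x n)) \<longlonglongrightarrow> 0"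
    by (auto simp: null_rel_iff)
qed

lemma class_carrier [simp, intro]: "x \<in> cauchy_seqs F \<Longrightarrow> seq_class F x \<in> carrier C"
  by (simp add: completion_def seq_class_def quotientI)

lemma carrier_cases:
  assumes "X \<in> carrier C"
  obtains x where "x \<in> cauchy_seqs F" "X = seq_class F x"
  using assms by (auto simp: completion_def seq_class_def elim: quotientE)

lemma add_class:
  assumes "x \<in> cauchy_seqs F" "y \<in> cauchy_seqs F"
  shows "seq_class F x \<oplus>\<^bsub>C\<^esub> seq_class F y = seq_class F (\<lambda>n. x n + y n)"
proof -
  have "seq_class F (\<lambda>n. x' n + y' n) = seq_class F (\<lambda>n. x n + y n)"
    if xy': "x' \<in> seq_class F x" "y' \<in> seq_class F y" for x' y'
  proof -
    note x' = class_memD[OF xy'(1)] and y' = class_memD[OF xy'(2)]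
    have "p (x' n + y' n - (x n + y n)) \<le> p (x' n - x n) + p (y' n - y n)" for n
      using triangle[of "x' n - x n" "y' n - y n"] assms x' y'
      by (simp add: cauchy_polys algebra_simps)
    then have "(\<lambda>n. p (x' n + y' n - (x n + y n))) \<longlonglongrightarrow> 0"
      by (intro tendsto_zero_le[OF _ _ tendsto_add_zero[OF x'(3) y'(3)]] nonneg)
        (use assms x' y' in \<open>auto intro: cauchy_polys\<close>)
    then show ?thesis
      using assms x' y' by (subst class_eq_iff) (auto intro: cauchy_add)
  qed
  then have "(\<Union>x'\<in>seq_class F x. \<Union>y'\<in>seq_class F y. seq_class F (\<lambda>n. x' n + y' n)) =
      seq_class F (\<lambda>n. x n + y n)"
    by (intro UN_eq_const[OF class_self[OF assms(1)]] UN_eq_const[OF class_self[OF assms(2)]])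
  then show ?thesis by (simp add: completion_def)
qed

lemma mult_class:
  assumes "x \<in> cauchy_seqs F" "y \<in> cauchy_seqs F"
  shows "seq_class F x \<otimes>\<^bsub>C\<^esub> seq_class F y = seq_class F (\<lambda>n. x n * y n)"
proof -
  have "seq_class F (\<lambda>n. x' n * y' n) = seq_class F (\<lambda>n. x n * y n)"
    if xy': "x' \<in> seq_class F x" "y' \<in> seq_class F y" for x' y'
  proof -
    note x' = class_memD[OF xy'(1)] and y' = class_memD[OF xy'(2)]
    \<comment> \<open>The bound is taken for the new left factor and the old right factor, the two
      that \<open>mult_diff_le\<close> leaves undifferenced.\<close>
    obtain K where K: "K > 0" "\<And>n. p (x' n) \<le> K" "\<And>n. p (y n) \<le> K"
      using cauchy_bounded2[OF x'(1) assms(2)] by blast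
    have "p (x' n * y' n - x n * y n) \<le> K * (p (x' n - x n) + p (y' n - y n))" for n
      using assms x' y' K by (intro mult_diff_le) (auto intro: cauchy_polys)
    then have "(\<lambda>n. p (x' n * y' n - x n * y n)) \<longlonglongrightarrow> 0"
      by (intro tendsto_zero_le[OF _ _ tendsto_mult_right_zero[OF tendsto_add_zero[OF x'(3) y'(3)]]] nonneg)
        (use assms x' y' in \<open>auto intro: cauchy_polys\<close>)
    then show ?thesis
      using assms x' y' by (subst class_eq_iff) (auto intro: cauchy_mult)
  qed
  then have "(\<Union>x'\<in>seq_class F x. \<Union>y'\<in>seq_class F y. seq_class F (\<lambda>n. x' n * y' n)) =
      seq_class F (\<lambda>n. x n * y n)"
    by (intro UN_eq_const[OF class_self[OF assms(1)]] UN_eq_const[OF class_self[OF assms(2)]])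
  then show ?thesis by (simp add: completion_def)
qed

lemma scale_class:
  assumes "x \<in> cauchy_seqs F"
  shows "c \<odot>\<^bsub>C\<^esub> seq_class F x = seq_class F (\<lambda>n. c \<cdot> x n)"
proof -
  have "seq_class F (\<lambda>n. c \<cdot> x' n) = seq_class F (\<lambda>n. c \<cdot> x n)"
    if xy': "x' \<in> seq_class F x" for x'
  proof -
    note x' = class_memD[OF xy']
    have "p (c \<cdot> x' n - c \<cdot> x n) = cmod c * p (x' n - x n)" for n
      using smul[of "x' n - x n" c] assms x' by (simp add: cauchy_polys right_diff_distrib)
    then have "(\<lambda>n. p (c \<cdot> x' n - c \<cdot> x n)) \<longlonglongrightarrow> 0"
      using tendsto_mult_right_zero[OF x'(3)] by simp
    then show ?thesis
      using assms x' by (subst class_eq_iff) (auto intro: cauchy_smul)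
  qed
  then have "(\<Union>x'\<in>seq_class F x. seq_class F (\<lambda>n. c \<cdot> x' n)) = seq_class F (\<lambda>n. c \<cdot> x n)"
    by (intro UN_eq_const[OF class_self[OF assms(1)]])
  then show ?thesis by (simp add: completion_def)
qed

lemma adj_class:
  assumes "x \<in> cauchy_seqs F"
  shows "adj C (seq_class F x) = seq_class F (\<lambda>n. padj (x n))"
proof -
  have "seq_class F (\<lambda>n. padj (x' n)) = seq_class F (\<lambda>n. padj (x n))"
    if xy': "x' \<in> seq_class F x" for x'
  proof -
    note x' = class_memD[OF xy']
    have "p (padj (x' n) - padj (x n)) = p (x' n - x n)" for n
      using norm_padj[of "x' n - x n"] assms x' by (simp add: cauchy_polys padj_diff)
    then have "(\<lambda>n. p (padj (x' n) - padj (x n))) \<longlonglongrightarrow> 0"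
      using x'(3) by simp
    then show ?thesis
      using assms x' by (subst class_eq_iff) (auto intro: cauchy_padj)
  qed
  then have "(\<Union>x'\<in>seq_class F x. seq_class F (\<lambda>n. padj (x' n))) = seq_class F (\<lambda>n. padj (x n))"
    by (intro UN_eq_const[OF class_self[OF assms(1)]])
  then show ?thesis by (simp add: completion_def)
qed

text \<open>A function that is 1-Lipschitz for \<open>p\<close> sends equivalent sequences to
  sequences with the same limit, so the definite description denotes that limit. This serves both
  the norm of the completion (\<open>g = p\<close>) and extended functionals.\<close>

lemma class_lim_eq:
  fixes g :: "'g star_poly \<Rightarrow> 'b::real_normed_vector"
  assumes x: "x \<in> cauchy_seqs F" and conv: "convergent (\<lambda>n. g (x n))"
    and g: "\<And>a b. a \<in> polys G \<Longrightarrow> b \<in> polys G \<Longrightarrow> norm (g a - g b) \<le> p (a - b)"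
  shows "(\<lambda>n. g (x n)) \<longlonglongrightarrow> (THE l. \<forall>y\<in>seq_class F x. (\<lambda>n. g (y n)) \<longlonglongrightarrow> l)"
proof -
  obtain l where l: "(\<lambda>n. g (x n)) \<longlonglongrightarrow> l" using conv by (auto simp: convergent_def)
  have "(\<lambda>n. g (y n)) \<longlonglongrightarrow> l" if "y \<in> seq_class F x" for y
  proof -
    note y = class_memD[OF that]
    have "(\<lambda>n. norm (g (y n) - g (x n))) \<longlonglongrightarrow> 0"
      by (rule tendsto_zero_le[OF _ _ y(3)]) (auto intro!: g cauchy_polys x y)
    then have "(\<lambda>n. g (y n) - g (x n)) \<longlonglongrightarrow> 0" by (rule tendsto_norm_zero_cancel)
    from tendsto_add[OF this l] show ?thesis by simp
  qed
  moreover have "l' = l" if "\<forall>y\<in>seq_class F x. (\<lambda>n. g (y n)) \<longlonglongrightarrow> l'" for l'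
    using that class_self[OF x] l LIMSEQ_unique by blast
  ultimately have "(THE l. \<forall>y\<in>seq_class F x. (\<lambda>n. g (y n)) \<longlonglongrightarrow> l) = l"
    by (intro the_equality) auto
  with l show ?thesis by simp
qed

lemma nrm_class:
  assumes "x \<in> cauchy_seqs F"
  shows "(\<lambda>n. p (x n)) \<longlonglongrightarrow> nrm C (seq_class F x)"
  using class_lim_eq[of x p, OF assms cauchy_convergent_nrm[OF assms]] abs_diff_le
  by (simp add: completion_def)

section \<open>Polynomials inside the completion\<close>

lemma zero_class: "\<zero>\<^bsub>C\<^esub> = emb 0"
  by (simp add: completion_def embed_def)

lemma emb_class: "emb a = seq_class F (\<lambda>n. a)"
  by (simp add: embed_def)

lemma emb_carrier [simp, intro]: "a \<in> polys G \<Longrightarrow> emb a \<in> carrier C"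
  by (simp add: emb_class)

lemma emb_add: "a \<in> polys G \<Longrightarrow> b \<in> polys G \<Longrightarrow> emb a \<oplus>\<^bsub>C\<^esub> emb b = emb (a + b)"
  by (simp add: emb_class add_class)

lemma emb_mult: "a \<in> polys G \<Longrightarrow> b \<in> polys G \<Longrightarrow> emb a \<otimes>\<^bsub>C\<^esub> emb b = emb (a * b)"
  by (simp add: emb_class mult_class)

lemma emb_scale: "a \<in> polys G \<Longrightarrow> c \<odot>\<^bsub>C\<^esub> emb a = emb (c \<cdot> a)"
  by (simp add: emb_class scale_class)

lemma emb_adj: "a \<in> polys G \<Longrightarrow> adj C (emb a) = emb (padj a)"
  by (simp add: emb_class adj_class)

lemma diff_class:
  "x \<in> cauchy_seqs F \<Longrightarrow> y \<in> cauchy_seqs F \<Longrightarrow>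
     diff C (seq_class F x) (seq_class F y) = seq_class F (\<lambda>n. x n - y n)"
  using cauchy_smul[of y "-1"] by (simp add: diff_def scale_class add_class smul_minus_one)

lemma cauchy_diff: "x \<in> cauchy_seqs F \<Longrightarrow> y \<in> cauchy_seqs F \<Longrightarrow> (\<lambda>n. x n - y n) \<in> cauchy_seqs F"
  using cauchy_add[of x "\<lambda>n. - y n"] cauchy_smul[of y "-1"] by (simp add: smul_minus_one)

lemma emb_diff: "a \<in> polys G \<Longrightarrow> b \<in> polys G \<Longrightarrow> diff C (emb a) (emb b) = emb (a - b)"
  by (simp add: emb_class diff_class)

lemma emb_eq_iff: "a \<in> polys G \<Longrightarrow> b \<in> polys G \<Longrightarrow> emb a = emb b \<longleftrightarrow> p (a - b) = 0"
  by (simp add: emb_class class_eq_iff LIMSEQ_const_iff)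

lemma emb_nrm: "a \<in> polys G \<Longrightarrow> nrm C (emb a) = p a"
  using nrm_class[of "\<lambda>n. a"] by (simp add: emb_class LIMSEQ_const_iff)

text \<open>\<open>fsum\<close> folds along a list picked by choice. The induction runs over
  arbitrary lists within \<open>I\<close>, and the order disappears only when the sum of polynomials
  over the chosen list is rewritten as a sum over the set.\<close>

lemma emb_fsum:
  assumes "\<And>i. i \<in> I \<Longrightarrow> f i \<in> polys G"
  shows "fsum C (\<lambda>i. emb (f i)) I = emb (sum f I)"
proof (cases "finite I")
  case True
  have *: "foldr (\<lambda>i y. emb (f i) \<oplus>\<^bsub>C\<^esub> y) is \<zero>\<^bsub>C\<^esub> = emb (sum_list (map f is)) \<and> sum_list (map f is) \<in> polys G"
    if "set is \<subseteq> I" for "is"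
    using that by (induction "is") (auto simp: zero_class emb_add assms)
  define js where "js = (SOME is. distinct is \<and> set is = I)"
  have js: "distinct js \<and> set js = I"
    unfolding js_def by (rule someI_ex) (use finite_distinct_list[OF True] in blast)
  have "fsum C (\<lambda>i. emb (f i)) I = emb (sum_list (map f js))"
    using * js True by (simp add: fsum_def js_def[symmetric])
  also have "sum_list (map f js) = sum f I"
    using js by (metis sum_list_distinct_conv_sum_set)
  finally show ?thesis .
qed (simp add: fsum_def zero_class)

section \<open>The norm of the completion and density of the polynomials\<close>

lemma carrier_closed [simp, intro]:
  assumes "X \<in> carrier C" "Y \<in> carrier C"
  shows "X \<oplus>\<^bsub>C\<^esub> Y \<in> carrier C" "X \<otimes>\<^bsub>C\<^esub> Y \<in> carrier C" "diff C X Y \<in> carrier C"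
    "c \<odot>\<^bsub>C\<^esub> X \<in> carrier C" "adj C X \<in> carrier C"
  using assms
  by (auto elim!: carrier_cases intro!: class_carrier cauchy_add cauchy_mult cauchy_diff cauchy_smul cauchy_padj
      simp: add_class mult_class diff_class scale_class adj_class)

lemma nrm_nonneg: "X \<in> carrier C \<Longrightarrow> 0 \<le> nrm C X"
  by (elim carrier_cases) (auto intro!: LIMSEQ_le_const[OF nrm_class] nonneg cauchy_polys)

lemma nrm_mult_le: "X \<in> carrier C \<Longrightarrow> Y \<in> carrier C \<Longrightarrow> nrm C (X \<otimes>\<^bsub>C\<^esub> Y) \<le> nrm C X * nrm C Y"
proof (elim carrier_cases, hypsubst)
  fix x y assume *: "x \<in> cauchy_seqs F" "y \<in> cauchy_seqs F"
  show "nrm C (seq_class F x \<otimes>\<^bsub>C\<^esub> seq_class F y) \<le> nrm C (seq_class F x) * nrm C (seq_class F y)"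
    using * unfolding mult_class[OF *]
    by (intro LIMSEQ_le[OF nrm_class tendsto_mult[OF nrm_class nrm_class]])
      (auto intro!: cauchy_mult submult cauchy_polys)
qed

lemma nrm_scale: "X \<in> carrier C \<Longrightarrow> nrm C (c \<odot>\<^bsub>C\<^esub> X) = cmod c * nrm C X"
proof (elim carrier_cases, hypsubst)
  fix x assume *: "x \<in> cauchy_seqs F"
  show "nrm C (c \<odot>\<^bsub>C\<^esub> seq_class F x) = cmod c * nrm C (seq_class F x)"
    using nrm_class[OF cauchy_smul[OF *]] tendsto_mult_left[OF nrm_class[OF *]] *
    by (intro LIMSEQ_unique[where X = "\<lambda>n. p (c \<cdot> x n)"]) (auto simp: scale_class smul cauchy_polys)
qed

lemma nrm_triangle3:
  "X \<in> carrier C \<Longrightarrow> Y \<in> carrier C \<Longrightarrow> Z \<in> carrier C \<Longrightarrow>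
     nrm C (diff C X Z) \<le> nrm C (diff C X Y) + nrm C (diff C Y Z)"
proof (elim carrier_cases, hypsubst)
  fix x y z assume *: "x \<in> cauchy_seqs F" "y \<in> cauchy_seqs F" "z \<in> cauchy_seqs F"
  show "nrm C (diff C (seq_class F x) (seq_class F z)) \<le>
    nrm C (diff C (seq_class F x) (seq_class F y)) + nrm C (diff C (seq_class F y) (seq_class F z))"
    using * by (auto simp: diff_class intro!: LIMSEQ_le[OF nrm_class tendsto_add[OF nrm_class nrm_class]]
        cauchy_diff triangle3 cauchy_polys)
qed

lemma nrm_diff_commute:
  "X \<in> carrier C \<Longrightarrow> Y \<in> carrier C \<Longrightarrow> nrm C (diff C X Y) = nrm C (diff C Y X)"
proof (elim carrier_cases, hypsubst)
  fix x y assume *: "x \<in> cauchy_seqs F" "y \<in> cauchy_seqs F"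
  show "nrm C (diff C (seq_class F x) (seq_class F y)) = nrm C (diff C (seq_class F y) (seq_class F x))"
    using nrm_class[OF cauchy_diff[OF *]] nrm_class[OF cauchy_diff[OF *(2,1)]] *
    by (intro LIMSEQ_unique[where X = "\<lambda>n. p (x n - y n)"]) (auto simp: diff_class diff_commute cauchy_polys)
qed

lemma nrm_diff_eq_0:
  assumes "X \<in> carrier C" "Y \<in> carrier C" "nrm C (diff C X Y) = 0"
  shows "X = Y"
proof -
  obtain x y where *: "x \<in> cauchy_seqs F" "y \<in> cauchy_seqs F" "X = seq_class F x" "Y = seq_class F y"
    using assms by (metis carrier_cases)
  then show ?thesis using assms nrm_class[OF cauchy_diff[OF *(1,2)]]
    by (simp add: diff_class class_eq_iff)
qed

text \<open>The distance from the class of \<open>x\<close> to its n-th term is the limit over m of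
  p(x m - x n), which the Cauchy property makes small. Hence the polynomials are dense.\<close>

lemma emb_lim:
  assumes x: "x \<in> cauchy_seqs F"
  shows "(\<lambda>n. nrm C (diff C (seq_class F x) (emb (x n)))) \<longlonglongrightarrow> 0"
proof (rule LIMSEQ_I)
  fix e :: real assume "e > 0"
  then obtain N where N: "\<forall>m\<ge>N. \<forall>n\<ge>N. p (x m - x n) < e / 2"
    using x unfolding cauchy_iff by (meson half_gt_zero)
  have "norm (nrm C (diff C (seq_class F x) (emb (x n))) - 0) < e" if n: "n \<ge> N" for n
  proof -
    have c: "(\<lambda>m. x n) \<in> cauchy_seqs F" using x by (auto intro: cauchy_polys)
    have "nrm C (seq_class F (\<lambda>m. x m - x n)) \<le> e / 2"
      by (rule LIMSEQ_le_const2[OF nrm_class[OF cauchy_diff[OF x c]]])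
        (use N n in \<open>auto intro!: exI[of _ N] less_imp_le\<close>)
    moreover have "0 \<le> nrm C (seq_class F (\<lambda>m. x m - x n))"
      by (intro nrm_nonneg class_carrier cauchy_diff x c)
    ultimately show ?thesis using \<open>e > 0\<close> x c by (simp add: emb_class diff_class)
  qed
  then show "\<exists>N. \<forall>n\<ge>N. norm (nrm C (diff C (seq_class F x) (emb (x n))) - 0) < e" by blast
qed

section \<open>Bounded functionals on the completion\<close>

lemma bounded_functional_diff:
  "bounded_functional C L \<Longrightarrow> X \<in> carrier C \<Longrightarrow> Y \<in> carrier C \<Longrightarrow> L (diff C X Y) = L X - L Y"
  by (auto simp: bounded_functional_def diff_def)

lemma bounded_functional_lim:
  assumes L: "bounded_functional C L" and x: "x \<in> cauchy_seqs F"
  shows "(\<lambda>n. L (emb (x n))) \<longlonglongrightarrow> L (seq_class F x)"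
proof -
  obtain K where K: "K \<ge> 0" "\<And>X. X \<in> carrier C \<Longrightarrow> cmod (L X) \<le> K * nrm C X"
    using L by (auto simp: bounded_functional_def)
  have c: "emb (x n) \<in> carrier C" "seq_class F x \<in> carrier C" for n
    using x by (auto intro: cauchy_polys)
  have "(\<lambda>n. cmod (L (seq_class F x) - L (emb (x n)))) \<longlonglongrightarrow> 0"
    by (rule tendsto_zero_le[OF _ _ tendsto_mult_right_zero[OF emb_lim[OF x], of K]])
      (use c K(2)[of "diff C (seq_class F x) (emb (x n))" for n] in
        \<open>auto simp: bounded_functional_diff[OF L]\<close>)
  then have "(\<lambda>n. L (seq_class F x) - L (emb (x n))) \<longlonglongrightarrow> 0" by (rule tendsto_norm_zero_cancel)
  from tendsto_diff[OF tendsto_const[of "L (seq_class F x)"] this] show ?thesis by simp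
qed

text \<open>Bounded functionals are continuous and every class is the limit of its own terms, so
  agreement on polynomials suffices.\<close>

lemma bounded_functional_eqI:
  assumes "bounded_functional C L" "bounded_functional C M"
    and "\<And>a. a \<in> polys G \<Longrightarrow> L (emb a) = M (emb a)" and "X \<in> carrier C"
  shows "L X = M X"
proof -
  obtain x where x: "x \<in> cauchy_seqs F" "X = seq_class F x" using assms(4) by (rule carrier_cases)
  then show ?thesis
    using LIMSEQ_unique[OF bounded_functional_lim[OF assms(1) x(1)]] bounded_functional_lim[OF assms(2) x(1)]
    by (simp add: assms(3) cauchy_polys)
qed

end

subsection \<open>Extension of functionals\<close>

text \<open>The constant is 1 rather than an arbitrary K because the extension is meant to be a
  state and must have norm at most 1.\<close>

definition dominated_functional ::
    "'g set \<Rightarrow> ('g star_poly \<Rightarrow> real) \<Rightarrow> ('g star_poly \<Rightarrow> complex) \<Rightarrow> bool" where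
  "dominated_functional G p g \<longleftrightarrow>
     (\<forall>x\<in>polys G. \<forall>y\<in>polys G. g (x + y) = g x + g y) \<and>
     (\<forall>c. \<forall>x\<in>polys G. g (c \<cdot> x) = c * g x) \<and>
     (\<forall>x\<in>polys G. cmod (g x) \<le> p x)"

text \<open>The restriction to the carrier makes the extension \<open>undefined\<close> elsewhere,
  as \<open>state\<close> demands; the limit is the same for all representatives by
  \<open>class_lim_eq\<close>.\<close>

definition ext_functional ::
    "'g set \<Rightarrow> ('g star_poly \<Rightarrow> real) \<Rightarrow> ('g star_poly \<Rightarrow> complex) \<Rightarrow> (nat \<Rightarrow> 'g star_poly) set \<Rightarrow> complex" where
  "ext_functional G p g = (\<lambda>X\<in>carrier (completion (free_star_algebra G p)).
     THE l. \<forall>x\<in>X. (\<lambda>n. g (x n)) \<longlonglongrightarrow> l)"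

context cstar_seminormed
begin

lemma dominated_functional_diff:
  assumes "dominated_functional G p g" "x \<in> polys G" "y \<in> polys G"
  shows "g (x - y) = g x - g y"
proof -
  have "g (x + (-1) \<cdot> y) = g x + (-1) * g y"
    using assms unfolding dominated_functional_def by (metis smul_polys)
  then show ?thesis by (simp add: smul_minus_one)
qed

lemma ext_functional_lim:
  assumes g: "dominated_functional G p g" and x: "x \<in> cauchy_seqs F"
  shows "(\<lambda>n. g (x n)) \<longlonglongrightarrow> ext_functional G p g (seq_class F x)"
proof -
  have le: "cmod (g a - g b) \<le> p (a - b)" if "a \<in> polys G" "b \<in> polys G" for a b
    using g that dominated_functional_diff[OF g that] unfolding dominated_functional_def
    by (metis diff_polys)
  have "Cauchy (\<lambda>n. g (x n))"
  proof (rule metric_CauchyI)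
    fix e :: real assume "e > 0"
    then obtain N where N: "\<forall>m\<ge>N. \<forall>n\<ge>N. p (x m - x n) < e"
      using x unfolding cauchy_iff by blast
    have "dist (g (x m)) (g (x n)) < e" if "m \<ge> N" "n \<ge> N" for m n
      using le[of "x m" "x n"] N that cauchy_polys[OF x] by (fastforce simp: dist_norm)
    then show "\<exists>M. \<forall>m\<ge>M. \<forall>n\<ge>M. dist (g (x m)) (g (x n)) < e" by blast
  qed
  then have "convergent (\<lambda>n. g (x n))" by (simp add: Cauchy_convergent_iff)
  from class_lim_eq[OF x this le] show ?thesis using x by (simp add: ext_functional_def)
qed

lemma ext_functional_emb:
  "dominated_functional G p g \<Longrightarrow> a \<in> polys G \<Longrightarrow> ext_functional G p g (emb a) = g a"
  using ext_functional_lim[of g "\<lambda>n. a"] by (simp add: emb_class LIMSEQ_const_iff)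

lemma ext_functional_le:
  "dominated_functional G p g \<Longrightarrow> X \<in> carrier C \<Longrightarrow> cmod (ext_functional G p g X) \<le> nrm C X"
proof (elim carrier_cases, hypsubst)
  fix x assume g: "dominated_functional G p g" and x: "x \<in> cauchy_seqs F"
  show "cmod (ext_functional G p g (seq_class F x)) \<le> nrm C (seq_class F x)"
    using g x by (intro LIMSEQ_le[OF tendsto_norm[OF ext_functional_lim[OF g x]] nrm_class[OF x]])
      (auto simp: dominated_functional_def cauchy_polys)
qed

lemma ext_functional_bounded:
  assumes g: "dominated_functional G p g"
  shows "bounded_functional C (ext_functional G p g)"
  unfolding bounded_functional_def
proof (intro conjI ballI allI exI[of _ "1::real"])
  fix X Y assume "X \<in> carrier C" "Y \<in> carrier C"
  then obtain x y where *: "x \<in> cauchy_seqs F" "y \<in> cauchy_seqs F" "X = seq_class F x" "Y = seq_class F y"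
    by (metis carrier_cases)
  show "ext_functional G p g (X \<oplus>\<^bsub>C\<^esub> Y) = ext_functional G p g X + ext_functional G p g Y"
    using tendsto_add[OF ext_functional_lim[OF g *(1)] ext_functional_lim[OF g *(2)]]
      ext_functional_lim[OF g cauchy_add[OF *(1,2)]] g *
    by (intro LIMSEQ_unique[where X = "\<lambda>n. g (x n + y n)"])
      (auto simp: add_class dominated_functional_def cauchy_polys)
next
  fix c X assume "X \<in> carrier C"
  then obtain x where *: "x \<in> cauchy_seqs F" "X = seq_class F x"
    by (metis carrier_cases)
  show "ext_functional G p g (c \<odot>\<^bsub>C\<^esub> X) = c * ext_functional G p g X"
    using tendsto_mult_left[OF ext_functional_lim[OF g *(1)], of c]
      ext_functional_lim[OF g cauchy_smul[OF *(1), of c]] g *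
    by (intro LIMSEQ_unique[where X = "\<lambda>n. g (c \<cdot> x n)"])
      (auto simp: scale_class dominated_functional_def cauchy_polys)
qed (use ext_functional_le[OF g] in auto)

end

subsection \<open>Extension of homomorphisms\<close>

definition ext_hom ::
    "'g set \<Rightarrow> ('g star_poly \<Rightarrow> real) \<Rightarrow> 'h set \<Rightarrow> ('h star_poly \<Rightarrow> real) \<Rightarrow> ('g star_poly \<Rightarrow> 'h star_poly) \<Rightarrow>
     (nat \<Rightarrow> 'g star_poly) set \<Rightarrow> (nat \<Rightarrow> 'h star_poly) set" where
  "ext_hom G p H q h = (\<lambda>X\<in>carrier (completion (free_star_algebra G p)).
     \<Union>x\<in>X. seq_class (free_star_algebra H q) (\<lambda>n. h (x n)))"

text \<open>The algebraic laws are asked of all polynomials, constants included, since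
  \<open>twist c\<close> satisfies them there; only closure and the norm estimate refer to
  \<open>polys G\<close>.\<close>

locale contractive_hom = dom: cstar_seminormed G p + cod: cstar_seminormed H q
  for G :: "'g set" and p and H :: "'h set" and q +
  fixes h :: "'g star_poly \<Rightarrow> 'h star_poly"
  assumes h_polys: "x \<in> polys G \<Longrightarrow> h x \<in> polys H"
    and h_add: "h (x + y) = h x + h y"
    and h_mult: "h (x * y) = h x * h y"
    and h_smul: "h (c \<cdot> x) = c \<cdot> h x"
    and h_padj: "h (padj x) = padj (h x)"
    and h_le: "x \<in> polys G \<Longrightarrow> q (h x) \<le> p x"
begin

abbreviation "ext \<equiv> ext_hom G p H q h"

lemma h_diff: "h (x - y) = h x - h y"
  using h_add[of x "(-1) \<cdot> y"] h_smul[of "-1" y] by (simp add: smul_minus_one)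

lemma h_cauchy:
  assumes "x \<in> cauchy_seqs dom.F"
  shows "(\<lambda>n. h (x n)) \<in> cauchy_seqs cod.F"
proof (rule cod.cauchyI_dominated[where K = 1 and b = "\<lambda>m n. p (x m - x n)"])
  fix m n show "q (h (x m) - h (x n)) \<le> 1 * p (x m - x n)"
    using h_le[of "x m - x n"] assms by (simp add: h_diff dom.cauchy_polys)
qed (use assms in \<open>auto simp: dom.cauchy_iff intro: h_polys\<close>)

lemma ext_class:
  assumes x: "x \<in> cauchy_seqs dom.F"
  shows "ext (seq_class dom.F x) = seq_class cod.F (\<lambda>n. h (x n))"
proof -
  have "seq_class cod.F (\<lambda>n. h (y n)) = seq_class cod.F (\<lambda>n. h (x n))" if "y \<in> seq_class dom.F x" for y
  proof -
    note y = dom.class_memD[OF that]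
    have "(\<lambda>n. q (h (y n) - h (x n))) \<longlonglongrightarrow> 0"
      unfolding h_diff[symmetric]
      by (rule dom.tendsto_zero_le[OF _ _ y(3)])
        (use x y in \<open>auto intro!: cod.nonneg h_polys h_le intro: dom.cauchy_polys\<close>)
    then show ?thesis using x y by (subst cod.class_eq_iff) (auto intro: h_cauchy)
  qed
  then have "(\<Union>y\<in>seq_class dom.F x. seq_class cod.F (\<lambda>n. h (y n))) = seq_class cod.F (\<lambda>n. h (x n))"
    by (intro UN_eq_const[OF dom.class_self[OF x]])
  then show ?thesis using x by (simp add: ext_hom_def)
qed

lemma ext_emb: "a \<in> polys G \<Longrightarrow> ext (dom.emb a) = cod.emb (h a)"
  by (simp add: dom.emb_class cod.emb_class ext_class)

lemma star_hom_ext: "star_hom dom.C cod.C ext"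
  unfolding star_hom_def
proof (intro conjI ballI allI)
  have "ext X \<in> carrier cod.C" if "X \<in> carrier dom.C" for X
    using that by (elim dom.carrier_cases) (auto simp: ext_class intro!: h_cauchy)
  then show "ext \<in> carrier dom.C \<rightarrow>\<^sub>E carrier cod.C"
    by (auto simp: ext_hom_def PiE_iff)
next
  fix X Y assume "X \<in> carrier dom.C" "Y \<in> carrier dom.C"
  then obtain x y where *: "x \<in> cauchy_seqs dom.F" "y \<in> cauchy_seqs dom.F"
    and **: "X = seq_class dom.F x" "Y = seq_class dom.F y"
    by (metis dom.carrier_cases)
  show "ext (X \<oplus>\<^bsub>dom.C\<^esub> Y) = ext X \<oplus>\<^bsub>cod.C\<^esub> ext Y"
    using * by (simp add: ** dom.add_class cod.add_class ext_class h_cauchy dom.cauchy_add h_add)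
  show "ext (X \<otimes>\<^bsub>dom.C\<^esub> Y) = ext X \<otimes>\<^bsub>cod.C\<^esub> ext Y"
    using * by (simp add: ** dom.mult_class cod.mult_class ext_class h_cauchy dom.cauchy_mult h_mult)
next
  fix X c assume "X \<in> carrier dom.C"
  then obtain x where *: "x \<in> cauchy_seqs dom.F" and **: "X = seq_class dom.F x"
    by (metis dom.carrier_cases)
  show "ext (c \<odot>\<^bsub>dom.C\<^esub> X) = c \<odot>\<^bsub>cod.C\<^esub> ext X"
    using * by (simp add: ** dom.scale_class cod.scale_class ext_class h_cauchy dom.cauchy_smul h_smul)
next
  fix X assume "X \<in> carrier dom.C"
  then obtain x where *: "x \<in> cauchy_seqs dom.F" and **: "X = seq_class dom.F x"
    by (metis dom.carrier_cases)
  show "ext (adj dom.C X) = adj cod.C (ext X)"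
    using * by (simp add: ** dom.adj_class cod.adj_class ext_class h_cauchy dom.cauchy_padj h_padj)
  show "nrm cod.C (ext X) \<le> nrm dom.C X"
    using * unfolding ** ext_class[OF *]
    by (intro LIMSEQ_le[OF cod.nrm_class dom.nrm_class]) (auto intro: h_cauchy h_le dom.cauchy_polys)
qed

end

text \<open>Both maps are contractive and agree at the terms x n, so the distance of \<pi> X and
  \<rho> X is at most twice the distance of X and x n, which tends to 0; the completion is
  Hausdorff.\<close>

lemma star_hom_eqI:
  assumes "cstar_seminormed G p" "cstar_seminormed H q"
  defines "A \<equiv> completion (free_star_algebra G p)" and "B \<equiv> completion (free_star_algebra H q)"
  assumes \<pi>: "star_hom A B \<pi>" and \<rho>: "star_hom A B \<rho>"
    and eq: "\<And>a. a \<in> polys G \<Longrightarrow>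
      \<pi> (embed (free_star_algebra G p) a) = \<rho> (embed (free_star_algebra G p) a)"
  shows "\<pi> = \<rho>"
proof -
  interpret dom: cstar_seminormed G p by fact
  interpret cod: cstar_seminormed H q by fact
  have near: "nrm B (diff B (\<sigma> X) (\<sigma> Y)) \<le> nrm A (diff A X Y)"
    if "star_hom A B \<sigma>" "X \<in> carrier A" "Y \<in> carrier A" for \<sigma> X Y
  proof -
    have "diff A X Y \<in> carrier A" "(-1) \<odot>\<^bsub>A\<^esub> Y \<in> carrier A"
      using that by (auto simp: A_def)
    moreover from this have "\<sigma> (diff A X Y) = diff B (\<sigma> X) (\<sigma> Y)"
      using that unfolding star_hom_def diff_def by metis
    ultimately show ?thesis using that unfolding star_hom_def by metis
  qed
  have ext: "\<pi> \<in> carrier A \<rightarrow>\<^sub>E carrier B" "\<rho> \<in> carrier A \<rightarrow>\<^sub>E carrier B"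
    using \<pi> \<rho> by (auto simp: star_hom_def)
  have "\<pi> X = \<rho> X" if X: "X \<in> carrier A" for X
  proof -
    obtain x where x: "x \<in> cauchy_seqs dom.F" "X = seq_class dom.F x"
      using X unfolding A_def by (rule dom.carrier_cases)
    have e: "dom.emb (x n) \<in> carrier A" "\<pi> X \<in> carrier B" "\<rho> X \<in> carrier B"
      "\<pi> (dom.emb (x n)) \<in> carrier B" "\<rho> (dom.emb (x n)) = \<pi> (dom.emb (x n))" for n
      using x X ext eq[of "x n"] by (auto simp: A_def dom.cauchy_polys)
    have "nrm B (diff B (\<pi> X) (\<rho> X)) \<le> nrm A (diff A X (dom.emb (x n))) + nrm A (diff A X (dom.emb (x n)))" for n
    proof -
      have "nrm B (diff B (\<pi> X) (\<rho> X)) \<le> nrm B (diff B (\<pi> X) (\<pi> (dom.emb (x n)))) +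
          nrm B (diff B (\<pi> (dom.emb (x n))) (\<rho> X))"
        using e unfolding B_def by (intro cod.nrm_triangle3) auto
      also have "nrm B (diff B (\<pi> (dom.emb (x n))) (\<rho> X)) = nrm B (diff B (\<rho> X) (\<rho> (dom.emb (x n))))"
        using e unfolding B_def by (metis cod.nrm_diff_commute)
      finally show ?thesis using near[OF \<pi> X e(1)] near[OF \<rho> X e(1)] by (smt (verit))
    qed
    then have "nrm B (diff B (\<pi> X) (\<rho> X)) \<le> 0 + 0"
      using dom.emb_lim[OF x(1)] x(2) unfolding A_def
      by (intro LIMSEQ_le_const[OF tendsto_add]) auto
    moreover have "nrm B (diff B (\<pi> X) (\<rho> X)) \<ge> 0"
      using e unfolding B_def by (intro cod.nrm_nonneg) auto
    ultimately show ?thesis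
      using e unfolding B_def by (intro cod.nrm_diff_eq_0) auto
  qed
  then show ?thesis using ext by (blast intro: PiE_ext)
qed

lemma fsum_cong:
  assumes "\<And>i. i \<in> I \<Longrightarrow> f i = g i"
  shows "fsum A f I = fsum A g I"
proof (cases "finite I")
  case True
  define js where "js = (SOME is. distinct is \<and> set is = I)"
  have "distinct js \<and> set js = I"
    unfolding js_def by (rule someI_ex) (use finite_distinct_list[OF True] in blast)
  then have "foldr (\<lambda>i y. f i \<oplus>\<^bsub>A\<^esub> y) js \<zero>\<^bsub>A\<^esub> = foldr (\<lambda>i y. g i \<oplus>\<^bsub>A\<^esub> y) js \<zero>\<^bsub>A\<^esub>"
    using assms by (intro foldr_cong) auto
  then show ?thesis by (simp add: fsum_def js_def)
qed (simp add: fsum_def)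

section \<open>Calculation modulo the null ideal of the seminorm\<close>

context cstar_seminormed
begin

text \<open>This is equality of images in the completion, expressed among polynomials. Relations of
  the algebra can thus be verified by polynomial arithmetic and transferred once through
  \<open>emb_eq_iff_eqv\<close>.\<close>

definition eqv :: "'g star_poly \<Rightarrow> 'g star_poly \<Rightarrow> bool" (infix \<open>\<doteq>\<close> 50) where
  "x \<doteq> y \<longleftrightarrow> x \<in> polys G \<and> y \<in> polys G \<and> p (x - y) = 0"

lemma eqv_polys: "x \<doteq> y \<Longrightarrow> x \<in> polys G" "x \<doteq> y \<Longrightarrow> y \<in> polys G"
  by (simp_all add: eqv_def)

lemma eqv_refl [simp]: "x \<doteq> x \<longleftrightarrow> x \<in> polys G"
  by (simp add: eqv_def)

lemma eqv_sym: "x \<doteq> y \<Longrightarrow> y \<doteq> x"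
  by (auto simp: eqv_def diff_commute)

lemma eqv_trans [trans]: "x \<doteq> y \<Longrightarrow> y \<doteq> z \<Longrightarrow> x \<doteq> z"
  using triangle3[of x y z] nonneg[of "x - z"] by (auto simp: eqv_def)

lemma eqv_add: "x \<doteq> x' \<Longrightarrow> y \<doteq> y' \<Longrightarrow> x + y \<doteq> x' + y'"
  using triangle[of "x - x'" "y - y'"] nonneg[of "x + y - (x' + y')"]
  by (auto simp: eqv_def algebra_simps)

lemma eqv_smul: "x \<doteq> y \<Longrightarrow> c \<cdot> x \<doteq> c \<cdot> y"
  using smul[of "x - y" c] by (auto simp: eqv_def right_diff_distrib)

lemma eqv_minus: "x \<doteq> y \<Longrightarrow> - x \<doteq> - y"
  using eqv_smul[of x y "-1"] by (simp add: smul_minus_one)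

lemma eqv_diff: "x \<doteq> x' \<Longrightarrow> y \<doteq> y' \<Longrightarrow> x - y \<doteq> x' - y'"
  using eqv_add[of x x' "- y" "- y'"] eqv_minus[of y y'] by simp

lemma eqv_padj: "x \<doteq> y \<Longrightarrow> padj x \<doteq> padj y"
  using norm_padj[of "x - y"] by (auto simp: eqv_def padj_diff)

lemma eqv_mult:
  assumes "x \<doteq> x'" "y \<doteq> y'"
  shows "x * y \<doteq> x' * y'"
proof -
  have "p (x * y - x' * y') \<le> max (p x) (p y') * (p (x - x') + p (y - y'))"
    using assms by (intro mult_diff_le) (auto simp: eqv_def)
  then show ?thesis
    using assms nonneg[of "x * y - x' * y'"] by (auto simp: eqv_def)
qed

lemma eqv_sum: "(\<And>i. i \<in> I \<Longrightarrow> f i \<doteq> f' i) \<Longrightarrow> sum f I \<doteq> sum f' I"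
  by (induction I rule: infinite_finite_induct) (auto intro: eqv_add)

lemma scale_zero: "X \<in> carrier C \<Longrightarrow> 0 \<odot>\<^bsub>C\<^esub> X = \<zero>\<^bsub>C\<^esub>"
  by (elim carrier_cases) (simp add: scale_class zero_class emb_class)

lemma emb_eq_iff_eqv: "a \<in> polys G \<Longrightarrow> b \<in> polys G \<Longrightarrow> emb a = emb b \<longleftrightarrow> a \<doteq> b"
  by (simp add: emb_eq_iff eqv_def)

end

section \<open>2-graphs\<close>

context two_graph
begin

lemma deg_src: "\<kappa> \<in> paths \<Lambda> \<Longrightarrow> deg \<Lambda> (src \<Lambda> \<kappa>) = 0"
  by (metis deg_rng rng_src src_closed)

text \<open>The degree of the second factor is determined by cancellation in \<nat> \<times> \<nat>,
  so both pairs are factorisations of the same path for the same two degrees.\<close>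

lemma factor_unique:
  assumes "\<mu> \<in> paths \<Lambda>" "\<nu> \<in> paths \<Lambda>" "src \<Lambda> \<mu> = rng \<Lambda> \<nu>"
    and "\<mu>' \<in> paths \<Lambda>" "\<nu>' \<in> paths \<Lambda>" "src \<Lambda> \<mu>' = rng \<Lambda> \<nu>'"
    and "pcomp \<Lambda> \<mu> \<nu> = pcomp \<Lambda> \<mu>' \<nu>'" "deg \<Lambda> \<mu> = deg \<Lambda> \<mu>'"
  shows "\<mu> = \<mu>' \<and> \<nu> = \<nu>'"
proof -
  have d: "deg \<Lambda> \<nu>' = deg \<Lambda> \<nu>"
    using deg_comp[OF assms(1-3)] deg_comp[OF assms(4-6)] assms(7,8) by simp
  define P where "P = (\<lambda>(a, b). a \<in> paths \<Lambda> \<and> b \<in> paths \<Lambda> \<and> src \<Lambda> a = rng \<Lambda> b \<and>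
      pcomp \<Lambda> \<mu> \<nu> = pcomp \<Lambda> a b \<and> deg \<Lambda> a = deg \<Lambda> \<mu> \<and> deg \<Lambda> b = deg \<Lambda> \<nu>)"
  have "\<exists>!x. P x"
    unfolding P_def using factorisation[OF comp_closed[OF assms(1-3)] deg_comp[OF assms(1-3)]] .
  moreover have "P (\<mu>, \<nu>)" using assms(1-3) by (simp add: P_def)
  moreover have "P (\<mu>', \<nu>')" using assms(4-8) d by (simp add: P_def)
  ultimately have "(\<mu>, \<nu>) = (\<mu>', \<nu>')" by blast
  then show ?thesis by simp
qed

lemma factor_exists:
  assumes "\<kappa> \<in> paths \<Lambda>" "deg \<Lambda> \<kappa> = m + n"
  obtains \<mu> \<nu> where "\<mu> \<in> paths \<Lambda>" "\<nu> \<in> paths \<Lambda>" "src \<Lambda> \<mu> = rng \<Lambda> \<nu>" "\<kappa> = pcomp \<Lambda> \<mu> \<nu>"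
    "deg \<Lambda> \<mu> = m" "deg \<Lambda> \<nu> = n"
  using factorisation[OF assms] by (auto simp: Ex1_def)

text \<open>Composing z with its range on the left and with its source on the right gives two
  factorisations of z into paths of degree 0; uniqueness identifies them.\<close>

lemma vertex_rng_src:
  assumes "z \<in> paths_deg \<Lambda> 0"
  shows "rng \<Lambda> z = z" "src \<Lambda> z = z"
proof -
  have z: "z \<in> paths \<Lambda>" "deg \<Lambda> z = 0" using assms by (auto simp: paths_deg_def)
  have "rng \<Lambda> z = z \<and> z = src \<Lambda> z"
    using z factor_unique[of "rng \<Lambda> z" z z "src \<Lambda> z"]
    by (simp add: rng_closed src_closed src_rng rng_src comp_rng comp_src deg_rng)
  then show "rng \<Lambda> z = z" "src \<Lambda> z = z" by auto
qed

lemma rng_vertex: "\<kappa> \<in> paths \<Lambda> \<Longrightarrow> rng \<Lambda> \<kappa> \<in> paths_deg \<Lambda> 0"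
  by (simp add: paths_deg_def rng_closed deg_rng)

lemma src_vertex: "\<kappa> \<in> paths \<Lambda> \<Longrightarrow> src \<Lambda> \<kappa> \<in> paths_deg \<Lambda> 0"
  by (simp add: paths_deg_def src_closed deg_src)

text \<open>A common extension would have both paths as its initial segment of one and the same
  degree.\<close>

lemma min_ext_same_degree:
  assumes "\<mu> \<in> paths \<Lambda>" "\<nu> \<in> paths \<Lambda>" "deg \<Lambda> \<mu> = deg \<Lambda> \<nu>" "\<mu> \<noteq> \<nu>"
  shows "min_ext \<Lambda> \<mu> \<nu> = {}"
proof -
  have False if "(\<alpha>, \<beta>) \<in> min_ext \<Lambda> \<mu> \<nu>" for \<alpha> \<beta>
    using that assms factor_unique[of \<mu> \<alpha> \<nu> \<beta>] by (simp add: min_ext_def)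
  then show ?thesis by auto
qed

lemma min_extD:
  assumes "(\<alpha>, \<beta>) \<in> min_ext \<Lambda> \<mu> \<nu>"
  shows "\<alpha> \<in> paths \<Lambda>" "\<beta> \<in> paths \<Lambda>" "src \<Lambda> \<mu> = rng \<Lambda> \<alpha>" "src \<Lambda> \<nu> = rng \<Lambda> \<beta>"
    "pcomp \<Lambda> \<mu> \<alpha> = pcomp \<Lambda> \<nu> \<beta>" "deg \<Lambda> (pcomp \<Lambda> \<mu> \<alpha>) = sup (deg \<Lambda> \<mu>) (deg \<Lambda> \<nu>)"
  using assms by (auto simp: min_ext_def)

end

section \<open>Toeplitz seminorms\<close>

text \<open>
  Relation (T4) is absent: the other relations make \<open>t\<^sub>z - \<Sum> t\<^sub>\<kappa> t\<^sub>\<kappa>\<^sup>*\<close> a projection. So is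
  \<open>t\<^sub>\<kappa> t\<^sub>\<kappa>\<^sup>* t\<^sub>\<kappa> = t\<^sub>\<kappa>\<close>, which follows from (T2) and (T3).
\<close>

definition toeplitz_relations :: "'p two_graph_data \<Rightarrow> ('p star_poly \<Rightarrow> real) \<Rightarrow> bool" where
  "toeplitz_relations \<Lambda> p \<longleftrightarrow>
     (\<forall>z\<in>paths_deg \<Lambda> 0. p (padj (gen z) - gen z) = 0 \<and> p (gen z * gen z - gen z) = 0) \<and>
     (\<forall>z\<in>paths_deg \<Lambda> 0. \<forall>x\<in>paths_deg \<Lambda> 0. z \<noteq> x \<longrightarrow> p (gen z * gen x) = 0) \<and>
     (\<forall>\<kappa>\<in>paths \<Lambda>. \<forall>\<mu>\<in>paths \<Lambda>. src \<Lambda> \<kappa> = rng \<Lambda> \<mu> \<longrightarrow> p (gen \<kappa> * gen \<mu> - gen (pcomp \<Lambda> \<kappa> \<mu>)) = 0) \<and>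
     (\<forall>\<kappa>\<in>paths \<Lambda>. p (padj (gen \<kappa>) * gen \<kappa> - gen (src \<Lambda> \<kappa>)) = 0) \<and>
     (\<forall>\<mu>\<in>paths \<Lambda>. \<forall>\<nu>\<in>paths \<Lambda>.
        p (padj (gen \<mu>) * gen \<nu> - (\<Sum>(\<alpha>, \<beta>)\<in>min_ext \<Lambda> \<mu> \<nu>. gen \<alpha> * padj (gen \<beta>))) = 0)"

locale toeplitz_seminormed = two_graph \<Lambda> + cstar_seminormed "paths \<Lambda>" p
  for \<Lambda> :: "'p two_graph_data" and p +
  assumes relations: "toeplitz_relations \<Lambda> p"
begin

notation eqv (infix \<open>\<doteq>\<close> 50)

lemma gen_closed [simp, intro]: "\<kappa> \<in> paths \<Lambda> \<Longrightarrow> gen \<kappa> \<in> polys (paths \<Lambda>)"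
  by (rule gen_polys)

lemma vertex_path: "z \<in> paths_deg \<Lambda> 0 \<Longrightarrow> z \<in> paths \<Lambda>"
  by (simp add: paths_deg_def)

section \<open>First consequences of the Toeplitz relations\<close>

lemma vertex_adj: "z \<in> paths_deg \<Lambda> 0 \<Longrightarrow> padj (gen z) \<doteq> gen z"
  using relations by (auto simp: toeplitz_relations_def eqv_def vertex_path)

lemma vertex_idem: "z \<in> paths_deg \<Lambda> 0 \<Longrightarrow> gen z * gen z \<doteq> gen z"
  using relations by (auto simp: toeplitz_relations_def eqv_def vertex_path)

lemma vertex_orth:
  "z \<in> paths_deg \<Lambda> 0 \<Longrightarrow> x \<in> paths_deg \<Lambda> 0 \<Longrightarrow> z \<noteq> x \<Longrightarrow> gen z * gen x \<doteq> 0"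
  using relations by (auto simp: toeplitz_relations_def eqv_def vertex_path)

lemma gen_comp:
  "\<kappa> \<in> paths \<Lambda> \<Longrightarrow> \<mu> \<in> paths \<Lambda> \<Longrightarrow> src \<Lambda> \<kappa> = rng \<Lambda> \<mu> \<Longrightarrow> gen \<kappa> * gen \<mu> \<doteq> gen (pcomp \<Lambda> \<kappa> \<mu>)"
  using relations by (auto simp: toeplitz_relations_def eqv_def comp_closed)

lemma gen_adj_gen: "\<kappa> \<in> paths \<Lambda> \<Longrightarrow> padj (gen \<kappa>) * gen \<kappa> \<doteq> gen (src \<Lambda> \<kappa>)"
  using relations by (auto simp: toeplitz_relations_def eqv_def src_closed)

lemma min_ext_term_closed: "i \<in> min_ext \<Lambda> \<mu> \<nu> \<Longrightarrow> (case i of (\<alpha>, \<beta>) \<Rightarrow> gen \<alpha> * padj (gen \<beta>)) \<in> polys (paths \<Lambda>)"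
  by (auto simp: min_ext_def)

lemma gen_adj_gen_min_ext:
  "\<mu> \<in> paths \<Lambda> \<Longrightarrow> \<nu> \<in> paths \<Lambda> \<Longrightarrow>
     padj (gen \<mu>) * gen \<nu> \<doteq> (\<Sum>(\<alpha>, \<beta>)\<in>min_ext \<Lambda> \<mu> \<nu>. gen \<alpha> * padj (gen \<beta>))"
  using relations min_ext_term_closed by (auto simp: toeplitz_relations_def eqv_def intro!: sum_polys)

lemma gen_rng: "\<kappa> \<in> paths \<Lambda> \<Longrightarrow> gen (rng \<Lambda> \<kappa>) * gen \<kappa> \<doteq> gen \<kappa>"
  using gen_comp[of "rng \<Lambda> \<kappa>" \<kappa>] by (simp add: rng_closed src_rng comp_rng)

lemma gen_src: "\<kappa> \<in> paths \<Lambda> \<Longrightarrow> gen \<kappa> * gen (src \<Lambda> \<kappa>) \<doteq> gen \<kappa>"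
  using gen_comp[of \<kappa> "src \<Lambda> \<kappa>"] by (simp add: src_closed rng_src comp_src)

lemma gen_src_adj: "\<kappa> \<in> paths \<Lambda> \<Longrightarrow> gen \<kappa> * padj (gen (src \<Lambda> \<kappa>)) \<doteq> gen \<kappa>"
  by (rule eqv_trans[OF eqv_mult gen_src]) (auto intro: vertex_adj src_vertex)

lemma adj_gen_src: "\<kappa> \<in> paths \<Lambda> \<Longrightarrow> gen (src \<Lambda> \<kappa>) * padj (gen \<kappa>) \<doteq> padj (gen \<kappa>)"
  using eqv_padj[OF gen_src_adj] by (simp add: padj_mult)

text \<open>Insert the source projection of \<kappa> and the range projection of \<mu> between the
  two factors: they belong to distinct vertices and are orthogonal.\<close>

lemma gen_comp_zero:
  assumes "\<kappa> \<in> paths \<Lambda>" "\<mu> \<in> paths \<Lambda>" "src \<Lambda> \<kappa> \<noteq> rng \<Lambda> \<mu>"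
  shows "gen \<kappa> * gen \<mu> \<doteq> 0"
proof -
  have "gen \<kappa> * gen \<mu> \<doteq> (gen \<kappa> * gen (src \<Lambda> \<kappa>)) * (gen (rng \<Lambda> \<mu>) * gen \<mu>)"
    by (intro eqv_mult eqv_sym[OF gen_src] eqv_sym[OF gen_rng] assms)
  also have "(gen \<kappa> * gen (src \<Lambda> \<kappa>)) * (gen (rng \<Lambda> \<mu>) * gen \<mu>) =
      gen \<kappa> * (gen (src \<Lambda> \<kappa>) * gen (rng \<Lambda> \<mu>)) * gen \<mu>"
    by (simp add: mult.assoc)
  also have "\<dots> \<doteq> gen \<kappa> * 0 * gen \<mu>"
    using assms by (intro eqv_mult vertex_orth) (auto simp: src_vertex rng_vertex)
  finally show ?thesis by simp
qed

lemma gen_adj_gen_zero: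
  "\<mu> \<in> paths \<Lambda> \<Longrightarrow> \<nu> \<in> paths \<Lambda> \<Longrightarrow> deg \<Lambda> \<mu> = deg \<Lambda> \<nu> \<Longrightarrow> \<mu> \<noteq> \<nu> \<Longrightarrow> padj (gen \<mu>) * gen \<nu> \<doteq> 0"
  using gen_adj_gen_min_ext[of \<mu> \<nu>] by (simp add: min_ext_same_degree)

text \<open>The elements t_\<kappa> t_\<kappa>^* for \<kappa> of fixed degree and range z are
  mutually orthogonal subprojections of t_z, so their sum is a projection below t_z and the gap is
  one too. This supplies (T4), and later the positivity that makes a critical KMS state vanish at
  v.\<close>

lemma gap_projection:
  assumes z: "z \<in> paths_deg \<Lambda> 0" and S: "finite S" "S \<subseteq> paths_to \<Lambda> z n"
  defines "e \<equiv> gen z - (\<Sum>\<kappa>\<in>S. gen \<kappa> * padj (gen \<kappa>))"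
  shows "padj e * e \<doteq> e"
proof -
  define s where "s = (\<Sum>\<kappa>\<in>S. gen \<kappa> * padj (gen \<kappa>))"
  have S': "\<kappa> \<in> paths \<Lambda>" "rng \<Lambda> \<kappa> = z" "deg \<Lambda> \<kappa> = n" if "\<kappa> \<in> S" for \<kappa>
    using S that by (auto simp: paths_to_def paths_deg_def)
  have closed: "s \<in> polys (paths \<Lambda>)" "gen z \<in> polys (paths \<Lambda>)"
    using S' z by (auto simp: s_def vertex_path)
  have zs: "gen z * s \<doteq> s"
    unfolding s_def sum_distrib_left mult.assoc[symmetric]
    using gen_rng S' by (intro eqv_sum eqv_mult) fastforce+
  have ss: "padj s = s"
    by (simp add: s_def padj_sum padj_mult)
  have "padj (gen z * s) \<doteq> s"
    using eqv_padj[OF zs] ss by simp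
  then have "s * padj (gen z) \<doteq> s" by (simp add: padj_mult ss)
  moreover have "s * padj (gen z) \<doteq> s * gen z"
    using vertex_adj[OF z] closed by (intro eqv_mult) auto
  ultimately have sz: "s * gen z \<doteq> s" by (meson eqv_sym eqv_trans)
  \<comment> \<open>Off-diagonal terms vanish by (T5), since distinct paths of equal degree have no
    common extension; diagonal terms collapse by (T3).\<close>
  have "s * s = (\<Sum>\<kappa>\<in>S. \<Sum>\<mu>\<in>S. gen \<kappa> * (padj (gen \<kappa>) * gen \<mu>) * padj (gen \<mu>))"
    by (simp add: s_def sum_product mult.assoc)
  also have "\<dots> \<doteq> (\<Sum>\<kappa>\<in>S. \<Sum>\<mu>\<in>S. if \<mu> = \<kappa> then gen \<kappa> * padj (gen \<kappa>) else 0)"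
  proof (intro eqv_sum)
    fix \<kappa> \<mu> assume \<kappa>: "\<kappa> \<in> S" and \<mu>: "\<mu> \<in> S"
    show "gen \<kappa> * (padj (gen \<kappa>) * gen \<mu>) * padj (gen \<mu>) \<doteq> (if \<mu> = \<kappa> then gen \<kappa> * padj (gen \<kappa>) else 0)"
    proof (cases "\<mu> = \<kappa>")
      case True
      have "gen \<kappa> * (padj (gen \<kappa>) * gen \<kappa>) * padj (gen \<kappa>) \<doteq> gen \<kappa> * padj (gen \<kappa>)"
        using S'[OF \<kappa>] eqv_trans[OF eqv_mult[OF _ gen_adj_gen[of \<kappa>]] gen_src[of \<kappa>]]
        by (intro eqv_mult) auto
      then show ?thesis using True by simp
    next
      case False
      have "gen \<kappa> * (padj (gen \<kappa>) * gen \<mu>) * padj (gen \<mu>) \<doteq> gen \<kappa> * 0 * padj (gen \<mu>)"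
        using S'[OF \<kappa>] S'[OF \<mu>] False by (intro eqv_mult gen_adj_gen_zero) auto
      then show ?thesis using False by simp
    qed
  qed
  also have "\<dots> = s" using S by (simp add: s_def)
  finally have sss: "s * s \<doteq> s" .
  have "padj e * e = (padj (gen z) - s) * (gen z - s)"
    by (simp add: e_def s_def[symmetric] padj_diff ss)
  also have "\<dots> \<doteq> (gen z - s) * (gen z - s)"
    using closed vertex_adj[OF z] by (intro eqv_mult eqv_diff) auto
  also have "\<dots> = gen z * gen z - gen z * s - (s * gen z - s * s)"
    by (simp add: algebra_simps)
  also have "\<dots> \<doteq> gen z - s - (s - s)"
    by (intro eqv_diff vertex_idem z zs sz sss)
  finally show ?thesis by (simp add: e_def s_def)
qed

lemma toeplitz_family_emb: "toeplitz_family \<Lambda> C (\<lambda>\<mu>. emb (gen \<mu>))"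
  unfolding toeplitz_family_def
proof (intro conjI ballI allI impI)
  fix \<kappa> assume \<kappa>: "\<kappa> \<in> paths \<Lambda>"
  show "emb (gen \<kappa>) \<in> carrier C" using \<kappa> by auto
  have "gen \<kappa> * padj (gen \<kappa>) * gen \<kappa> \<doteq> gen \<kappa> * gen (src \<Lambda> \<kappa>)"
    unfolding mult.assoc using \<kappa> by (intro eqv_mult gen_adj_gen) auto
  then have "gen \<kappa> * padj (gen \<kappa>) * gen \<kappa> \<doteq> gen \<kappa>"
    using \<kappa> by (rule eqv_trans[OF _ gen_src])
  then show "emb (gen \<kappa>) \<otimes>\<^bsub>C\<^esub> adj C (emb (gen \<kappa>)) \<otimes>\<^bsub>C\<^esub> emb (gen \<kappa>) = emb (gen \<kappa>)"
    using \<kappa> by (simp add: emb_adj emb_mult emb_eq_iff_eqv)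
  show "adj C (emb (gen \<kappa>)) \<otimes>\<^bsub>C\<^esub> emb (gen \<kappa>) = emb (gen (src \<Lambda> \<kappa>))"
    using \<kappa> gen_adj_gen[of \<kappa>] by (simp add: emb_adj emb_mult emb_eq_iff_eqv src_closed)
next
  fix z assume z: "z \<in> paths_deg \<Lambda> 0"
  show "adj C (emb (gen z)) = emb (gen z)" "emb (gen z) \<otimes>\<^bsub>C\<^esub> emb (gen z) = emb (gen z)"
    using z vertex_adj[OF z] vertex_idem[OF z] by (simp_all add: emb_adj emb_mult emb_eq_iff_eqv vertex_path)
next
  fix z x assume zx: "z \<in> paths_deg \<Lambda> 0" "x \<in> paths_deg \<Lambda> 0" "z \<noteq> x"
  show "emb (gen z) \<otimes>\<^bsub>C\<^esub> emb (gen x) = \<zero>\<^bsub>C\<^esub>"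
    using zx vertex_orth[OF zx] by (simp add: zero_class emb_mult emb_eq_iff_eqv vertex_path)
next
  fix \<kappa> \<mu> assume *: "\<kappa> \<in> paths \<Lambda>" "\<mu> \<in> paths \<Lambda>" "src \<Lambda> \<kappa> = rng \<Lambda> \<mu>"
  show "emb (gen \<kappa>) \<otimes>\<^bsub>C\<^esub> emb (gen \<mu>) = emb (gen (pcomp \<Lambda> \<kappa> \<mu>))"
    using * gen_comp[OF *] by (simp add: emb_mult emb_eq_iff_eqv comp_closed)
next
  fix z n S assume z: "z \<in> paths_deg \<Lambda> 0" and S: "finite S \<and> S \<subseteq> paths_to \<Lambda> z n"
  define e where "e = gen z - (\<Sum>\<kappa>\<in>S. gen \<kappa> * padj (gen \<kappa>))"
  have S': "\<kappa> \<in> paths \<Lambda>" if "\<kappa> \<in> S" for \<kappa>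
    using S that by (auto simp: paths_to_def paths_deg_def)
  have e: "e \<in> polys (paths \<Lambda>)"
    using z S' by (auto simp: e_def vertex_path)
  have "fsum C (\<lambda>\<kappa>. emb (gen \<kappa>) \<otimes>\<^bsub>C\<^esub> adj C (emb (gen \<kappa>))) S = fsum C (\<lambda>\<kappa>. emb (gen \<kappa> * padj (gen \<kappa>))) S"
    using S' by (intro fsum_cong) (simp add: emb_adj emb_mult)
  also have "\<dots> = emb (\<Sum>\<kappa>\<in>S. gen \<kappa> * padj (gen \<kappa>))"
    using S' by (intro emb_fsum) auto
  finally have "diff C (emb (gen z)) (fsum C (\<lambda>\<kappa>. emb (gen \<kappa>) \<otimes>\<^bsub>C\<^esub> adj C (emb (gen \<kappa>))) S) = emb e"
    using z S' by (simp add: e_def emb_diff vertex_path sum_polys)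
  \<comment> \<open>Being a projection, \<open>e\<close> is its own witness of positivity.\<close>
  also have "emb e = adj C (emb e) \<otimes>\<^bsub>C\<^esub> emb e"
    using gap_projection[OF z, of S n] S e by (simp add: emb_adj emb_mult emb_eq_iff_eqv eqv_sym e_def)
  finally show "positive C (diff C (emb (gen z)) (fsum C (\<lambda>\<kappa>. emb (gen \<kappa>) \<otimes>\<^bsub>C\<^esub> adj C (emb (gen \<kappa>))) S))"
    using e unfolding positive_def by (metis emb_carrier)
next
  fix \<mu> \<nu> assume *: "\<mu> \<in> paths \<Lambda>" "\<nu> \<in> paths \<Lambda>"
  show "adj C (emb (gen \<mu>)) \<otimes>\<^bsub>C\<^esub> emb (gen \<nu>) =
    fsum C (\<lambda>(\<alpha>, \<beta>). emb (gen \<alpha>) \<otimes>\<^bsub>C\<^esub> adj C (emb (gen \<beta>))) (min_ext \<Lambda> \<mu> \<nu>)"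
  proof -
    have "fsum C (\<lambda>(\<alpha>, \<beta>). emb (gen \<alpha>) \<otimes>\<^bsub>C\<^esub> adj C (emb (gen \<beta>))) (min_ext \<Lambda> \<mu> \<nu>) =
        fsum C (\<lambda>i. emb (case i of (\<alpha>, \<beta>) \<Rightarrow> gen \<alpha> * padj (gen \<beta>))) (min_ext \<Lambda> \<mu> \<nu>)"
      by (intro fsum_cong) (auto simp: min_ext_def emb_adj emb_mult)
    also have "\<dots> = emb (\<Sum>(\<alpha>, \<beta>)\<in>min_ext \<Lambda> \<mu> \<nu>. gen \<alpha> * padj (gen \<beta>))"
      by (intro emb_fsum min_ext_term_closed)
    also have "\<dots> = emb (padj (gen \<mu>) * gen \<nu>)"
      using gen_adj_gen_min_ext[OF *] by (subst emb_eq_iff_eqv) (auto dest: eqv_polys intro: eqv_sym)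
    finally show ?thesis using * by (simp add: emb_adj emb_mult)
  qed
qed

subsection \<open>The span of the elements \<open>t\<^sub>\<mu> t\<^sub>\<nu>\<^sup>*\<close>\<close>

text \<open>Closure under \<doteq> makes this the preimage of the linear span of the t_\<mu>
  t_\<nu>^* in the quotient by the null ideal, so products may be rewritten by the Toeplitz
  relations.\<close>

inductive_set spanned :: "'p star_poly set" where
  zero: "0 \<in> spanned"
| step: "\<lbrakk>x \<in> spanned; \<mu> \<in> paths \<Lambda>; \<nu> \<in> paths \<Lambda>\<rbrakk> \<Longrightarrow> x + c \<cdot> (gen \<mu> * padj (gen \<nu>)) \<in> spanned"
| eqv: "\<lbrakk>x \<in> spanned; x \<doteq> y\<rbrakk> \<Longrightarrow> y \<in> spanned"

lemma spanned_polys: "x \<in> spanned \<Longrightarrow> x \<in> polys (paths \<Lambda>)"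
  by (induction rule: spanned.induct) (auto dest: eqv_polys)

lemma spanned_add:
  assumes "y \<in> spanned" "x \<in> spanned"
  shows "x + y \<in> spanned"
  using assms
proof (induction rule: spanned.induct)
  case (step y \<mu> \<nu> c)
  then show ?case using spanned.step[of "x + y" \<mu> \<nu> c] by (simp add: add.assoc)
next
  case (eqv y z)
  then show ?case using spanned.eqv[of "x + y" "x + z"] eqv_add[of x x y z] by (simp add: spanned_polys)
qed simp

lemma spanned_gen_adj: "\<mu> \<in> paths \<Lambda> \<Longrightarrow> \<nu> \<in> paths \<Lambda> \<Longrightarrow> gen \<mu> * padj (gen \<nu>) \<in> spanned"
  using spanned.step[OF spanned.zero, of \<mu> \<nu> 1] by simp

lemma spanned_smul: "x \<in> spanned \<Longrightarrow> c \<cdot> x \<in> spanned"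
proof (induction rule: spanned.induct)
  case (step x \<mu> \<nu> d)
  then show ?case using spanned.step[of "c \<cdot> x" \<mu> \<nu> "c * d"] by (simp add: distrib_left smul_smul)
next
  case (eqv x y)
  then show ?case using spanned.eqv eqv_smul by blast
qed (simp add: spanned.zero)

lemma spanned_sum: "(\<And>i. i \<in> I \<Longrightarrow> f i \<in> spanned) \<Longrightarrow> sum f I \<in> spanned"
  by (induction I rule: infinite_finite_induct) (auto intro: spanned_add spanned.zero)

lemma spanned_left_mult:
  assumes "x \<in> spanned" and y: "y \<in> polys (paths \<Lambda>)"
    and *: "\<And>\<mu> \<nu>. \<mu> \<in> paths \<Lambda> \<Longrightarrow> \<nu> \<in> paths \<Lambda> \<Longrightarrow> y * (gen \<mu> * padj (gen \<nu>)) \<in> spanned"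
  shows "y * x \<in> spanned"
  using assms(1)
proof (induction rule: spanned.induct)
  case (step x \<mu> \<nu> c)
  then show ?case using spanned_add[OF spanned_smul[OF *]] by (simp add: distrib_left mult_smul)
next
  case (eqv x z)
  then show ?case using spanned.eqv[of "y * x" "y * z"] eqv_mult[of y y x z] y by simp
qed (simp add: spanned.zero)

lemma spanned_gen_gen_adj:
  assumes "\<kappa> \<in> paths \<Lambda>" "\<mu> \<in> paths \<Lambda>" "\<nu> \<in> paths \<Lambda>"
  shows "gen \<kappa> * (gen \<mu> * padj (gen \<nu>)) \<in> spanned"
proof (cases "src \<Lambda> \<kappa> = rng \<Lambda> \<mu>")
  case True
  then have "gen \<kappa> * gen \<mu> * padj (gen \<nu>) \<doteq> gen (pcomp \<Lambda> \<kappa> \<mu>) * padj (gen \<nu>)"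
    using assms by (intro eqv_mult gen_comp) auto
  then show ?thesis
    using spanned.eqv[OF spanned_gen_adj eqv_sym, of "pcomp \<Lambda> \<kappa> \<mu>" \<nu>] comp_closed True assms
    by (simp add: mult.assoc)
next
  case False
  then have "gen \<kappa> * gen \<mu> * padj (gen \<nu>) \<doteq> 0 * padj (gen \<nu>)"
    using assms by (intro eqv_mult gen_comp_zero) auto
  then show ?thesis
    using spanned.eqv[OF spanned.zero eqv_sym] by (simp add: mult.assoc)
qed

lemma spanned_gen_adj_adj:
  assumes "\<mu> \<in> paths \<Lambda>" "\<nu> \<in> paths \<Lambda>" "\<kappa> \<in> paths \<Lambda>"
  shows "gen \<mu> * padj (gen \<nu>) * padj (gen \<kappa>) \<in> spanned"
proof (cases "src \<Lambda> \<kappa> = rng \<Lambda> \<nu>")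
  case True
  then have "gen \<mu> * padj (gen \<kappa> * gen \<nu>) \<doteq> gen \<mu> * padj (gen (pcomp \<Lambda> \<kappa> \<nu>))"
    using assms by (intro eqv_mult eqv_padj gen_comp) auto
  then show ?thesis
    using spanned.eqv[OF spanned_gen_adj eqv_sym, of \<mu> "pcomp \<Lambda> \<kappa> \<nu>"] comp_closed True assms
    by (simp add: mult.assoc padj_mult)
next
  case False
  then have "gen \<mu> * padj (gen \<kappa> * gen \<nu>) \<doteq> gen \<mu> * padj 0"
    using assms by (intro eqv_mult eqv_padj gen_comp_zero) auto
  then show ?thesis
    using spanned.eqv[OF spanned.zero eqv_sym] by (simp add: mult.assoc padj_mult)
qed

text \<open>(T5) moves the adjoint to the right: t_\<kappa>^* t_\<mu> becomes a sum of t_\<alpha>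
  t_\<beta>^*, and t_\<beta>^* t_\<nu>^* is again an adjoint of a generator or 0.\<close>

lemma spanned_adj_gen_adj:
  assumes "\<kappa> \<in> paths \<Lambda>" "\<mu> \<in> paths \<Lambda>" "\<nu> \<in> paths \<Lambda>"
  shows "padj (gen \<kappa>) * (gen \<mu> * padj (gen \<nu>)) \<in> spanned"
proof -
  let ?S = "\<Sum>(\<alpha>, \<beta>)\<in>min_ext \<Lambda> \<kappa> \<mu>. gen \<alpha> * padj (gen \<beta>)"
  have "padj (gen \<kappa>) * gen \<mu> * padj (gen \<nu>) \<doteq> ?S * padj (gen \<nu>)"
    using assms by (intro eqv_mult gen_adj_gen_min_ext) auto
  moreover have "?S * padj (gen \<nu>) \<in> spanned"
    unfolding sum_distrib_right
    using assms by (intro spanned_sum) (auto simp: min_ext_def intro!: spanned_gen_adj_adj)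
  ultimately show ?thesis
    using spanned.eqv[OF _ eqv_sym] by (simp add: mult.assoc)
qed

lemma single_Word_Cons: "single (Word (l # ls)) (a :: complex) = single (Word [l]) 1 * single (Word ls) a"
  by (simp add: mult_single plus_star_word_def)

lemma letter_poly: "single (Word [(g, b)]) 1 = (if b then padj (gen g) else gen g)"
  by (cases b) (simp_all add: padj_gen, simp add: gen_def)

text \<open>Peel off the leftmost letter and use that the span is stable under left multiplication
  by generators and their adjoints. A single letter is in the span because the source projection can
  be inserted: t_g = t_g t_s^* and t_g^* = t_s t_g^* with s the source of g.\<close>

lemma spanned_word: "Word ls \<in> words (paths \<Lambda>) \<Longrightarrow> single (Word ls) 1 \<in> spanned"
proof (induction ls)
  case (Cons l ls)
  obtain g b where l: "l = (g, b)" by (cases l)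
  have g: "g \<in> paths \<Lambda>" using Cons.prems by (auto simp: words_def l)
  show ?case
  proof (cases "ls = []")
    case True
    have "gen g \<in> spanned" "padj (gen g) \<in> spanned"
      using spanned.eqv[OF spanned_gen_adj gen_src_adj[OF g]] spanned.eqv[OF spanned_gen_adj adj_gen_src[OF g]]
        g src_closed[OF g] by simp_all
    then show ?thesis by (simp add: True l letter_poly)
  next
    case False
    then have "single (Word ls) 1 \<in> spanned" using Cons by (auto simp: words_def)
    then have "gen g * single (Word ls) 1 \<in> spanned" "padj (gen g) * single (Word ls) 1 \<in> spanned"
      using spanned_left_mult[OF _ gen_closed[OF g] spanned_gen_gen_adj[OF g]]
        spanned_left_mult[OF _ padj_polys[OF gen_closed[OF g]] spanned_adj_gen_adj[OF g]] by simp_all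
    then show ?thesis unfolding l single_Word_Cons[of _ ls] letter_poly by simp
  qed
qed (simp add: words_def)

theorem spanned_eq_polys: "spanned = polys (paths \<Lambda>)"
proof
  show "polys (paths \<Lambda>) \<subseteq> spanned"
  proof
    fix x assume "x \<in> polys (paths \<Lambda>)"
    then show "x \<in> spanned"
    proof (induction rule: poly_induct)
      case (add x w a)
      have "single w 1 \<in> spanned" using spanned_word[of "letters w"] add by simp
      then have "a \<cdot> single w 1 \<in> spanned" by (rule spanned_smul)
      then show ?case using add.IH spanned_add by (simp add: smul_single)
    qed (rule spanned.zero)
  qed
qed (auto simp: spanned_polys)

text \<open>Any property of polynomials that respects \<doteq> now needs checking only along the
  addition of spanning elements.\<close>

lemmas span_induct = spanned.induct[unfolded spanned_eq_polys, consumes 1, case_names zero step eqv]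

lemma bounded_functional_eq_on_span:
  assumes L: "bounded_functional C L" and M: "bounded_functional C M"
    and eq: "\<And>\<mu> \<nu>. \<mu> \<in> paths \<Lambda> \<Longrightarrow> \<nu> \<in> paths \<Lambda> \<Longrightarrow>
      L (emb (gen \<mu>) \<otimes>\<^bsub>C\<^esub> adj C (emb (gen \<nu>))) = M (emb (gen \<mu>) \<otimes>\<^bsub>C\<^esub> adj C (emb (gen \<nu>)))"
    and X: "X \<in> carrier C"
  shows "L X = M X"
proof (rule bounded_functional_eqI[OF L M _ X])
  have lin: "N (emb (x + c \<cdot> y)) = N (emb x) + c * N (emb y)"
    if "bounded_functional C N" "x \<in> polys (paths \<Lambda>)" "y \<in> polys (paths \<Lambda>)" for N x c y
  proof -
    have e: "emb (x + c \<cdot> y) = emb x \<oplus>\<^bsub>C\<^esub> c \<odot>\<^bsub>C\<^esub> emb y" "emb x \<in> carrier C" "emb y \<in> carrier C"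
      using that by (auto simp: emb_add emb_scale)
    then have "c \<odot>\<^bsub>C\<^esub> emb y \<in> carrier C" by blast
    then show ?thesis using that(1) e unfolding bounded_functional_def by simp
  qed
  fix x assume "x \<in> polys (paths \<Lambda>)"
  then show "L (emb x) = M (emb x)"
  proof (induction rule: span_induct)
    case zero
    show ?case using lin[OF L, of 0 0 1] lin[OF M, of 0 0 1] by simp
  next
    case (step x \<mu> \<nu> c)
    then show ?case using eq[of \<mu> \<nu>] by (simp add: lin[OF L] lin[OF M] emb_adj emb_mult)
  next
    case (eqv x y)
    then have "emb x = emb y" using eqv_polys[of x y] by (simp add: emb_eq_iff_eqv)
    then show ?case using eqv by simp
  qed
qed

lemma star_hom_eq_on_span:
  assumes "cstar_seminormed H q"
  defines "B \<equiv> completion (free_star_algebra H q)"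
  assumes \<pi>: "star_hom C B \<pi>" and \<rho>: "star_hom C B \<rho>"
    and eq: "\<And>\<mu> \<nu>. \<mu> \<in> paths \<Lambda> \<Longrightarrow> \<nu> \<in> paths \<Lambda> \<Longrightarrow>
      \<pi> (emb (gen \<mu>) \<otimes>\<^bsub>C\<^esub> adj C (emb (gen \<nu>))) = \<rho> (emb (gen \<mu>) \<otimes>\<^bsub>C\<^esub> adj C (emb (gen \<nu>)))"
  shows "\<pi> = \<rho>"
proof (rule star_hom_eqI[OF cstar_seminormed_axioms assms(1)])
  show "star_hom C (completion (free_star_algebra H q)) \<pi>" "star_hom C (completion (free_star_algebra H q)) \<rho>"
    using \<pi> \<rho> by (simp_all add: B_def)
  have lin: "\<sigma> (emb (x + c \<cdot> y)) = \<sigma> (emb x) \<oplus>\<^bsub>B\<^esub> c \<odot>\<^bsub>B\<^esub> \<sigma> (emb y)"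
    if "star_hom C B \<sigma>" "x \<in> polys (paths \<Lambda>)" "y \<in> polys (paths \<Lambda>)" for \<sigma> x c y
  proof -
    have e: "emb (x + c \<cdot> y) = emb x \<oplus>\<^bsub>C\<^esub> c \<odot>\<^bsub>C\<^esub> emb y" "emb x \<in> carrier C" "emb y \<in> carrier C"
      using that by (auto simp: emb_add emb_scale)
    then have "c \<odot>\<^bsub>C\<^esub> emb y \<in> carrier C" by blast
    then show ?thesis using that(1) e unfolding star_hom_def by simp
  qed
  have hom_zero: "\<sigma> (emb 0) = \<zero>\<^bsub>B\<^esub>" if "star_hom C B \<sigma>" for \<sigma>
  proof -
    have "\<sigma> (emb 0) \<in> carrier B" "\<sigma> (0 \<odot>\<^bsub>C\<^esub> emb 0) = 0 \<odot>\<^bsub>B\<^esub> \<sigma> (emb 0)"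
      using that emb_carrier[of 0] unfolding star_hom_def by auto
    then show ?thesis
      using cstar_seminormed.scale_zero[OF assms(1)] by (simp add: emb_scale B_def)
  qed
  fix x assume "x \<in> polys (paths \<Lambda>)"
  then show "\<pi> (emb x) = \<rho> (emb x)"
  proof (induction rule: span_induct)
    case zero
    show ?case using hom_zero[OF \<pi>] hom_zero[OF \<rho>] by simp
  next
    case (step x \<mu> \<nu> c)
    then show ?case using eq[of \<mu> \<nu>] by (simp add: lin[OF \<pi>] lin[OF \<rho>] emb_adj emb_mult)
  next
    case (eqv x y)
    then have "emb x = emb y" using eqv_polys[of x y] by (simp add: emb_eq_iff_eqv)
    then show ?case using eqv by simp
  qed
qed

end

subsection \<open>The universal seminorm\<close>

lemma (in cstar_seminormed) eqvD: "eqv x y \<Longrightarrow> p (x - y) = 0"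
  by (simp add: eqv_def)

lemma (in cstar_seminormed) eqv_norm: "eqv x y \<Longrightarrow> p x = p y"
  using abs_diff_le[of x y] by (simp add: eqv_def)

context toeplitz_seminormed
begin

text \<open>For a projection the C*-identity reads p^2 = p, so its seminorm is 0 or 1.\<close>

lemma norm_vertex_le: "z \<in> paths_deg \<Lambda> 0 \<Longrightarrow> p (gen z) \<le> 1"
proof -
  assume z: "z \<in> paths_deg \<Lambda> 0"
  have "padj (gen z) * gen z \<doteq> gen z * gen z"
    using z by (intro eqv_mult vertex_adj) (auto simp: vertex_path)
  then have "padj (gen z) * gen z \<doteq> gen z" using vertex_idem[OF z] by (rule eqv_trans)
  then have "(p (gen z))\<^sup>2 = p (gen z)"
    using eqv_norm cstar_identity[of "gen z"] z by (simp add: vertex_path)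
  then show ?thesis by (auto simp: power2_eq_square)
qed

lemma norm_gen_le: "\<kappa> \<in> paths \<Lambda> \<Longrightarrow> p (gen \<kappa>) \<le> 1"
proof -
  assume \<kappa>: "\<kappa> \<in> paths \<Lambda>"
  then have "(p (gen \<kappa>))\<^sup>2 = p (gen (src \<Lambda> \<kappa>))"
    using eqv_norm[OF gen_adj_gen[OF \<kappa>]] cstar_identity[of "gen \<kappa>"] by simp
  then have "(p (gen \<kappa>))\<^sup>2 \<le> 1\<^sup>2" using norm_vertex_le[OF src_vertex[OF \<kappa>]] by simp
  then show ?thesis by (rule power2_le_imp_le) simp
qed

lemma norm_letter_le: "g \<in> paths \<Lambda> \<Longrightarrow> p (single (Word [(g, b)]) 1) \<le> 1"
  using norm_gen_le[of g] norm_padj[of "gen g"] by (simp add: letter_poly)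

lemma norm_word_le: "Word ls \<in> words (paths \<Lambda>) \<Longrightarrow> p (single (Word ls) 1) \<le> 1"
proof (induction ls)
  case (Cons l ls)
  obtain g b where l: "l = (g, b)" by (cases l)
  have g: "g \<in> paths \<Lambda>" using Cons.prems by (auto simp: words_def l)
  show ?case
  proof (cases "ls = []")
    case False
    then have w: "Word ls \<in> words (paths \<Lambda>)" using Cons by (auto simp: words_def)
    have lw: "Word [(g, b)] \<in> words (paths \<Lambda>)" using g by (auto simp: words_def)
    have "p (single (Word (l # ls)) 1) \<le> p (single (Word [(g, b)]) 1) * p (single (Word ls) 1)"
      unfolding l single_Word_Cons[of _ ls] using w lw by (intro submult) auto
    also have "\<dots> \<le> 1 * 1"
      using w lw norm_letter_le[OF g] Cons.IH by (intro mult_mono nonneg) auto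
    finally show ?thesis by simp
  qed (use norm_letter_le[OF g] l in simp)
qed (simp add: words_def)

text \<open>All words have seminorm at most 1, so the l1-norm of the coefficients bounds every
  Toeplitz seminorm at once. Without this uniform bound the supremum in the universal norm would
  carry no information.\<close>

lemma norm_le_coeffs:
  assumes "x \<in> polys (paths \<Lambda>)"
  shows "p x \<le> (\<Sum>w\<in>keys x. cmod (lookup x w))"
proof -
  have w: "w \<in> words (paths \<Lambda>)" if "w \<in> keys x" for w
    using assms that by (auto simp: polys_def)
  have "p (\<Sum>w\<in>keys x. single w (lookup x w)) \<le> (\<Sum>w\<in>keys x. p (single w (lookup x w)))"
    using w by (intro sum_le) auto
  also have "\<dots> \<le> (\<Sum>w\<in>keys x. cmod (lookup x w))"
  proof (intro sum_mono)
    fix w assume "w \<in> keys x"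
    then have "p (lookup x w \<cdot> single w 1) \<le> cmod (lookup x w) * 1"
      using w norm_word_le[of "letters w"] by (subst smul) (auto intro!: mult_left_le)
    then show "p (single w (lookup x w)) \<le> cmod (lookup x w)" by (simp add: smul_single)
  qed
  finally show ?thesis by (simp add: poly_expansion[symmetric])
qed

end

definition toeplitz_norm :: "'p two_graph_data \<Rightarrow> 'p star_poly \<Rightarrow> real" where
  "toeplitz_norm \<Lambda> x = (SUP p\<in>toeplitz_seminorms \<Lambda>. p x)"

lemma toeplitz_free_eq: "toeplitz_free \<Lambda> = free_star_algebra (paths \<Lambda>) (toeplitz_norm \<Lambda>)"
  by (simp add: toeplitz_free_def toeplitz_norm_def[abs_def])

context two_graph
begin

text \<open>An equation between images of polynomials in the completion says exactly that
  \<open>p\<close> vanishes on the difference, so each relation of the family translates back to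
  polynomials.\<close>

lemma relations_of_family:
  assumes cs: "cstar_seminorm (free_star_algebra (paths \<Lambda>) p)"
    and fam: "toeplitz_family \<Lambda> (completion (free_star_algebra (paths \<Lambda>) p))
      (\<lambda>\<mu>. embed (free_star_algebra (paths \<Lambda>) p) (gen \<mu>))"
  shows "toeplitz_relations \<Lambda> p"
proof -
  interpret cstar_seminormed "paths \<Lambda>" p by standard (rule cs)
  note f = fam[unfolded toeplitz_family_def]
  note fam_vertex = f[THEN conjunct2, THEN conjunct1]
  note fam_orth = f[THEN conjunct2, THEN conjunct2, THEN conjunct1]
  note fam_comp = f[THEN conjunct2, THEN conjunct2, THEN conjunct2, THEN conjunct1]
  note fam_src = f[THEN conjunct2, THEN conjunct2, THEN conjunct2, THEN conjunct2, THEN conjunct1]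
  note fam_min = f[THEN conjunct2, THEN conjunct2, THEN conjunct2, THEN conjunct2, THEN conjunct2, THEN conjunct2]
  have v: "z \<in> paths \<Lambda>" if "z \<in> paths_deg \<Lambda> 0" for z using that by (simp add: paths_deg_def)
  have "p (padj (gen z) - gen z) = 0 \<and> p (gen z * gen z - gen z) = 0" if z: "z \<in> paths_deg \<Lambda> 0" for z
  proof -
    have "adj C (emb (gen z)) = emb (gen z) \<and> emb (gen z) \<otimes>\<^bsub>C\<^esub> emb (gen z) = emb (gen z)"
      using fam_vertex z by blast
    then show ?thesis using v[OF z] by (simp add: emb_adj emb_mult emb_eq_iff)
  qed
  moreover have "p (gen z * gen x) = 0"
    if z: "z \<in> paths_deg \<Lambda> 0" "x \<in> paths_deg \<Lambda> 0" "z \<noteq> x" for z x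
  proof -
    have "emb (gen z) \<otimes>\<^bsub>C\<^esub> emb (gen x) = \<zero>\<^bsub>C\<^esub>"
      using fam_orth z by blast
    then show ?thesis using v[OF z(1)] v[OF z(2)] by (simp add: emb_mult zero_class emb_eq_iff)
  qed
  moreover have "p (gen \<kappa> * gen \<mu> - gen (pcomp \<Lambda> \<kappa> \<mu>)) = 0"
    if \<kappa>: "\<kappa> \<in> paths \<Lambda>" "\<mu> \<in> paths \<Lambda>" "src \<Lambda> \<kappa> = rng \<Lambda> \<mu>" for \<kappa> \<mu>
  proof -
    have "emb (gen \<kappa>) \<otimes>\<^bsub>C\<^esub> emb (gen \<mu>) = emb (gen (pcomp \<Lambda> \<kappa> \<mu>))"
      using fam_comp \<kappa> by blast
    then show ?thesis using \<kappa> by (simp add: emb_mult emb_eq_iff comp_closed)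
  qed
  moreover have "p (padj (gen \<kappa>) * gen \<kappa> - gen (src \<Lambda> \<kappa>)) = 0" if \<kappa>: "\<kappa> \<in> paths \<Lambda>" for \<kappa>
  proof -
    have "adj C (emb (gen \<kappa>)) \<otimes>\<^bsub>C\<^esub> emb (gen \<kappa>) = emb (gen (src \<Lambda> \<kappa>))"
      using fam_src \<kappa> by blast
    then show ?thesis using \<kappa> by (simp add: emb_mult emb_adj emb_eq_iff src_closed)
  qed
  moreover have "p (padj (gen \<mu>) * gen \<nu> - (\<Sum>(\<alpha>, \<beta>)\<in>min_ext \<Lambda> \<mu> \<nu>. gen \<alpha> * padj (gen \<beta>))) = 0"
    if *: "\<mu> \<in> paths \<Lambda>" "\<nu> \<in> paths \<Lambda>" for \<mu> \<nu>
  proof -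
    have t: "i \<in> min_ext \<Lambda> \<mu> \<nu> \<Longrightarrow> (case i of (\<alpha>, \<beta>) \<Rightarrow> gen \<alpha> * padj (gen \<beta>)) \<in> polys (paths \<Lambda>)" for i
      by (auto simp: min_ext_def)
    have "adj C (emb (gen \<mu>)) \<otimes>\<^bsub>C\<^esub> emb (gen \<nu>) =
        fsum C (\<lambda>(\<alpha>, \<beta>). emb (gen \<alpha>) \<otimes>\<^bsub>C\<^esub> adj C (emb (gen \<beta>))) (min_ext \<Lambda> \<mu> \<nu>)"
      using fam_min * by blast
    also have "\<dots> = fsum C (\<lambda>i. emb (case i of (\<alpha>, \<beta>) \<Rightarrow> gen \<alpha> * padj (gen \<beta>))) (min_ext \<Lambda> \<mu> \<nu>)"
      by (intro fsum_cong) (auto simp: min_ext_def emb_adj emb_mult)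
    also have "\<dots> = emb (\<Sum>(\<alpha>, \<beta>)\<in>min_ext \<Lambda> \<mu> \<nu>. gen \<alpha> * padj (gen \<beta>))"
      by (intro emb_fsum t)
    finally have "emb (padj (gen \<mu>) * gen \<nu>) = emb (\<Sum>(\<alpha>, \<beta>)\<in>min_ext \<Lambda> \<mu> \<nu>. gen \<alpha> * padj (gen \<beta>))"
      using * by (simp add: emb_adj emb_mult)
    then show ?thesis using * t by (subst (asm) emb_eq_iff) (auto intro!: sum_polys)
  qed
  ultimately show ?thesis by (simp add: toeplitz_relations_def)
qed

lemma toeplitz_seminorms_iff: "p \<in> toeplitz_seminorms \<Lambda> \<longleftrightarrow> toeplitz_seminormed \<Lambda> p"
proof
  assume "p \<in> toeplitz_seminorms \<Lambda>"
  then show "toeplitz_seminormed \<Lambda> p"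
    using relations_of_family[of p]
    by unfold_locales (simp_all add: toeplitz_seminorms_def Let_def)
next
  assume "toeplitz_seminormed \<Lambda> p"
  then interpret toeplitz_seminormed \<Lambda> p .
  show "p \<in> toeplitz_seminorms \<Lambda>"
    using cstar toeplitz_family_emb by (simp add: toeplitz_seminorms_def Let_def)
qed

text \<open>The zero seminorm satisfies every relation. It makes the family of seminorms nonempty,
  so that the supremum is meaningful, and it makes the supremum nonnegative.\<close>

lemma zero_toeplitz_seminorm: "(\<lambda>x. 0) \<in> toeplitz_seminorms \<Lambda>"
  unfolding toeplitz_seminorms_iff
  by unfold_locales (auto simp: cstar_seminorm_def toeplitz_relations_def)

lemma toeplitz_norm_upper:
  assumes "p \<in> toeplitz_seminorms \<Lambda>" "x \<in> polys (paths \<Lambda>)"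
  shows "p x \<le> toeplitz_norm \<Lambda> x"
proof -
  have "bdd_above ((\<lambda>p. p x) ` toeplitz_seminorms \<Lambda>)"
    using toeplitz_seminormed.norm_le_coeffs[OF _ assms(2)]
    by (auto simp: toeplitz_seminorms_iff intro!: bdd_aboveI)
  then show ?thesis unfolding toeplitz_norm_def by (intro cSUP_upper assms)
qed

lemma toeplitz_norm_least:
  "(\<And>p. p \<in> toeplitz_seminorms \<Lambda> \<Longrightarrow> p x \<le> K) \<Longrightarrow> toeplitz_norm \<Lambda> x \<le> K"
  unfolding toeplitz_norm_def using zero_toeplitz_seminorm by (intro cSUP_least) auto

lemma toeplitz_norm_zeroI:
  "(\<And>p. p \<in> toeplitz_seminorms \<Lambda> \<Longrightarrow> p x = 0) \<Longrightarrow> x \<in> polys (paths \<Lambda>) \<Longrightarrow> toeplitz_norm \<Lambda> x = 0"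
  using toeplitz_norm_least[of x 0] toeplitz_norm_upper[OF zero_toeplitz_seminorm, of x] by fastforce

text \<open>Each axiom of a C*-seminorm survives a pointwise bounded supremum, and a polynomial on
  which all seminorms vanish has supremum 0, so the relations survive as well.\<close>

theorem toeplitz_norm_seminormed: "toeplitz_seminormed \<Lambda> (toeplitz_norm \<Lambda>)"
proof -
  let ?N = "toeplitz_norm \<Lambda>"
  let ?P = "polys (paths \<Lambda>)"
  have cs: "cstar_seminormed (paths \<Lambda>) p" if "p \<in> toeplitz_seminorms \<Lambda>" for p
    using that by (simp add: toeplitz_seminorms_iff toeplitz_seminormed_def)
  note up = toeplitz_norm_upper
  have nonneg: "0 \<le> ?N x" if "x \<in> ?P" for x
    using up[OF zero_toeplitz_seminorm that] by simp
  have smul_le: "?N (c \<cdot> x) \<le> cmod c * ?N x" if "x \<in> ?P" for c x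
  proof (rule toeplitz_norm_least)
    fix p assume p: "p \<in> toeplitz_seminorms \<Lambda>"
    show "p (c \<cdot> x) \<le> cmod c * ?N x"
      unfolding cstar_seminormed.smul[OF cs[OF p] that] using up[OF p that] by (rule mult_left_mono) simp
  qed
  have seminorm: "cstar_seminorm (free_star_algebra (paths \<Lambda>) ?N)"
    unfolding cstar_seminorm_def free_star_algebra_simps
  proof (intro conjI ballI allI)
    fix x y assume xy: "x \<in> ?P" "y \<in> ?P"
    show "?N (x + y) \<le> ?N x + ?N y"
    proof (rule toeplitz_norm_least)
      fix p assume p: "p \<in> toeplitz_seminorms \<Lambda>"
      show "p (x + y) \<le> ?N x + ?N y"
        using cstar_seminormed.triangle[OF cs[OF p] xy] up[OF p xy(1)] up[OF p xy(2)] by linarith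
    qed
    show "?N (x * y) \<le> ?N x * ?N y"
    proof (rule toeplitz_norm_least)
      fix p assume p: "p \<in> toeplitz_seminorms \<Lambda>"
      have "p (x * y) \<le> p x * p y" using cstar_seminormed.submult[OF cs[OF p] xy] .
      also have "\<dots> \<le> ?N x * ?N y"
        using xy by (intro mult_mono up p nonneg cstar_seminormed.nonneg[OF cs]) auto
      finally show "p (x * y) \<le> ?N x * ?N y" .
    qed
  next
    fix c x assume x: "x \<in> ?P"
    show "?N (c \<cdot> x) = cmod c * ?N x"
    proof (cases "c = 0")
      case True
      then show ?thesis using smul_le[OF x, of 0] nonneg[of 0] by simp
    next
      case False
      \<comment> \<open>Scaling back by 1/c turns the upper estimate into the lower one.\<close>
      have "?N ((1 / c) \<cdot> c \<cdot> x) \<le> cmod (1 / c) * ?N (c \<cdot> x)"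
        using x by (intro smul_le) auto
      then have "cmod c * ?N x \<le> ?N (c \<cdot> x)"
        using False by (simp add: smul_smul norm_divide field_simps)
      then show ?thesis using smul_le[OF x, of c] by simp
    qed
  next
    fix x assume x: "x \<in> ?P"
    \<comment> \<open>The square root lets the estimate be checked for one seminorm at a time;
      squaring afterwards gives the difficult half of the C*-identity.\<close>
    have "?N x \<le> sqrt (?N (padj x * x))"
    proof (rule toeplitz_norm_least)
      fix p assume p: "p \<in> toeplitz_seminorms \<Lambda>"
      have "(p x)\<^sup>2 \<le> ?N (padj x * x)"
        using cstar_seminormed.cstar_identity[OF cs[OF p] x] up[OF p, of "padj x * x"] x by simp
      then show "p x \<le> sqrt (?N (padj x * x))" by (rule real_le_rsqrt)
    qed
    then have "(?N x)\<^sup>2 \<le> ?N (padj x * x)"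
      using nonneg[OF x] x nonneg[of "padj x * x"] by (metis mult_polys padj_polys real_sqrt_ge_0_iff real_sqrt_pow2 power_mono)
    moreover have "?N (padj x * x) \<le> (?N x)\<^sup>2"
    proof (rule toeplitz_norm_least)
      fix p assume p: "p \<in> toeplitz_seminorms \<Lambda>"
      show "p (padj x * x) \<le> (?N x)\<^sup>2"
        using cstar_seminormed.cstar_identity[OF cs[OF p] x] up[OF p x]
          cstar_seminormed.nonneg[OF cs[OF p] x] by (simp add: power_mono)
    qed
    ultimately show "?N (padj x * x) = (?N x)\<^sup>2" by simp
  qed (rule nonneg)
  have "toeplitz_relations \<Lambda> ?N"
    unfolding toeplitz_relations_def
  proof (intro conjI ballI impI)
    fix z assume z: "z \<in> paths_deg \<Lambda> 0"
    then have "z \<in> paths \<Lambda>" by (simp add: paths_deg_def)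
    then show "?N (padj (gen z) - gen z) = 0" "?N (gen z * gen z - gen z) = 0"
      using z by (auto intro!: toeplitz_norm_zeroI simp: toeplitz_seminorms_iff toeplitz_seminormed_def
          toeplitz_seminormed_axioms_def toeplitz_relations_def)
  next
    fix z x assume z: "z \<in> paths_deg \<Lambda> 0" "x \<in> paths_deg \<Lambda> 0" "z \<noteq> x"
    then have "z \<in> paths \<Lambda>" "x \<in> paths \<Lambda>" by (auto simp: paths_deg_def)
    then show "?N (gen z * gen x) = 0"
      using z by (auto intro!: toeplitz_norm_zeroI simp: toeplitz_seminorms_iff toeplitz_seminormed_def
          toeplitz_seminormed_axioms_def toeplitz_relations_def)
  next
    fix \<kappa> \<mu> assume "\<kappa> \<in> paths \<Lambda>" "\<mu> \<in> paths \<Lambda>" "src \<Lambda> \<kappa> = rng \<Lambda> \<mu>"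
    then show "?N (gen \<kappa> * gen \<mu> - gen (pcomp \<Lambda> \<kappa> \<mu>)) = 0"
      by (auto intro!: toeplitz_norm_zeroI simp: comp_closed toeplitz_seminorms_iff toeplitz_seminormed_def
          toeplitz_seminormed_axioms_def toeplitz_relations_def)
  next
    fix \<kappa> assume "\<kappa> \<in> paths \<Lambda>"
    then show "?N (padj (gen \<kappa>) * gen \<kappa> - gen (src \<Lambda> \<kappa>)) = 0"
      by (auto intro!: toeplitz_norm_zeroI simp: src_closed toeplitz_seminorms_iff toeplitz_seminormed_def
          toeplitz_seminormed_axioms_def toeplitz_relations_def)
  next
    fix \<mu> \<nu> assume *: "\<mu> \<in> paths \<Lambda>" "\<nu> \<in> paths \<Lambda>"
    have "(\<Sum>(\<alpha>, \<beta>)\<in>min_ext \<Lambda> \<mu> \<nu>. gen \<alpha> * padj (gen \<beta>)) \<in> ?P"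
      by (intro sum_polys) (auto simp: min_ext_def)
    with * show "?N (padj (gen \<mu>) * gen \<nu> - (\<Sum>(\<alpha>, \<beta>)\<in>min_ext \<Lambda> \<mu> \<nu>. gen \<alpha> * padj (gen \<beta>))) = 0"
      by (intro toeplitz_norm_zeroI) (auto simp: toeplitz_seminorms_iff toeplitz_seminormed_def
          toeplitz_seminormed_axioms_def toeplitz_relations_def)
  qed
  with seminorm show ?thesis by unfold_locales
qed

end

section \<open>Cocycles\<close>

fun twist_letter :: "('g \<Rightarrow> complex) \<Rightarrow> 'g \<times> bool \<Rightarrow> complex" where
  "twist_letter c (g, b) = (if b then cnj (c g) else c g)"

definition twist_word :: "('g \<Rightarrow> complex) \<Rightarrow> 'g star_word \<Rightarrow> complex" where
  "twist_word c w = prod_list (map (twist_letter c) (letters w))"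

text \<open>This is the endomorphism of the free *-algebra sending each generator g to c(g) g; it is
  diagonal on words, so multiplying coefficients is enough.\<close>

definition twist :: "('g \<Rightarrow> complex) \<Rightarrow> 'g star_poly \<Rightarrow> 'g star_poly" where
  "twist c x = Poly_Mapping.mapp (\<lambda>w a. twist_word c w * a) x"

lemma lookup_twist: "lookup (twist c x) w = twist_word c w * lookup x w"
  by (simp add: twist_def lookup_mapp in_keys_iff when_def)

lemma twist_add: "twist c (x + y) = twist c x + twist c y"
  by (rule poly_mapping_eqI) (simp add: lookup_twist lookup_add distrib_left)

lemma twist_smul: "twist c (a \<cdot> x) = a \<cdot> twist c x"
  by (rule poly_mapping_eqI) (simp add: lookup_twist lookup_smul)

lemma twist_0 [simp]: "twist c 0 = 0"
  by (rule poly_mapping_eqI) (simp add: lookup_twist)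

lemma twist_diff: "twist c (x - y) = twist c x - twist c y"
  by (rule poly_mapping_eqI) (simp add: lookup_twist lookup_minus right_diff_distrib)

lemma twist_sum: "twist c (sum f I) = (\<Sum>i\<in>I. twist c (f i))"
  by (induction I rule: infinite_finite_induct) (auto simp: twist_add)

lemma twist_word_add: "twist_word c (v + w) = twist_word c v * twist_word c w"
  by (simp add: twist_word_def plus_star_word_def)

lemma twist_word_adj: "twist_word c (word_adj w) = cnj (twist_word c w)"
proof -
  have "prod_list (map (twist_letter c) (rev (map (\<lambda>(g, b). (g, \<not> b)) ls))) =
      cnj (prod_list (map (twist_letter c) ls))" for ls
    by (induction ls) (auto split: if_splits)
  then show ?thesis by (simp add: twist_word_def word_adj_def)
qed

lemma twist_single: "twist c (single w a) = single w (twist_word c w * a)"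
  by (rule poly_mapping_eqI) (auto simp: lookup_twist lookup_single when_def)

lemma twist_mult: "twist c (x * y) = twist c x * twist c y"
  by (rule poly_mult_eqI)
    (auto simp: twist_add distrib_left distrib_right twist_single mult_single twist_word_add algebra_simps)

lemma twist_padj: "twist c (padj x) = padj (twist c x)"
  by (rule poly_mapping_eqI) (simp add: lookup_twist lookup_padj twist_word_adj)

lemma twist_scalar [simp]: "twist c (single 0 a) = single 0 a"
  by (simp add: twist_single twist_word_def zero_star_word_def)

lemma twist_gen: "twist c (gen g) = c g \<cdot> gen g"
  by (simp add: gen_def twist_single twist_word_def smul_single)

lemma twist_gen_adj: "twist c (gen g * padj (gen h)) = (c g * cnj (c h)) \<cdot> (gen g * padj (gen h))"
  by (simp add: twist_mult twist_padj twist_gen padj_smul mult_smul[of "gen g"] smul_smul mult.assoc)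

lemma twist_word_zero: "(g, b) \<in> set (letters w) \<Longrightarrow> c g = 0 \<Longrightarrow> twist_word c w = 0"
  by (force simp: twist_word_def prod_list_zero_iff image_iff)

lemma twist_polys:
  assumes "x \<in> polys G" and "\<And>g. g \<in> G \<Longrightarrow> c g \<noteq> 0 \<Longrightarrow> g \<in> H"
  shows "twist c x \<in> polys H"
proof -
  have "w \<in> words H" if "w \<in> keys (twist c x)" for w
  proof -
    have "twist_word c w \<noteq> 0" "w \<in> keys x"
      using that by (auto simp: in_keys_iff lookup_twist)
    then have "w \<in> words G" "\<And>g b. (g, b) \<in> set (letters w) \<Longrightarrow> c g \<noteq> 0"
      using assms(1) twist_word_zero[of _ _ w c] by (auto simp: polys_def)
    then show ?thesis using assms(2) by (fastforce simp: words_def)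
  qed
  then show ?thesis by (auto simp: polys_def)
qed

text \<open>Starred letters carry the conjugate scalars, whose product is also 1, so every word
  returns with coefficient 1. This is what makes the dynamics invertible.\<close>

lemma twist_twist:
  assumes "\<And>g. c g * d g = 1"
  shows "twist c (twist d x) = x"
proof -
  have "prod_list (map (twist_letter c) ls) * prod_list (map (twist_letter d) ls) = 1" for ls
  proof (induction ls)
    case (Cons l ls)
    obtain g b where l: "l = (g, b)" by (cases l)
    have "twist_letter c l * twist_letter d l = 1"
      using assms[of g] by (auto simp: l simp flip: complex_cnj_mult)
    then show ?case using Cons by (simp add: mult.assoc mult.left_commute) (metis mult.assoc mult.commute mult_1)
  qed simp
  then show ?thesis
    by (intro poly_mapping_eqI) (simp add: lookup_twist twist_word_def mult.assoc[symmetric])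
qed

text \<open>
  Multiplying each generator \<open>t\<^sub>\<kappa>\<close> by \<open>c(\<kappa>)\<close> covers both the gauge action (\<open>c\<close> unimodular) and the
  quotient map that removes a vertex (\<open>c\<close> the indicator of the remaining paths).
\<close>

locale cocycle = two_graph \<Lambda> for \<Lambda> :: "'p two_graph_data" +
  fixes c :: "'p \<Rightarrow> complex"
  assumes c_comp: "\<kappa> \<in> paths \<Lambda> \<Longrightarrow> \<mu> \<in> paths \<Lambda> \<Longrightarrow> src \<Lambda> \<kappa> = rng \<Lambda> \<mu> \<Longrightarrow> c (pcomp \<Lambda> \<kappa> \<mu>) = c \<kappa> * c \<mu>"
    and c_src: "\<kappa> \<in> paths \<Lambda> \<Longrightarrow> c (src \<Lambda> \<kappa>) = c \<kappa> * cnj (c \<kappa>)"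
    and min_exts_finite: "\<mu> \<in> paths \<Lambda> \<Longrightarrow> \<nu> \<in> paths \<Lambda> \<Longrightarrow> finite (min_ext \<Lambda> \<mu> \<nu>)"
begin

text \<open>The graph over which the twisted generators live: all of \<Lambda> when c is unimodular,
  and the graph without the vertex when c is the indicator.\<close>

definition support :: "'p two_graph_data" where
  "support = \<Lambda>\<lparr>paths := {\<kappa> \<in> paths \<Lambda>. c \<kappa> \<noteq> 0}\<rparr>"

lemma support_simps [simp]:
  "paths support = {\<kappa> \<in> paths \<Lambda>. c \<kappa> \<noteq> 0}" "rng support = rng \<Lambda>" "src support = src \<Lambda>"
  "pcomp support = pcomp \<Lambda>" "deg support = deg \<Lambda>"
  by (simp_all add: support_def)

lemma c_rng: "\<kappa> \<in> paths \<Lambda> \<Longrightarrow> c (rng \<Lambda> \<kappa>) * c \<kappa> = c \<kappa>"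
  using c_comp[of "rng \<Lambda> \<kappa>" \<kappa>] by (simp add: rng_closed src_rng comp_rng)

lemma c_rng_nonzero: "\<kappa> \<in> paths \<Lambda> \<Longrightarrow> c \<kappa> \<noteq> 0 \<Longrightarrow> c (rng \<Lambda> \<kappa>) \<noteq> 0"
  using c_rng[of \<kappa>] by auto

text \<open>Composition with the source gives c(\<kappa>) = c(\<kappa>) c(s), where s is the source
  of \<kappa> and c(s) = |c(\<kappa>)|^2; cancel c(\<kappa>). So all values of a cocycle have
  modulus 0 or 1.\<close>

lemma c_unimodular: "\<kappa> \<in> paths \<Lambda> \<Longrightarrow> c \<kappa> \<noteq> 0 \<Longrightarrow> c \<kappa> * cnj (c \<kappa>) = 1"
  using c_comp[of \<kappa> "src \<Lambda> \<kappa>"] c_src[of \<kappa>] by (simp add: src_closed rng_src comp_src)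

lemma c_vertex: "z \<in> paths_deg \<Lambda> 0 \<Longrightarrow> c z = 0 \<or> c z = 1"
  using c_rng[of z] vertex_rng_src[of z] by (auto simp: paths_deg_def)

lemma two_graph_support: "two_graph support"
proof
  show "countable (paths support)"
    by (rule countable_subset[OF _ countable_paths]) auto
next
  fix \<kappa> m n assume \<kappa>: "\<kappa> \<in> paths support" "deg support \<kappa> = m + n"
  then have "\<exists>!(\<mu>, \<nu>). \<mu> \<in> paths \<Lambda> \<and> \<nu> \<in> paths \<Lambda> \<and> src \<Lambda> \<mu> = rng \<Lambda> \<nu> \<and>
      \<kappa> = pcomp \<Lambda> \<mu> \<nu> \<and> deg \<Lambda> \<mu> = m \<and> deg \<Lambda> \<nu> = n"
    using factorisation[of \<kappa> m n] by simp
  \<comment> \<open>Multiplicativity of c forces both factors of a path in the support to have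
    nonzero values, so its factorisations stay in the support.\<close>
  moreover have "(\<mu> \<in> paths support \<and> \<nu> \<in> paths support \<and> src support \<mu> = rng support \<nu> \<and>
        \<kappa> = pcomp support \<mu> \<nu> \<and> deg support \<mu> = m \<and> deg support \<nu> = n) \<longleftrightarrow>
      (\<mu> \<in> paths \<Lambda> \<and> \<nu> \<in> paths \<Lambda> \<and> src \<Lambda> \<mu> = rng \<Lambda> \<nu> \<and>
      \<kappa> = pcomp \<Lambda> \<mu> \<nu> \<and> deg \<Lambda> \<mu> = m \<and> deg \<Lambda> \<nu> = n)" for \<mu> \<nu>
    using \<kappa>(1) c_comp[of \<mu> \<nu>] by auto
  ultimately show "\<exists>!(\<mu>, \<nu>). \<mu> \<in> paths support \<and> \<nu> \<in> paths support \<and> src support \<mu> = rng support \<nu> \<and>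
        \<kappa> = pcomp support \<mu> \<nu> \<and> deg support \<mu> = m \<and> deg support \<nu> = n"
    by presburger
qed (auto simp: c_rng_nonzero c_src c_comp rng_closed src_closed rng_rng src_rng rng_src src_src comp_closed
      rng_comp src_comp comp_rng comp_src comp_assoc deg_rng deg_comp)

lemma twist_closed: "x \<in> polys (paths \<Lambda>) \<Longrightarrow> twist c x \<in> polys (paths support)"
  by (rule twist_polys) auto

text \<open>From \<mu>\<alpha> = \<nu>\<beta> one has c(\<mu>) c(\<alpha>) = c(\<nu>) c(\<beta>).
  Multiplying by the conjugates of c(\<mu>) and c(\<beta>), both of modulus 1 when all values are
  nonzero, isolates a scalar that depends on \<mu> and \<nu> alone. A term leaving the support has
  coefficient 0.\<close>

lemma min_ext_term:
  assumes i: "(\<alpha>, \<beta>) \<in> min_ext \<Lambda> \<mu> \<nu>" and "\<mu> \<in> paths \<Lambda>" "\<nu> \<in> paths \<Lambda>"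
  shows "c \<alpha> * cnj (c \<beta>) = (if c \<mu> \<noteq> 0 \<and> c \<nu> \<noteq> 0 \<and> (\<alpha>, \<beta>) \<in> min_ext support \<mu> \<nu> then cnj (c \<mu>) * c \<nu> else 0)"
proof -
  note d = min_extD[OF i]
  have mn: "c \<mu> * c \<alpha> = c \<nu> * c \<beta>"
    using c_comp[of \<mu> \<alpha>] c_comp[of \<nu> \<beta>] d assms by simp
  have z: "c \<mu> = 0 \<Longrightarrow> c \<alpha> = 0" "c \<nu> = 0 \<Longrightarrow> c \<beta> = 0"
    using c_src[of \<mu>] c_src[of \<nu>] c_rng[of \<alpha>] c_rng[of \<beta>] d assms by auto
  show ?thesis
  proof (cases "c \<alpha> = 0 \<or> c \<beta> = 0")
    case True
    then have "(\<alpha>, \<beta>) \<notin> min_ext support \<mu> \<nu>" by (auto simp: min_ext_def)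
    then show ?thesis using True by auto
  next
    case False
    then have nz: "c \<mu> \<noteq> 0" "c \<nu> \<noteq> 0" using z by auto
    have "(\<alpha>, \<beta>) \<in> min_ext support \<mu> \<nu>" using i False by (auto simp: min_ext_def)
    moreover have "c \<alpha> * cnj (c \<beta>) = cnj (c \<mu>) * c \<nu>"
    proof -
      have "c \<alpha> * cnj (c \<beta>) = (c \<mu> * cnj (c \<mu>)) * c \<alpha> * cnj (c \<beta>)"
        using c_unimodular[of \<mu>] nz assms by simp
      also have "\<dots> = cnj (c \<mu>) * (c \<mu> * c \<alpha>) * cnj (c \<beta>)" by (simp only: mult.commute mult.left_commute)
      also have "\<dots> = cnj (c \<mu>) * c \<nu> * (c \<beta> * cnj (c \<beta>))" by (simp add: mn mult.assoc)
      finally show ?thesis using c_unimodular[of \<beta>] False d by simp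
    qed
    ultimately show ?thesis using nz by simp
  qed
qed

text \<open>\<open>twist c\<close> turns every Toeplitz relation of \<Lambda> into a scalar multiple
  of the same relation over the support, or into a trivial one. Hence Toeplitz seminorms pull back
  to Toeplitz seminorms, the source of all contractivity of maps.\<close>

lemma twist_toeplitz_seminorm:
  assumes "toeplitz_seminormed support q"
  shows "toeplitz_seminormed \<Lambda> (\<lambda>x. q (twist c x))"
proof -
  interpret S: toeplitz_seminormed support q by fact
  have cs: "cstar_seminorm (free_star_algebra (paths \<Lambda>) (\<lambda>x. q (twist c x)))"
    using twist_closed unfolding cstar_seminorm_def
    by (simp add: twist_add twist_smul twist_mult twist_padj S.nonneg S.triangle S.smul S.submult S.cstar_identity
        del: support_simps)
  have vertex: "z \<in> paths_deg support 0" if "z \<in> paths_deg \<Lambda> 0" "c z \<noteq> 0" for z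
    using that by (simp add: paths_deg_def)
  have "toeplitz_relations \<Lambda> (\<lambda>x. q (twist c x))"
    unfolding toeplitz_relations_def
  proof (intro conjI ballI impI)
    fix z assume z: "z \<in> paths_deg \<Lambda> 0"
    show "q (twist c (padj (gen z) - gen z)) = 0" "q (twist c (gen z * gen z - gen z)) = 0"
      using c_vertex[OF z] S.eqvD[OF S.vertex_adj[OF vertex[OF z]]] S.eqvD[OF S.vertex_idem[OF vertex[OF z]]]
      by (auto simp: twist_diff twist_mult twist_padj twist_gen)
  next
    fix z x assume z: "z \<in> paths_deg \<Lambda> 0" "x \<in> paths_deg \<Lambda> 0" "z \<noteq> x"
    show "q (twist c (gen z * gen x)) = 0"
      using c_vertex[OF z(1)] c_vertex[OF z(2)] S.eqvD[OF S.vertex_orth[OF vertex[OF z(1)] vertex[OF z(2)] z(3)]]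
      by (auto simp: twist_mult twist_gen)
  next
    fix \<kappa> \<mu> assume *: "\<kappa> \<in> paths \<Lambda>" "\<mu> \<in> paths \<Lambda>" "src \<Lambda> \<kappa> = rng \<Lambda> \<mu>"
    have "twist c (gen \<kappa> * gen \<mu> - gen (pcomp \<Lambda> \<kappa> \<mu>)) =
        (c \<kappa> * c \<mu>) \<cdot> (gen \<kappa> * gen \<mu> - gen (pcomp \<Lambda> \<kappa> \<mu>))"
      using c_comp[OF *]
      by (simp add: twist_diff twist_mult twist_gen right_diff_distrib mult_smul[of "gen \<kappa>"] smul_smul mult.assoc)
    moreover have "q ((c \<kappa> * c \<mu>) \<cdot> (gen \<kappa> * gen \<mu> - gen (pcomp \<Lambda> \<kappa> \<mu>))) = 0"
    proof (cases "c \<kappa> = 0 \<or> c \<mu> = 0")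
      case False
      then have "S.eqv (gen \<kappa> * gen \<mu>) (gen (pcomp \<Lambda> \<kappa> \<mu>))"
        using S.gen_comp[of \<kappa> \<mu>] * by (simp del: S.eqv_refl)
      from S.eqvD[OF S.eqv_smul[OF this]] show ?thesis by (simp add: right_diff_distrib)
    qed auto
    ultimately show "q (twist c (gen \<kappa> * gen \<mu> - gen (pcomp \<Lambda> \<kappa> \<mu>))) = 0" by simp
  next
    fix \<kappa> assume *: "\<kappa> \<in> paths \<Lambda>"
    have "twist c (padj (gen \<kappa>) * gen \<kappa> - gen (src \<Lambda> \<kappa>)) =
        (c \<kappa> * cnj (c \<kappa>)) \<cdot> (padj (gen \<kappa>) * gen \<kappa> - gen (src \<Lambda> \<kappa>))"
      using c_src[OF *]
      by (simp add: twist_diff twist_mult twist_gen twist_padj padj_smul right_diff_distrib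
          mult_smul[of "padj (gen \<kappa>)"] smul_smul mult.assoc mult.commute[of "c \<kappa>"])
    moreover have "q ((c \<kappa> * cnj (c \<kappa>)) \<cdot> (padj (gen \<kappa>) * gen \<kappa> - gen (src \<Lambda> \<kappa>))) = 0"
    proof (cases "c \<kappa> = 0")
      case False
      then have "S.eqv (padj (gen \<kappa>) * gen \<kappa>) (gen (src \<Lambda> \<kappa>))"
        using S.gen_adj_gen[of \<kappa>] * by simp
      from S.eqvD[OF S.eqv_smul[OF this]] show ?thesis by (simp add: right_diff_distrib)
    qed auto
    ultimately show "q (twist c (padj (gen \<kappa>) * gen \<kappa> - gen (src \<Lambda> \<kappa>))) = 0" by simp
  next
    fix \<mu> \<nu> assume *: "\<mu> \<in> paths \<Lambda>" "\<nu> \<in> paths \<Lambda>"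
    define k where "k = cnj (c \<mu>) * c \<nu>"
    let ?t = "\<lambda>i. case i of (\<alpha>, \<beta>) \<Rightarrow> (gen \<alpha> * padj (gen \<beta>) :: 'p star_poly)"
    have lhs: "twist c (padj (gen \<mu>) * gen \<nu>) = k \<cdot> (padj (gen \<mu>) * gen \<nu>)"
      by (simp add: k_def twist_mult twist_gen twist_padj padj_smul mult_smul[of "padj (gen \<mu>)"] smul_smul mult.assoc)
    have "twist c (\<Sum>i\<in>min_ext \<Lambda> \<mu> \<nu>. ?t i) =
        (\<Sum>i\<in>min_ext \<Lambda> \<mu> \<nu>. if c \<mu> \<noteq> 0 \<and> c \<nu> \<noteq> 0 \<and> i \<in> min_ext support \<mu> \<nu> then k \<cdot> ?t i else 0)"
      unfolding twist_sum
    proof (intro sum.cong refl)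
      fix i assume i: "i \<in> min_ext \<Lambda> \<mu> \<nu>"
      obtain \<alpha> \<beta> where [simp]: "i = (\<alpha>, \<beta>)" by (cases i)
      show "twist c (?t i) =
          (if c \<mu> \<noteq> 0 \<and> c \<nu> \<noteq> 0 \<and> i \<in> min_ext support \<mu> \<nu> then k \<cdot> ?t i else 0)"
        using min_ext_term[OF _ *, of \<alpha> \<beta>] i by (simp only: twist_gen_adj k_def prod.case if_distrib \<open>i = _\<close>) auto
    qed
    also have "\<dots> = (if c \<mu> \<noteq> 0 \<and> c \<nu> \<noteq> 0 then \<Sum>i\<in>min_ext support \<mu> \<nu>. k \<cdot> ?t i else 0)"
    proof -
      \<comment> \<open>Terms outside \<open>min_ext support\<close> are 0. Finiteness of the larger
        index set matters: a sum over an infinite set is 0 by convention and could not be restricted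
        to a subset.\<close>
      have "min_ext support \<mu> \<nu> \<subseteq> min_ext \<Lambda> \<mu> \<nu>" by (auto simp: min_ext_def)
      then show ?thesis using min_exts_finite[OF *]
        by (auto simp: sum.inter_restrict[symmetric] Int_absorb1 Int_absorb2)
    qed
    finally have rhs: "twist c (\<Sum>i\<in>min_ext \<Lambda> \<mu> \<nu>. ?t i) =
        (if c \<mu> \<noteq> 0 \<and> c \<nu> \<noteq> 0 then k \<cdot> (\<Sum>i\<in>min_ext support \<mu> \<nu>. ?t i) else 0)"
      by (simp add: sum_distrib_left)
    show "q (twist c (padj (gen \<mu>) * gen \<nu> - (\<Sum>i\<in>min_ext \<Lambda> \<mu> \<nu>. ?t i))) = 0"
    proof (cases "c \<mu> \<noteq> 0 \<and> c \<nu> \<noteq> 0")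
      case True
      then have "S.eqv (k \<cdot> (padj (gen \<mu>) * gen \<nu>)) (k \<cdot> (\<Sum>i\<in>min_ext support \<mu> \<nu>. ?t i))"
        using * by (intro S.eqv_smul S.gen_adj_gen_min_ext) auto
      from S.eqvD[OF this] show ?thesis using True by (simp add: twist_diff lhs rhs)
    next
      case False
      then have "k = 0" by (auto simp: k_def)
      then show ?thesis using False by (auto simp: twist_diff lhs rhs)
    qed
  qed
  with cs show ?thesis by unfold_locales
qed

text \<open>For each Toeplitz seminorm q of the support, q composed with the twist is one of the
  seminorms whose supremum is the universal norm of \<Lambda>.\<close>

lemma contractive_hom_twist:
  "contractive_hom (paths \<Lambda>) (toeplitz_norm \<Lambda>) (paths support) (toeplitz_norm support) (twist c)"
proof -
  interpret D: toeplitz_seminormed \<Lambda> "toeplitz_norm \<Lambda>" by (rule toeplitz_norm_seminormed)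
  interpret S: toeplitz_seminormed support "toeplitz_norm support"
    by (rule two_graph.toeplitz_norm_seminormed[OF two_graph_support])
  show "contractive_hom (paths \<Lambda>) (toeplitz_norm \<Lambda>) (paths support) (toeplitz_norm support) (twist c)"
  proof
    fix x assume x: "x \<in> polys (paths \<Lambda>)"
    show "toeplitz_norm support (twist c x) \<le> toeplitz_norm \<Lambda> x"
    proof (rule two_graph.toeplitz_norm_least[OF two_graph_support])
      fix q assume "q \<in> toeplitz_seminorms support"
      then have "toeplitz_seminormed \<Lambda> (\<lambda>x. q (twist c x))"
        by (intro twist_toeplitz_seminorm) (simp add: two_graph.toeplitz_seminorms_iff[OF two_graph_support])
      then show "q (twist c x) \<le> toeplitz_norm \<Lambda> x"
        using toeplitz_norm_upper[of "\<lambda>x. q (twist c x)" x] x by (simp add: toeplitz_seminorms_iff)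
    qed
  qed (use twist_closed in \<open>auto simp: twist_add twist_mult twist_smul twist_padj\<close>)
qed

end

section \<open>Finitely supported functions\<close>

definition finsupp :: "('a \<Rightarrow> complex) \<Rightarrow> bool" where
  "finsupp \<xi> \<longleftrightarrow> finite {x. \<xi> x \<noteq> 0}"

text \<open>Linear in the first variable and conjugate linear in the second. Summing over the
  support of \<xi> keeps the sum finite for finitely supported \<xi>, whatever \<eta> is.\<close>

definition ip :: "('a \<Rightarrow> complex) \<Rightarrow> ('a \<Rightarrow> complex) \<Rightarrow> complex" where
  "ip \<xi> \<eta> = (\<Sum>x | \<xi> x \<noteq> 0. \<xi> x * cnj (\<eta> x))"

definition vnorm :: "('a \<Rightarrow> complex) \<Rightarrow> real" where
  "vnorm \<xi> = L2_set (\<lambda>x. cmod (\<xi> x)) {x. \<xi> x \<noteq> 0}"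

text \<open>
  On functions of paths, \<open>t\<^sub>\<kappa>\<close> and \<open>t\<^sub>\<kappa>\<^sup>*\<close> both act by pulling back along a partial injection \<open>j\<close> with
  domain \<open>S\<close>, so one computation yields contractivity and the adjoint for either of them.
\<close>

definition pull :: "'a set \<Rightarrow> ('a \<Rightarrow> 'a) \<Rightarrow> ('a \<Rightarrow> complex) \<Rightarrow> 'a \<Rightarrow> complex" where
  "pull S j \<xi> = (\<lambda>x. if x \<in> S then \<xi> (j x) else 0)"

definition delta :: "'a \<Rightarrow> 'a \<Rightarrow> complex" where
  "delta a = (\<lambda>x. if x = a then 1 else 0)"

lemma finsupp_add: "finsupp \<xi> \<Longrightarrow> finsupp \<eta> \<Longrightarrow> finsupp (\<lambda>x. \<xi> x + \<eta> x)"
  unfolding finsupp_def by (rule finite_subset[of _ "{x. \<xi> x \<noteq> 0} \<union> {x. \<eta> x \<noteq> 0}"]) auto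

lemma finsupp_scale: "finsupp \<xi> \<Longrightarrow> finsupp (\<lambda>x. c * \<xi> x)"
  unfolding finsupp_def by (rule finite_subset[of _ "{x. \<xi> x \<noteq> 0}"]) auto

lemma finsupp_0 [simp]: "finsupp (\<lambda>x. 0)"
  by (simp add: finsupp_def)

lemma finsupp_delta [simp]: "finsupp (delta a)"
  by (simp add: finsupp_def delta_def)

lemma ip_eq: "finite S \<Longrightarrow> (\<And>x. \<xi> x \<noteq> 0 \<Longrightarrow> \<eta> x \<noteq> 0 \<Longrightarrow> x \<in> S) \<Longrightarrow> finsupp \<xi> \<Longrightarrow>
    ip \<xi> \<eta> = (\<Sum>x\<in>S. \<xi> x * cnj (\<eta> x))"
  unfolding ip_def finsupp_def by (rule sum.mono_neutral_cong) auto

lemma vnorm_eq: "finite S \<Longrightarrow> {x. \<xi> x \<noteq> 0} \<subseteq> S \<Longrightarrow> vnorm \<xi> = L2_set (\<lambda>x. cmod (\<xi> x)) S"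
  unfolding vnorm_def L2_set_def by (intro arg_cong[of _ _ sqrt] sum.mono_neutral_left) auto

lemma vnorm_nonneg [simp]: "0 \<le> vnorm \<xi>"
  by (simp add: vnorm_def)

lemma vnorm_0 [simp]: "vnorm (\<lambda>x. 0) = 0"
  by (simp add: vnorm_def)

lemma vnorm_triangle:
  assumes "finsupp \<xi>" "finsupp \<eta>"
  shows "vnorm (\<lambda>x. \<xi> x + \<eta> x) \<le> vnorm \<xi> + vnorm \<eta>"
proof -
  let ?S = "{x. \<xi> x \<noteq> 0} \<union> {x. \<eta> x \<noteq> 0}"
  have S: "finite ?S" using assms by (simp add: finsupp_def)
  have "vnorm (\<lambda>x. \<xi> x + \<eta> x) = L2_set (\<lambda>x. cmod (\<xi> x + \<eta> x)) ?S" by (rule vnorm_eq[OF S]) auto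
  also have "\<dots> \<le> L2_set (\<lambda>x. cmod (\<xi> x) + cmod (\<eta> x)) ?S"
    by (rule L2_set_mono) (auto intro: norm_triangle_ineq)
  also have "\<dots> \<le> L2_set (\<lambda>x. cmod (\<xi> x)) ?S + L2_set (\<lambda>x. cmod (\<eta> x)) ?S"
    by (rule L2_set_triangle_ineq)
  also have "\<dots> = vnorm \<xi> + vnorm \<eta>"
    using vnorm_eq[OF S, of \<xi>] vnorm_eq[OF S, of \<eta>] by auto
  finally show ?thesis .
qed

lemma vnorm_scale: "vnorm (\<lambda>x. c * \<xi> x) = cmod c * vnorm \<xi>"
  by (cases "c = 0") (simp_all add: vnorm_def norm_mult L2_set_right_distrib[symmetric])

lemma ip_self: "ip \<xi> \<xi> = complex_of_real ((vnorm \<xi>)\<^sup>2)"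
proof -
  have "(vnorm \<xi>)\<^sup>2 = (\<Sum>x | \<xi> x \<noteq> 0. (cmod (\<xi> x))\<^sup>2)"
    unfolding vnorm_def L2_set_def by (rule real_sqrt_pow2) (simp add: sum_nonneg)
  then show ?thesis by (simp add: ip_def flip: complex_norm_square)
qed

lemma norm_ip_le:
  assumes "finsupp \<xi>" "finsupp \<eta>"
  shows "cmod (ip \<xi> \<eta>) \<le> vnorm \<xi> * vnorm \<eta>"
proof -
  let ?S = "{x. \<xi> x \<noteq> 0} \<union> {x. \<eta> x \<noteq> 0}"
  have S: "finite ?S" using assms by (simp add: finsupp_def)
  have "cmod (ip \<xi> \<eta>) = cmod (\<Sum>x\<in>?S. \<xi> x * cnj (\<eta> x))"
    using ip_eq[OF S, of \<xi> \<eta>] assms by auto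
  also have "\<dots> \<le> (\<Sum>x\<in>?S. \<bar>cmod (\<xi> x)\<bar> * \<bar>cmod (\<eta> x)\<bar>)"
    by (rule order.trans[OF norm_sum]) (simp add: norm_mult)
  also have "\<dots> \<le> L2_set (\<lambda>x. cmod (\<xi> x)) ?S * L2_set (\<lambda>x. cmod (\<eta> x)) ?S"
    by (rule L2_set_mult_ineq)
  also have "\<dots> = vnorm \<xi> * vnorm \<eta>"
    using vnorm_eq[OF S, of \<xi>] vnorm_eq[OF S, of \<eta>] by auto
  finally show ?thesis .
qed

lemma ip_commute: "finsupp \<xi> \<Longrightarrow> finsupp \<eta> \<Longrightarrow> ip \<eta> \<xi> = cnj (ip \<xi> \<eta>)"
proof -
  assume *: "finsupp \<xi>" "finsupp \<eta>"
  have S: "finite ({x. \<xi> x \<noteq> 0} \<union> {x. \<eta> x \<noteq> 0})" using * by (simp add: finsupp_def)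
  show ?thesis
    using ip_eq[OF S, of \<xi> \<eta>] ip_eq[OF S, of \<eta> \<xi>] * by (simp add: mult.commute)
qed

lemma ip_add_left:
  assumes "finsupp \<xi>" "finsupp \<eta>"
  shows "ip (\<lambda>x. \<xi> x + \<eta> x) \<zeta> = ip \<xi> \<zeta> + ip \<eta> \<zeta>"
proof -
  have S: "finite ({x. \<xi> x \<noteq> 0} \<union> {x. \<eta> x \<noteq> 0})" using assms by (simp add: finsupp_def)
  have "ip (\<lambda>x. \<xi> x + \<eta> x) \<zeta> = (\<Sum>x\<in>{x. \<xi> x \<noteq> 0} \<union> {x. \<eta> x \<noteq> 0}. (\<xi> x + \<eta> x) * cnj (\<zeta> x))"
    using finsupp_add[OF assms] by (intro ip_eq[OF S]) auto
  then show ?thesis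
    using ip_eq[OF S, of \<xi> \<zeta>] ip_eq[OF S, of \<eta> \<zeta>] assms by (simp add: sum.distrib distrib_right)
qed

lemma ip_add_right: "ip \<xi> (\<lambda>x. \<eta> x + \<zeta> x) = ip \<xi> \<eta> + ip \<xi> \<zeta>"
  by (simp add: ip_def sum.distrib distrib_left)

lemma ip_scale_left: "ip (\<lambda>x. c * \<xi> x) \<eta> = c * ip \<xi> \<eta>"
  by (cases "c = 0") (simp_all add: ip_def sum_distrib_left mult.assoc)

lemma ip_scale_right: "ip \<xi> (\<lambda>x. c * \<eta> x) = cnj c * ip \<xi> \<eta>"
  by (simp add: ip_def sum_distrib_left mult.left_commute)

lemma ip_delta: "finsupp \<xi> \<Longrightarrow> ip \<xi> (delta a) = \<xi> a"
  using ip_eq[of "{a}" \<xi> "delta a"] by (auto simp: delta_def split: if_splits)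

lemma vnorm_delta [simp]: "vnorm (delta a) = 1"
  by (simp add: vnorm_def delta_def)

lemma norm_apply_le_vnorm: "finsupp \<xi> \<Longrightarrow> cmod (\<xi> a) \<le> vnorm \<xi>"
  using norm_ip_le[of \<xi> "delta a"] by (simp add: ip_delta)

lemma finsupp_pull:
  assumes "inj_on j S" "finsupp \<xi>"
  shows "finsupp (pull S j \<xi>)"
proof -
  have "{x. pull S j \<xi> x \<noteq> 0} = j -` {x. \<xi> x \<noteq> 0} \<inter> S" by (auto simp: pull_def)
  moreover have "finite (j -` {x. \<xi> x \<noteq> 0} \<inter> S)"
    using assms by (intro finite_vimage_IntI) (simp_all add: finsupp_def)
  ultimately show ?thesis by (simp add: finsupp_def)
qed

text \<open>By injectivity of j every value of \<xi> is used at most once.\<close>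

lemma vnorm_pull_le:
  assumes j: "inj_on j S" and \<xi>: "finsupp \<xi>"
  shows "vnorm (pull S j \<xi>) \<le> vnorm \<xi>"
proof -
  let ?A = "{x. pull S j \<xi> x \<noteq> 0}"
  have A: "?A \<subseteq> S" "\<And>x. x \<in> ?A \<Longrightarrow> pull S j \<xi> x = \<xi> (j x)" by (auto simp: pull_def split: if_splits)
  have "(\<Sum>x\<in>?A. (cmod (pull S j \<xi> x))\<^sup>2) = (\<Sum>x\<in>?A. (cmod (\<xi> (j x)))\<^sup>2)"
    by (rule sum.cong[OF refl]) (simp only: A(2))
  also have "\<dots> = (\<Sum>y\<in>j ` ?A. (cmod (\<xi> y))\<^sup>2)"
    using inj_on_subset[OF j A(1)] by (simp only: sum.reindex o_def)
  also have "\<dots> \<le> (\<Sum>y | \<xi> y \<noteq> 0. (cmod (\<xi> y))\<^sup>2)"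
    using \<xi> by (intro sum_mono2) (auto simp: finsupp_def pull_def split: if_splits)
  finally show ?thesis unfolding vnorm_def L2_set_def by (rule real_sqrt_le_mono)
qed

text \<open>The substitution y = j x: the adjoint of pulling back along a partial injection is
  pulling back along its inverse.\<close>

lemma ip_pull:
  assumes j: "inj_on j S" and \<xi>: "finsupp \<xi>"
  shows "ip (pull S j \<xi>) \<eta> = ip \<xi> (pull (j ` S) (inv_into S j) \<eta>)"
proof -
  let ?A = "{x. pull S j \<xi> x \<noteq> 0}"
  have A: "?A \<subseteq> S" "\<And>x. x \<in> ?A \<Longrightarrow> pull S j \<xi> x = \<xi> (j x)" by (auto simp: pull_def split: if_splits)
  have A': "inv_into S j (j x) = x" if "x \<in> ?A" for x
    using inv_into_f_f[OF j] A(1) that by blast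
  have "ip (pull S j \<xi>) \<eta> = (\<Sum>x\<in>?A. \<xi> (j x) * cnj (\<eta> (inv_into S j (j x))))"
    unfolding ip_def by (rule sum.cong[OF refl]) (simp only: A(2) A')
  also have "\<dots> = (\<Sum>y\<in>j ` ?A. \<xi> y * cnj (\<eta> (inv_into S j y)))"
    using inj_on_subset[OF j A(1)] by (simp only: sum.reindex o_def)
  also have "\<dots> = (\<Sum>y | \<xi> y \<noteq> 0. \<xi> y * cnj (pull (j ` S) (inv_into S j) \<eta> y))"
    using \<xi> by (intro sum.mono_neutral_cong_left) (auto simp: finsupp_def pull_def split: if_splits)
  finally show ?thesis by (simp add: ip_def)
qed

lemma pull_add: "pull S j (\<lambda>x. \<xi> x + \<eta> x) = (\<lambda>x. pull S j \<xi> x + pull S j \<eta> x)"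
  by (auto simp: pull_def)

lemma pull_scale: "pull S j (\<lambda>x. c * \<xi> x) = (\<lambda>x. c * pull S j \<xi> x)"
  by (auto simp: pull_def)

section \<open>The path representation\<close>

context two_graph
begin

definition extensions :: "'p \<Rightarrow> 'p set" where
  "extensions g = {\<alpha> \<in> paths \<Lambda>. src \<Lambda> g = rng \<Lambda> \<alpha>}"

text \<open>The creation operator t_g sends the point mass at \<alpha> to the one at g\<alpha>. As
  an operator on functions it therefore pulls back along the inverse of \<alpha> \<mapsto>
  g\<alpha>, and its adjoint pulls back along that map itself.\<close>

fun letter_op :: "'p \<times> bool \<Rightarrow> ('p \<Rightarrow> complex) \<Rightarrow> 'p \<Rightarrow> complex" where
  "letter_op (g, True) = pull (extensions g) (pcomp \<Lambda> g)"
| "letter_op (g, False) = pull (pcomp \<Lambda> g ` extensions g) (inv_into (extensions g) (pcomp \<Lambda> g))"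

definition word_op :: "('p \<times> bool) list \<Rightarrow> ('p \<Rightarrow> complex) \<Rightarrow> 'p \<Rightarrow> complex" where
  "word_op ls = foldr letter_op ls"

definition rep :: "'p star_poly \<Rightarrow> ('p \<Rightarrow> complex) \<Rightarrow> 'p \<Rightarrow> complex" where
  "rep x \<xi> = (\<lambda>\<kappa>. \<Sum>w\<in>keys x. lookup x w * word_op (letters w) \<xi> \<kappa>)"

text \<open>The operator norm on l2 of the path space, with the supremum over finitely supported
  vectors, which are dense there; this way no Hilbert space has to be constructed.\<close>

definition rep_norm :: "'p star_poly \<Rightarrow> real" where
  "rep_norm x = (SUP \<xi>\<in>{\<xi>. finsupp \<xi> \<and> vnorm \<xi> \<le> 1}. vnorm (rep x \<xi>))"

lemma pcomp_inj: "g \<in> paths \<Lambda> \<Longrightarrow> inj_on (pcomp \<Lambda> g) (extensions g)"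
  by (rule inj_onI) (use factor_unique in \<open>force simp: extensions_def\<close>)

lemma letter_op_finsupp: "fst l \<in> paths \<Lambda> \<Longrightarrow> finsupp \<xi> \<Longrightarrow> finsupp (letter_op l \<xi>)"
  by (cases l, cases "snd l") (auto intro!: finsupp_pull pcomp_inj inj_on_inv_into)

lemma letter_op_le: "fst l \<in> paths \<Lambda> \<Longrightarrow> finsupp \<xi> \<Longrightarrow> vnorm (letter_op l \<xi>) \<le> vnorm \<xi>"
  by (cases l, cases "snd l") (auto intro!: vnorm_pull_le pcomp_inj inj_on_inv_into)

lemma letter_op_adj:
  assumes g: "g \<in> paths \<Lambda>" and "finsupp \<xi>" "finsupp \<eta>"
  shows "ip (letter_op (g, b) \<xi>) \<eta> = ip \<xi> (letter_op (g, \<not> b) \<eta>)"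
proof (cases b)
  case False
  have "ip (letter_op (g, False) \<xi>) \<eta> = cnj (ip \<eta> (letter_op (g, False) \<xi>))"
    using assms letter_op_finsupp[of "(g, False)" \<xi>] by (intro ip_commute) auto
  also have "\<dots> = cnj (ip (letter_op (g, True) \<eta>) \<xi>)"
    using ip_pull[OF pcomp_inj[OF g], of \<eta> \<xi>] assms by simp
  also have "\<dots> = ip \<xi> (letter_op (g, True) \<eta>)"
    using assms letter_op_finsupp[of "(g, True)" \<eta>] by (intro ip_commute[symmetric]) auto
  finally show ?thesis using False by simp
qed (use assms ip_pull[OF pcomp_inj[OF g]] in simp)

lemma letter_op_add: "letter_op l (\<lambda>x. \<xi> x + \<eta> x) = (\<lambda>x. letter_op l \<xi> x + letter_op l \<eta> x)"
  by (cases l, cases "snd l") (auto simp: pull_add)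

lemma letter_op_scale: "letter_op l (\<lambda>x. c * \<xi> x) = (\<lambda>x. c * letter_op l \<xi> x)"
  by (cases l, cases "snd l") (auto simp: pull_scale)

lemma word_op_Cons: "word_op (l # ls) \<xi> = letter_op l (word_op ls \<xi>)"
  by (simp add: word_op_def)

lemma word_op_Nil [simp]: "word_op [] \<xi> = \<xi>"
  by (simp add: word_op_def)

lemma word_op_append: "word_op (ls @ ms) \<xi> = word_op ls (word_op ms \<xi>)"
  by (simp add: word_op_def)

lemma word_op_add: "word_op ls (\<lambda>x. \<xi> x + \<eta> x) = (\<lambda>x. word_op ls \<xi> x + word_op ls \<eta> x)"
  by (induction ls) (auto simp: word_op_Cons letter_op_add)

lemma word_op_scale: "word_op ls (\<lambda>x. c * \<xi> x) = (\<lambda>x. c * word_op ls \<xi> x)"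
  by (induction ls) (auto simp: word_op_Cons letter_op_scale)

lemma word_op_finsupp: "fst ` set ls \<subseteq> paths \<Lambda> \<Longrightarrow> finsupp \<xi> \<Longrightarrow> finsupp (word_op ls \<xi>)"
  by (induction ls) (auto simp: word_op_Cons letter_op_finsupp)

lemma word_op_le: "fst ` set ls \<subseteq> paths \<Lambda> \<Longrightarrow> finsupp \<xi> \<Longrightarrow> vnorm (word_op ls \<xi>) \<le> vnorm \<xi>"
proof (induction ls)
  case (Cons l ls)
  then show ?case
    using letter_op_le[of l "word_op ls \<xi>"] word_op_finsupp[of ls \<xi>] by (simp add: word_op_Cons)
qed simp

lemma word_op_adj:
  "fst ` set ls \<subseteq> paths \<Lambda> \<Longrightarrow> finsupp \<xi> \<Longrightarrow> finsupp \<eta> \<Longrightarrow>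
     ip (word_op ls \<xi>) \<eta> = ip \<xi> (word_op (rev (map (\<lambda>(g, b). (g, \<not> b)) ls)) \<eta>)"
proof (induction ls arbitrary: \<eta>)
  case (Cons l ls)
  obtain g b where l: "l = (g, b)" by (cases l)
  have "ip (word_op (l # ls) \<xi>) \<eta> = ip (word_op ls \<xi>) (letter_op (g, \<not> b) \<eta>)"
    using Cons.prems word_op_finsupp[of ls \<xi>] by (simp add: word_op_Cons l letter_op_adj)
  also have "\<dots> = ip \<xi> (word_op (rev (map (\<lambda>(g, b). (g, \<not> b)) ls)) (letter_op (g, \<not> b) \<eta>))"
    using Cons.prems letter_op_finsupp[of "(g, \<not> b)" \<eta>] by (intro Cons.IH) (auto simp: l)
  finally show ?case by (simp add: l word_op_append word_op_Cons)
qed simp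

section \<open>The representation of polynomials and its operator norm\<close>

lemma rep_eq: "finite S \<Longrightarrow> keys x \<subseteq> S \<Longrightarrow> rep x \<xi> \<kappa> = (\<Sum>w\<in>S. lookup x w * word_op (letters w) \<xi> \<kappa>)"
  unfolding rep_def by (rule sum.mono_neutral_left) (auto simp: in_keys_iff)

lemma rep_add: "rep (x + y) \<xi> \<kappa> = rep x \<xi> \<kappa> + rep y \<xi> \<kappa>"
  using rep_eq[of "keys x \<union> keys y" x] rep_eq[of "keys x \<union> keys y" y] keys_add[of x y]
    rep_eq[of "keys x \<union> keys y" "x + y"]
  by (simp add: lookup_add sum.distrib distrib_right)

lemma rep_0 [simp]: "rep 0 \<xi> = (\<lambda>\<kappa>. 0)"
  by (simp add: rep_def)

lemma rep_smul: "rep (c \<cdot> x) \<xi> \<kappa> = c * rep x \<xi> \<kappa>"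
proof -
  have "keys (c \<cdot> x) \<subseteq> keys x" by (auto simp: in_keys_iff lookup_smul)
  then show ?thesis
    using rep_eq[of "keys x" "c \<cdot> x"] by (simp add: lookup_smul rep_def sum_distrib_left mult.assoc)
qed

lemma rep_diff: "rep (x - y) \<xi> \<kappa> = rep x \<xi> \<kappa> - rep y \<xi> \<kappa>"
  using rep_add[of x "(-1) \<cdot> y" \<xi> \<kappa>] rep_smul[of "-1" y \<xi> \<kappa>] by (simp add: smul_minus_one)

lemma rep_sum: "rep (sum f I) \<xi> \<kappa> = (\<Sum>i\<in>I. rep (f i) \<xi> \<kappa>)"
  by (induction I rule: infinite_finite_induct) (auto simp: rep_add)

lemma rep_single: "rep (single w a) \<xi> = (\<lambda>\<kappa>. a * word_op (letters w) \<xi> \<kappa>)"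
  by (auto simp: rep_def)

lemma rep_vec_add: "rep x (\<lambda>\<kappa>. \<xi> \<kappa> + \<eta> \<kappa>) \<kappa> = rep x \<xi> \<kappa> + rep x \<eta> \<kappa>"
  by (simp add: rep_def word_op_add distrib_left sum.distrib)

lemma rep_vec_scale: "rep x (\<lambda>\<kappa>. c * \<xi> \<kappa>) \<kappa> = c * rep x \<xi> \<kappa>"
  by (simp add: rep_def word_op_scale sum_distrib_left mult.left_commute)

lemma rep_mult: "rep (x * y) \<xi> \<kappa> = rep x (rep y \<xi>) \<kappa>"
proof (rule poly_mult_eqI)
  have *: "rep (y + z) \<xi> = (\<lambda>\<kappa>. rep y \<xi> \<kappa> + rep z \<xi> \<kappa>)" for y z by (simp add: rep_add fun_eq_iff)
  show "rep z (rep (x + y) \<xi>) \<kappa> = rep z (rep x \<xi>) \<kappa> + rep z (rep y \<xi>) \<kappa>" for x y z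
    unfolding * by (rule rep_vec_add)
qed (auto simp: rep_add mult_single rep_single word_op_scale plus_star_word_def word_op_append)

lemma rep_gen: "rep (gen g) \<xi> = letter_op (g, False) \<xi>"
  by (simp add: gen_def rep_single word_op_Cons)

lemma rep_padj_gen: "rep (padj (gen g)) \<xi> = letter_op (g, True) \<xi>"
  by (simp add: padj_gen rep_single word_op_Cons)

lemma rep_finsupp:
  assumes "x \<in> polys (paths \<Lambda>)" "finsupp \<xi>"
  shows "finsupp (rep x \<xi>)"
  using assms(1)
proof (induction rule: poly_induct)
  case (add x w a)
  have "rep (x + single w a) \<xi> = (\<lambda>\<kappa>. rep x \<xi> \<kappa> + a * word_op (letters w) \<xi> \<kappa>)"
    by (simp add: rep_add rep_single fun_eq_iff)
  moreover have "finsupp (word_op (letters w) \<xi>)"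
    using add.hyps assms(2) by (intro word_op_finsupp) (auto simp: words_def)
  ultimately show ?case using finsupp_add[OF add.IH finsupp_scale] by simp
qed simp

lemma rep_adj:
  assumes "x \<in> polys (paths \<Lambda>)" "finsupp \<xi>" "finsupp \<eta>"
  shows "ip (rep x \<xi>) \<eta> = ip \<xi> (rep (padj x) \<eta>)"
  using assms(1)
proof (induction rule: poly_induct)
  case (add x w a)
  have w: "fst ` set (letters w) \<subseteq> paths \<Lambda>" using add.hyps by (auto simp: words_def)
  have 1: "rep (x + single w a) \<xi> = (\<lambda>\<kappa>. rep x \<xi> \<kappa> + a * word_op (letters w) \<xi> \<kappa>)"
    by (simp add: rep_add rep_single fun_eq_iff)
  have 2: "rep (padj (x + single w a)) \<eta> =
      (\<lambda>\<kappa>. rep (padj x) \<eta> \<kappa> + cnj a * word_op (letters (word_adj w)) \<eta> \<kappa>)"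
    by (simp add: rep_add rep_single padj_add padj_single fun_eq_iff)
  have "ip (rep (x + single w a) \<xi>) \<eta> = ip (rep x \<xi>) \<eta> + a * ip (word_op (letters w) \<xi>) \<eta>"
    unfolding 1 using w assms rep_finsupp[OF add.hyps(1)]
    by (subst ip_add_left) (auto simp: ip_scale_left intro!: finsupp_scale word_op_finsupp)
  also have "\<dots> = ip \<xi> (rep (padj x) \<eta>) + a * ip \<xi> (word_op (letters (word_adj w)) \<eta>)"
    using w assms by (simp add: add.IH word_op_adj word_adj_def)
  also have "\<dots> = ip \<xi> (rep (padj (x + single w a)) \<eta>)"
    unfolding 2 by (simp add: ip_add_right ip_scale_right)
  finally show ?case .
qed (simp add: ip_def)

text \<open>Some bound must exist before the supremum \<open>rep_norm\<close> can be estimated from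
  below by its members; every word acts as a contraction, so the coefficients give one.\<close>

lemma rep_bounded:
  assumes "x \<in> polys (paths \<Lambda>)"
  shows "\<exists>K\<ge>0. \<forall>\<xi>. finsupp \<xi> \<longrightarrow> vnorm (rep x \<xi>) \<le> K * vnorm \<xi>"
  using assms
proof (induction rule: poly_induct)
  case (add x w a)
  then obtain K where K: "K \<ge> 0" "\<And>\<xi>. finsupp \<xi> \<Longrightarrow> vnorm (rep x \<xi>) \<le> K * vnorm \<xi>" by auto
  have w: "fst ` set (letters w) \<subseteq> paths \<Lambda>" using add.hyps by (auto simp: words_def)
  have "vnorm (rep (x + single w a) \<xi>) \<le> (K + cmod a) * vnorm \<xi>" if \<xi>: "finsupp \<xi>" for \<xi>
  proof -
    have 1: "rep (x + single w a) \<xi> = (\<lambda>\<kappa>. rep x \<xi> \<kappa> + a * word_op (letters w) \<xi> \<kappa>)"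
      by (simp add: rep_add rep_single fun_eq_iff)
    have "vnorm (rep (x + single w a) \<xi>) \<le> vnorm (rep x \<xi>) + vnorm (\<lambda>\<kappa>. a * word_op (letters w) \<xi> \<kappa>)"
      unfolding 1 using add.hyps w \<xi>
      by (intro vnorm_triangle rep_finsupp finsupp_scale word_op_finsupp)
    also have "\<dots> \<le> K * vnorm \<xi> + cmod a * vnorm \<xi>"
      using K(2)[OF \<xi>] w \<xi>
      by (intro add_mono) (auto simp: vnorm_scale word_op_finsupp intro!: mult_left_mono word_op_le)
    finally show ?thesis by (simp add: distrib_right)
  qed
  then show ?case using K by (intro exI[of _ "K + cmod a"]) auto
qed auto

lemma rep_norm_bdd:
  assumes "x \<in> polys (paths \<Lambda>)"
  shows "bdd_above ((\<lambda>\<xi>. vnorm (rep x \<xi>)) ` {\<xi>. finsupp \<xi> \<and> vnorm \<xi> \<le> 1})"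
proof -
  obtain K where K: "K \<ge> 0" "\<And>\<xi>. finsupp \<xi> \<Longrightarrow> vnorm (rep x \<xi>) \<le> K * vnorm \<xi>"
    using rep_bounded[OF assms] by auto
  have "vnorm (rep x \<xi>) \<le> K" if "finsupp \<xi>" "vnorm \<xi> \<le> 1" for \<xi>
    using K(2)[OF that(1)] mult_left_mono[OF that(2) K(1)] by simp
  then show ?thesis by (intro bdd_aboveI) auto
qed

lemma rep_norm_nonneg: "x \<in> polys (paths \<Lambda>) \<Longrightarrow> 0 \<le> rep_norm x"
  unfolding rep_norm_def
  by (rule cSUP_upper2[OF rep_norm_bdd, of _ "\<lambda>x. 0"]) auto

lemma rep_le:
  assumes "x \<in> polys (paths \<Lambda>)" "finsupp \<xi>"
  shows "vnorm (rep x \<xi>) \<le> rep_norm x * vnorm \<xi>"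
proof (cases "vnorm \<xi> = 0")
  case True
  \<comment> \<open>A vector of norm 0 cannot be normalised, but any bound already forces the norm
    of its image to be 0.\<close>
  then show ?thesis using rep_bounded[OF assms(1)] assms(2) by (metis mult_zero_right)
next
  case False
  then have pos: "vnorm \<xi> > 0" using vnorm_nonneg[of \<xi>] by linarith
  let ?\<eta> = "\<lambda>\<kappa>. complex_of_real (1 / vnorm \<xi>) * \<xi> \<kappa>"
  have "finsupp ?\<eta>" using assms(2) by (rule finsupp_scale)
  moreover have "vnorm ?\<eta> = 1"
    unfolding vnorm_scale using pos by (simp add: norm_divide)
  ultimately have \<eta>: "finsupp ?\<eta>" "vnorm ?\<eta> \<le> 1" by simp_all
  have "vnorm (rep x ?\<eta>) \<le> rep_norm x"
    using \<eta>
    unfolding rep_norm_def by (intro cSUP_upper rep_norm_bdd assms) simp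
  moreover have "rep x ?\<eta> = (\<lambda>\<kappa>. complex_of_real (1 / vnorm \<xi>) * rep x \<xi> \<kappa>)"
    by (rule ext) (rule rep_vec_scale)
  ultimately have "cmod (complex_of_real (1 / vnorm \<xi>)) * vnorm (rep x \<xi>) \<le> rep_norm x"
    by (simp only: vnorm_scale)
  then show ?thesis using pos by (simp add: norm_divide field_simps)
qed

lemma rep_norm_least:
  assumes "K \<ge> 0" "\<And>\<xi>. finsupp \<xi> \<Longrightarrow> vnorm (rep x \<xi>) \<le> K * vnorm \<xi>"
  shows "rep_norm x \<le> K"
  unfolding rep_norm_def
proof (rule cSUP_least)
  show "{\<xi> :: 'p \<Rightarrow> complex. finsupp \<xi> \<and> vnorm \<xi> \<le> 1} \<noteq> {}"
    using finsupp_0 vnorm_0 by (metis (mono_tags, lifting) empty_iff mem_Collect_eq zero_le_one)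
next
  fix \<xi> :: "'p \<Rightarrow> complex" assume "\<xi> \<in> {\<xi>. finsupp \<xi> \<and> vnorm \<xi> \<le> 1}"
  then have "vnorm (rep x \<xi>) \<le> K * vnorm \<xi>" "K * vnorm \<xi> \<le> K"
    using assms by (auto intro: mult_left_le)
  then show "vnorm (rep x \<xi>) \<le> K" by simp
qed

lemma rep_norm_triangle:
  assumes "x \<in> polys (paths \<Lambda>)" "y \<in> polys (paths \<Lambda>)"
  shows "rep_norm (x + y) \<le> rep_norm x + rep_norm y"
proof (rule rep_norm_least)
  fix \<xi> :: "'p \<Rightarrow> complex" assume \<xi>: "finsupp \<xi>"
  have "rep (x + y) \<xi> = (\<lambda>\<kappa>. rep x \<xi> \<kappa> + rep y \<xi> \<kappa>)" by (simp add: rep_add fun_eq_iff)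
  then have "vnorm (rep (x + y) \<xi>) \<le> vnorm (rep x \<xi>) + vnorm (rep y \<xi>)"
    using assms \<xi> by (simp add: vnorm_triangle rep_finsupp)
  also have "\<dots> \<le> rep_norm x * vnorm \<xi> + rep_norm y * vnorm \<xi>"
    using assms \<xi> by (intro add_mono rep_le)
  finally show "vnorm (rep (x + y) \<xi>) \<le> (rep_norm x + rep_norm y) * vnorm \<xi>"
    by (simp add: distrib_right)
qed (use assms rep_norm_nonneg in auto)

lemma rep_norm_submult:
  assumes "x \<in> polys (paths \<Lambda>)" "y \<in> polys (paths \<Lambda>)"
  shows "rep_norm (x * y) \<le> rep_norm x * rep_norm y"
proof (rule rep_norm_least)
  fix \<xi> :: "'p \<Rightarrow> complex" assume \<xi>: "finsupp \<xi>"
  have "rep (x * y) \<xi> = rep x (rep y \<xi>)" by (simp add: rep_mult fun_eq_iff)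
  then have "vnorm (rep (x * y) \<xi>) \<le> rep_norm x * vnorm (rep y \<xi>)"
    using rep_le[OF assms(1) rep_finsupp[OF assms(2) \<xi>]] by simp
  also have "\<dots> \<le> rep_norm x * (rep_norm y * vnorm \<xi>)"
    using assms \<xi> by (intro mult_left_mono rep_le rep_norm_nonneg)
  finally show "vnorm (rep (x * y) \<xi>) \<le> (rep_norm x * rep_norm y) * vnorm \<xi>"
    by (simp add: mult.assoc)
qed (use assms rep_norm_nonneg in auto)

lemma rep_norm_smul_le:
  assumes "x \<in> polys (paths \<Lambda>)"
  shows "rep_norm (c \<cdot> x) \<le> cmod c * rep_norm x"
proof (rule rep_norm_least)
  fix \<xi> :: "'p \<Rightarrow> complex" assume \<xi>: "finsupp \<xi>"
  have "rep (c \<cdot> x) \<xi> = (\<lambda>\<kappa>. c * rep x \<xi> \<kappa>)" by (simp add: rep_smul fun_eq_iff)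
  then show "vnorm (rep (c \<cdot> x) \<xi>) \<le> cmod c * rep_norm x * vnorm \<xi>"
    using rep_le[OF assms \<xi>] rep_finsupp[OF assms \<xi>]
    by (simp add: vnorm_scale mult.assoc mult_left_mono)
qed (use assms rep_norm_nonneg in auto)

text \<open>The squared norm of x\<xi> is the inner product of \<xi> with \<open>padj x * x\<close>
  applied to \<xi>; Cauchy-Schwarz bounds it by the operator norm of
  \<open>padj x * x\<close>.\<close>

lemma rep_norm_cstar_le:
  assumes "x \<in> polys (paths \<Lambda>)"
  shows "(rep_norm x)\<^sup>2 \<le> rep_norm (padj x * x)"
proof -
  have xx: "padj x * x \<in> polys (paths \<Lambda>)" using assms by auto
  have "rep_norm x \<le> sqrt (rep_norm (padj x * x))"
  proof (rule rep_norm_least)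
    fix \<xi> :: "'p \<Rightarrow> complex" assume \<xi>: "finsupp \<xi>"
    have "complex_of_real ((vnorm (rep x \<xi>))\<^sup>2) = ip (rep x \<xi>) (rep x \<xi>)"
      by (simp add: ip_self)
    also have "\<dots> = ip \<xi> (rep (padj x) (rep x \<xi>))"
      using assms \<xi> by (intro rep_adj rep_finsupp)
    also have "\<dots> = ip \<xi> (rep (padj x * x) \<xi>)" by (simp add: rep_mult[abs_def])
    finally have "(vnorm (rep x \<xi>))\<^sup>2 = cmod (ip \<xi> (rep (padj x * x) \<xi>))"
      by (metis norm_of_real abs_of_nonneg zero_le_power2)
    also have "\<dots> \<le> vnorm \<xi> * (rep_norm (padj x * x) * vnorm \<xi>)"
      using norm_ip_le[OF \<xi> rep_finsupp[OF xx \<xi>]] mult_left_mono[OF rep_le[OF xx \<xi>] vnorm_nonneg[of \<xi>]]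
      by (rule order.trans)
    also have "\<dots> = (sqrt (rep_norm (padj x * x)) * vnorm \<xi>)\<^sup>2"
      using rep_norm_nonneg[OF xx] by (simp add: power_mult_distrib power2_eq_square mult_ac)
    finally show "vnorm (rep x \<xi>) \<le> sqrt (rep_norm (padj x * x)) * vnorm \<xi>"
      by (rule power2_le_imp_le) (use rep_norm_nonneg[OF xx] in auto)
  qed (use rep_norm_nonneg[OF xx] in auto)
  then have "(rep_norm x)\<^sup>2 \<le> (sqrt (rep_norm (padj x * x)))\<^sup>2"
    using rep_norm_nonneg[OF assms] by (rule power_mono)
  then show ?thesis using rep_norm_nonneg[OF xx] by simp
qed

lemma rep_norm_padj_le: "x \<in> polys (paths \<Lambda>) \<Longrightarrow> rep_norm x \<le> rep_norm (padj x)"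
proof -
  assume x: "x \<in> polys (paths \<Lambda>)"
  have "rep_norm x * rep_norm x \<le> rep_norm (padj x) * rep_norm x"
    using rep_norm_cstar_le[OF x] rep_norm_submult[of "padj x" x] x by (simp add: power2_eq_square)
  then show ?thesis
    using rep_norm_nonneg[OF x] rep_norm_nonneg[OF padj_polys[OF x]] by (cases "rep_norm x = 0") auto
qed

lemma rep_seminormed: "cstar_seminormed (paths \<Lambda>) rep_norm"
proof
  show "cstar_seminorm (free_star_algebra (paths \<Lambda>) rep_norm)"
    unfolding cstar_seminorm_def free_star_algebra_simps
  proof (intro conjI ballI allI)
    fix c x assume x: "x \<in> polys (paths \<Lambda>)"
    show "rep_norm (c \<cdot> x) = cmod c * rep_norm x"
    proof (cases "c = 0")
      case True
      then show ?thesis using rep_norm_smul_le[OF x, of 0] rep_norm_nonneg[of 0] by simp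
    next
      case False
      have "rep_norm ((1 / c) \<cdot> c \<cdot> x) \<le> cmod (1 / c) * rep_norm (c \<cdot> x)"
        using x by (intro rep_norm_smul_le) auto
      then have "cmod c * rep_norm x \<le> rep_norm (c \<cdot> x)"
        using False by (simp add: smul_smul norm_divide field_simps)
      then show ?thesis using rep_norm_smul_le[OF x, of c] by simp
    qed
  next
    fix x assume x: "x \<in> polys (paths \<Lambda>)"
    have "rep_norm (padj x) = rep_norm x"
      using rep_norm_padj_le[OF x] rep_norm_padj_le[OF padj_polys[OF x]] by simp
    then show "rep_norm (padj x * x) = (rep_norm x)\<^sup>2"
      using rep_norm_cstar_le[OF x] rep_norm_submult[of "padj x" x] x by (simp add: power2_eq_square)
  qed (use rep_norm_nonneg rep_norm_triangle rep_norm_submult in auto)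
qed

lemma rep_norm_zeroI: "(\<And>\<xi> \<kappa>. finsupp \<xi> \<Longrightarrow> rep x \<xi> \<kappa> = rep y \<xi> \<kappa>) \<Longrightarrow> x \<in> polys (paths \<Lambda>) \<Longrightarrow>
    y \<in> polys (paths \<Lambda>) \<Longrightarrow> rep_norm (x - y) = 0"
proof -
  assume *: "\<And>\<xi> \<kappa>. finsupp \<xi> \<Longrightarrow> rep x \<xi> \<kappa> = rep y \<xi> \<kappa>" "x \<in> polys (paths \<Lambda>)" "y \<in> polys (paths \<Lambda>)"
  have "rep_norm (x - y) \<le> 0"
    using * by (intro rep_norm_least) (simp_all add: rep_diff[abs_def])
  then show ?thesis using rep_norm_nonneg[of "x - y"] * by simp
qed

section \<open>The Toeplitz relations in the path representation\<close>

lemma shift_apply: "g \<in> paths \<Lambda> \<Longrightarrow> \<alpha> \<in> extensions g \<Longrightarrow> letter_op (g, False) \<xi> (pcomp \<Lambda> g \<alpha>) = \<xi> \<alpha>"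
  using pcomp_inj[of g] by (simp add: pull_def inv_into_f_f)

lemma shift_zero: "\<kappa> \<notin> pcomp \<Lambda> g ` extensions g \<Longrightarrow> letter_op (g, False) \<xi> \<kappa> = 0"
  by (simp add: pull_def)

lemma shift_adj_apply: "letter_op (g, True) \<xi> \<alpha> = (if \<alpha> \<in> extensions g then \<xi> (pcomp \<Lambda> g \<alpha>) else 0)"
  by (simp add: pull_def)

lemma vertex_extensions: "z \<in> paths_deg \<Lambda> 0 \<Longrightarrow> \<alpha> \<in> extensions z \<longleftrightarrow> \<alpha> \<in> paths \<Lambda> \<and> rng \<Lambda> \<alpha> = z"
  using vertex_rng_src[of z] by (auto simp: extensions_def)

lemma shift_vertex:
  assumes z: "z \<in> paths_deg \<Lambda> 0"
  shows "letter_op (z, b) \<xi> \<kappa> = (if \<kappa> \<in> paths \<Lambda> \<and> rng \<Lambda> \<kappa> = z then \<xi> \<kappa> else 0)"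
proof -
  have zp: "z \<in> paths \<Lambda>" using z by (simp add: paths_deg_def)
  have id: "pcomp \<Lambda> z \<alpha> = \<alpha>" if "\<alpha> \<in> extensions z" for \<alpha>
    using that comp_rng[of \<alpha>] by (auto simp: vertex_extensions[OF z])
  have im: "pcomp \<Lambda> z ` extensions z = extensions z" using id by force
  show ?thesis
  proof (cases "\<kappa> \<in> extensions z")
    case True
    then have "letter_op (z, b) \<xi> \<kappa> = \<xi> \<kappa>"
      using shift_apply[OF zp True, of \<xi>] id[OF True] by (cases b) (auto simp: pull_def)
    then show ?thesis using True by (simp add: vertex_extensions[OF z])
  next
    case False
    then have "letter_op (z, b) \<xi> \<kappa> = 0"
      by (cases b) (auto simp: pull_def im)
    then show ?thesis using False by (auto simp: vertex_extensions[OF z])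
  qed
qed

lemma shift_comp:
  assumes *: "\<kappa> \<in> paths \<Lambda>" "\<mu> \<in> paths \<Lambda>" "src \<Lambda> \<kappa> = rng \<Lambda> \<mu>"
  shows "letter_op (\<kappa>, False) (letter_op (\<mu>, False) \<xi>) = letter_op (pcomp \<Lambda> \<kappa> \<mu>, False) \<xi>"
proof
  fix x
  have c: "pcomp \<Lambda> \<kappa> \<mu> \<in> paths \<Lambda>" using * by (rule comp_closed)
  have ext: "extensions (pcomp \<Lambda> \<kappa> \<mu>) = extensions \<mu>" using * by (simp add: extensions_def src_comp)
  have push: "pcomp \<Lambda> \<mu> \<gamma> \<in> extensions \<kappa> \<and> pcomp \<Lambda> \<kappa> (pcomp \<Lambda> \<mu> \<gamma>) = pcomp \<Lambda> (pcomp \<Lambda> \<kappa> \<mu>) \<gamma>"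
    if "\<gamma> \<in> extensions \<mu>" for \<gamma>
    using that * by (auto simp: extensions_def comp_closed rng_comp comp_assoc)
  show "letter_op (\<kappa>, False) (letter_op (\<mu>, False) \<xi>) x = letter_op (pcomp \<Lambda> \<kappa> \<mu>, False) \<xi> x"
  proof (cases "x \<in> pcomp \<Lambda> (pcomp \<Lambda> \<kappa> \<mu>) ` extensions \<mu>")
    case True
    then obtain \<gamma> where \<gamma>: "\<gamma> \<in> extensions \<mu>" "x = pcomp \<Lambda> \<kappa> (pcomp \<Lambda> \<mu> \<gamma>)"
      "x = pcomp \<Lambda> (pcomp \<Lambda> \<kappa> \<mu>) \<gamma>" using push by auto
    have "letter_op (\<kappa>, False) (letter_op (\<mu>, False) \<xi>) x = \<xi> \<gamma>"
      unfolding \<gamma>(2) using shift_apply[OF *(1), of "pcomp \<Lambda> \<mu> \<gamma>"] push[OF \<gamma>(1)]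
        shift_apply[OF *(2) \<gamma>(1), of \<xi>] by metis
    moreover have "letter_op (pcomp \<Lambda> \<kappa> \<mu>, False) \<xi> x = \<xi> \<gamma>"
      unfolding \<gamma>(3) using \<gamma>(1) c by (intro shift_apply) (simp_all add: ext)
    ultimately show ?thesis by simp
  next
    case False
    have "letter_op (\<kappa>, False) (letter_op (\<mu>, False) \<xi>) x = 0"
    proof (cases "x \<in> pcomp \<Lambda> \<kappa> ` extensions \<kappa>")
      case True
      then obtain \<beta> where \<beta>: "\<beta> \<in> extensions \<kappa>" "x = pcomp \<Lambda> \<kappa> \<beta>" by auto
      then have "\<beta> \<notin> pcomp \<Lambda> \<mu> ` extensions \<mu>" using False push by auto
      then show ?thesis unfolding \<beta>(2) shift_apply[OF *(1) \<beta>(1)] by (rule shift_zero)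
    qed (rule shift_zero)
    then show ?thesis using False by (simp only: shift_zero ext not_False_eq_True)
  qed
qed

lemma shift_adj_shift:
  assumes \<kappa>: "\<kappa> \<in> paths \<Lambda>"
  shows "letter_op (\<kappa>, True) (letter_op (\<kappa>, False) \<xi>) = letter_op (src \<Lambda> \<kappa>, False) \<xi>"
proof
  fix x
  show "letter_op (\<kappa>, True) (letter_op (\<kappa>, False) \<xi>) x = letter_op (src \<Lambda> \<kappa>, False) \<xi> x"
    unfolding shift_adj_apply shift_vertex[OF src_vertex[OF \<kappa>]]
    using shift_apply[OF \<kappa>, of x \<xi>] by (auto simp: extensions_def)
qed

text \<open>The common extension has degree above the join of the degrees of \<mu> and \<nu>.
  Cutting it at the join yields \<omega>, and unique factorisation makes \<mu> and \<nu> initial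
  segments of \<omega>, which gives the minimal pair; \<eta> is the common remainder.\<close>

lemma common_extension:
  assumes "\<mu> \<in> paths \<Lambda>" "\<nu> \<in> paths \<Lambda>" and x: "x \<in> extensions \<mu>" and y: "y \<in> extensions \<nu>"
    and eq: "pcomp \<Lambda> \<mu> x = pcomp \<Lambda> \<nu> y"
  obtains \<alpha> \<beta> \<eta> where "(\<alpha>, \<beta>) \<in> min_ext \<Lambda> \<mu> \<nu>" "\<eta> \<in> extensions \<alpha>" "\<eta> \<in> extensions \<beta>"
    "x = pcomp \<Lambda> \<alpha> \<eta>" "y = pcomp \<Lambda> \<beta> \<eta>"
proof -
  let ?s = "sup (deg \<Lambda> \<mu>) (deg \<Lambda> \<nu>)"
  have xy: "x \<in> paths \<Lambda>" "y \<in> paths \<Lambda>" "src \<Lambda> \<mu> = rng \<Lambda> x" "src \<Lambda> \<nu> = rng \<Lambda> y"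
    using x y by (auto simp: extensions_def)
  define \<rho> where "\<rho> = pcomp \<Lambda> \<mu> x"
  have \<rho>: "\<rho> \<in> paths \<Lambda>" "deg \<Lambda> \<rho> = deg \<Lambda> \<mu> + deg \<Lambda> x" "deg \<Lambda> \<rho> = deg \<Lambda> \<nu> + deg \<Lambda> y"
    using assms xy deg_comp[of \<mu> x] deg_comp[of \<nu> y] by (auto simp: \<rho>_def comp_closed)
  have "deg \<Lambda> \<rho> = ?s + (deg \<Lambda> \<rho> - ?s)"
    using \<rho>(2,3) by (cases "deg \<Lambda> \<mu>"; cases "deg \<Lambda> \<nu>"; cases "deg \<Lambda> x"; cases "deg \<Lambda> y") auto
  then obtain \<omega> \<eta> where \<omega>: "\<omega> \<in> paths \<Lambda>" "\<eta> \<in> paths \<Lambda>" "src \<Lambda> \<omega> = rng \<Lambda> \<eta>" "\<rho> = pcomp \<Lambda> \<omega> \<eta>"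
    "deg \<Lambda> \<omega> = ?s" by (rule factor_exists[OF \<rho>(1)])
  \<comment> \<open>An initial segment \<kappa> of \<rho> whose degree is below that of \<omega> is
    an initial segment of \<omega>: cut \<omega> at the degree of \<kappa> and compare the two
    factorisations of \<rho>.\<close>
  have prefix: "\<exists>\<alpha>\<in>paths \<Lambda>. src \<Lambda> \<kappa> = rng \<Lambda> \<alpha> \<and> \<omega> = pcomp \<Lambda> \<kappa> \<alpha> \<and> src \<Lambda> \<alpha> = rng \<Lambda> \<eta> \<and> z = pcomp \<Lambda> \<alpha> \<eta>"
    if \<kappa>: "\<kappa> \<in> paths \<Lambda>" "z \<in> paths \<Lambda>" "src \<Lambda> \<kappa> = rng \<Lambda> z" "\<rho> = pcomp \<Lambda> \<kappa> z" "deg \<Lambda> \<kappa> \<le> ?s" for \<kappa> z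
  proof -
    have "deg \<Lambda> \<omega> = deg \<Lambda> \<kappa> + (?s - deg \<Lambda> \<kappa>)"
      using \<kappa>(5) \<omega>(5) by (cases "deg \<Lambda> \<kappa>"; cases ?s) auto
    then obtain \<kappa>' \<alpha> where f: "\<kappa>' \<in> paths \<Lambda>" "\<alpha> \<in> paths \<Lambda>" "src \<Lambda> \<kappa>' = rng \<Lambda> \<alpha>"
      "\<omega> = pcomp \<Lambda> \<kappa>' \<alpha>" "deg \<Lambda> \<kappa>' = deg \<Lambda> \<kappa>" by (rule factor_exists[OF \<omega>(1)])
    have s: "src \<Lambda> \<alpha> = rng \<Lambda> \<eta>" using f \<omega> src_comp[of \<kappa>' \<alpha>] by simp
    have "pcomp \<Lambda> \<kappa>' (pcomp \<Lambda> \<alpha> \<eta>) = pcomp \<Lambda> \<kappa> z"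
      using comp_assoc[of \<kappa>' \<alpha> \<eta>] f \<omega> s \<kappa>(4) by simp
    then have "\<kappa>' = \<kappa> \<and> pcomp \<Lambda> \<alpha> \<eta> = z"
      using f s \<omega> \<kappa> by (intro factor_unique) (auto simp: comp_closed rng_comp)
    then show ?thesis using f s by auto
  qed
  obtain \<alpha> where \<alpha>: "\<alpha> \<in> paths \<Lambda>" "src \<Lambda> \<mu> = rng \<Lambda> \<alpha>" "\<omega> = pcomp \<Lambda> \<mu> \<alpha>" "src \<Lambda> \<alpha> = rng \<Lambda> \<eta>" "x = pcomp \<Lambda> \<alpha> \<eta>"
    using prefix[OF assms(1) xy(1) xy(3)] \<rho>_def by auto
  obtain \<beta> where \<beta>: "\<beta> \<in> paths \<Lambda>" "src \<Lambda> \<nu> = rng \<Lambda> \<beta>" "\<omega> = pcomp \<Lambda> \<nu> \<beta>" "src \<Lambda> \<beta> = rng \<Lambda> \<eta>" "y = pcomp \<Lambda> \<beta> \<eta>"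
    using prefix[OF assms(2) xy(2) xy(4)] \<rho>_def eq by auto
  have "rng \<Lambda> \<mu> = rng \<Lambda> \<nu>"
    using rng_comp[OF assms(1) \<alpha>(1,2)] rng_comp[OF assms(2) \<beta>(1,2)] \<alpha>(3) \<beta>(3) by simp
  then have "(\<alpha>, \<beta>) \<in> min_ext \<Lambda> \<mu> \<nu>"
    using \<alpha> \<beta> \<omega>(5) by (auto simp: min_ext_def)
  then show ?thesis using that \<alpha> \<beta> \<omega>(2) by (auto simp: extensions_def)
qed

text \<open>For a given x at most one pair contributes to the sum, the one determined by the initial
  segment of \<mu>x whose degree is the join. It exists exactly when \<mu>x also extends \<nu>,
  which is when the left side can be nonzero.\<close>

lemma shift_adj_shift_min_ext:
  assumes *: "\<mu> \<in> paths \<Lambda>" "\<nu> \<in> paths \<Lambda>" and fin: "finite (min_ext \<Lambda> \<mu> \<nu>)"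
  shows "letter_op (\<mu>, True) (letter_op (\<nu>, False) \<xi>) x =
    (\<Sum>(\<alpha>, \<beta>)\<in>min_ext \<Lambda> \<mu> \<nu>. letter_op (\<alpha>, False) (letter_op (\<beta>, True) \<xi>) x)"
proof -
  have split: "x \<in> extensions \<mu> \<and> pcomp \<Lambda> \<beta> \<eta> \<in> extensions \<nu> \<and> \<eta> \<in> extensions \<beta> \<and>
      pcomp \<Lambda> \<mu> x = pcomp \<Lambda> (pcomp \<Lambda> \<mu> \<alpha>) \<eta> \<and> pcomp \<Lambda> \<mu> x = pcomp \<Lambda> \<nu> (pcomp \<Lambda> \<beta> \<eta>)"
    if m: "(\<alpha>, \<beta>) \<in> min_ext \<Lambda> \<mu> \<nu>" and \<eta>: "\<eta> \<in> extensions \<alpha>" "x = pcomp \<Lambda> \<alpha> \<eta>" for \<alpha> \<beta> \<eta>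
  proof -
    note d = min_extD[OF m]
    have e: "\<eta> \<in> paths \<Lambda>" "src \<Lambda> \<alpha> = rng \<Lambda> \<eta>" using \<eta> by (auto simp: extensions_def)
    have "src \<Lambda> \<beta> = src \<Lambda> \<alpha>"
      using d src_comp[OF *(1) d(1) d(3)] src_comp[OF *(2) d(2) d(4)] by simp
    then have e': "src \<Lambda> \<beta> = rng \<Lambda> \<eta>" using e by simp
    show ?thesis
      using * d e e' \<eta>(2) comp_assoc[OF *(1) d(1) e(1) d(3) e(2)] comp_assoc[OF *(2) d(2) e(1) d(4) e']
      by (auto simp: extensions_def comp_closed rng_comp)
  qed
  show ?thesis
  proof (cases "x \<in> extensions \<mu> \<and> pcomp \<Lambda> \<mu> x \<in> pcomp \<Lambda> \<nu> ` extensions \<nu>")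
    case True
    then obtain y where y: "x \<in> extensions \<mu>" "y \<in> extensions \<nu>" "pcomp \<Lambda> \<mu> x = pcomp \<Lambda> \<nu> y" by auto
    obtain \<alpha> \<beta> \<eta> where m: "(\<alpha>, \<beta>) \<in> min_ext \<Lambda> \<mu> \<nu>" "\<eta> \<in> extensions \<alpha>" "\<eta> \<in> extensions \<beta>"
      "x = pcomp \<Lambda> \<alpha> \<eta>" "y = pcomp \<Lambda> \<beta> \<eta>" by (rule common_extension[OF * y])
    note d = min_extD[OF m(1)]
    have lhs: "letter_op (\<mu>, True) (letter_op (\<nu>, False) \<xi>) x = \<xi> y"
      unfolding shift_adj_apply using y shift_apply[OF *(2) y(2), of \<xi>] by simp
    have here: "letter_op (\<alpha>, False) (letter_op (\<beta>, True) \<xi>) x = \<xi> y"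
      unfolding m(4) shift_apply[OF d(1) m(2)] shift_adj_apply using m by simp
    \<comment> \<open>A second contributing pair would cut \<mu>x at the same degree, so unique
      factorisation identifies it with the first.\<close>
    have "letter_op (\<alpha>', False) (letter_op (\<beta>', True) \<xi>) x = 0"
      if m': "(\<alpha>', \<beta>') \<in> min_ext \<Lambda> \<mu> \<nu>" and ne: "(\<alpha>', \<beta>') \<noteq> (\<alpha>, \<beta>)" for \<alpha>' \<beta>'
    proof (rule shift_zero, rule notI)
      assume "x \<in> pcomp \<Lambda> \<alpha>' ` extensions \<alpha>'"
      then obtain \<eta>' where \<eta>': "\<eta>' \<in> extensions \<alpha>'" "x = pcomp \<Lambda> \<alpha>' \<eta>'" by auto
      note d' = min_extD[OF m']
      have "pcomp \<Lambda> (pcomp \<Lambda> \<mu> \<alpha>) \<eta> = pcomp \<Lambda> (pcomp \<Lambda> \<mu> \<alpha>') \<eta>'"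
        using split[OF m(1,2,4)] split[OF m' \<eta>'] by simp
      then have "pcomp \<Lambda> \<mu> \<alpha> = pcomp \<Lambda> \<mu> \<alpha>' \<and> \<eta> = \<eta>'"
      proof (rule factor_unique[rotated -2])
        show "pcomp \<Lambda> \<mu> \<alpha> \<in> paths \<Lambda>" "pcomp \<Lambda> \<mu> \<alpha>' \<in> paths \<Lambda>"
          using * d(1,3) d'(1,3) by (auto intro: comp_closed)
        show "\<eta> \<in> paths \<Lambda>" "\<eta>' \<in> paths \<Lambda>" using m(2) \<eta>'(1) by (auto simp: extensions_def)
        show "src \<Lambda> (pcomp \<Lambda> \<mu> \<alpha>) = rng \<Lambda> \<eta>"
          using src_comp[OF *(1) d(1,3)] m(2) by (simp add: extensions_def)
        show "src \<Lambda> (pcomp \<Lambda> \<mu> \<alpha>') = rng \<Lambda> \<eta>'"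
          using src_comp[OF *(1) d'(1,3)] \<eta>'(1) by (simp add: extensions_def)
        show "deg \<Lambda> (pcomp \<Lambda> \<mu> \<alpha>) = deg \<Lambda> (pcomp \<Lambda> \<mu> \<alpha>')" using d(6) d'(6) by simp
      qed
      then have same: "pcomp \<Lambda> \<mu> \<alpha> = pcomp \<Lambda> \<mu> \<alpha>'" "pcomp \<Lambda> \<nu> \<beta> = pcomp \<Lambda> \<nu> \<beta>'" using d d' by auto
      have "\<alpha> = \<alpha>'" using factor_unique[OF *(1) d(1,3) *(1) d'(1,3) same(1)] by simp
      moreover have "\<beta> = \<beta>'" using factor_unique[OF *(2) d(2,4) *(2) d'(2,4) same(2)] by simp
      ultimately show False using ne by simp
    qed
    then have "(\<Sum>i\<in>min_ext \<Lambda> \<mu> \<nu>. case i of (\<alpha>, \<beta>) \<Rightarrow> letter_op (\<alpha>, False) (letter_op (\<beta>, True) \<xi>) x) =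
        (\<Sum>i\<in>{(\<alpha>, \<beta>)}. case i of (\<alpha>, \<beta>) \<Rightarrow> letter_op (\<alpha>, False) (letter_op (\<beta>, True) \<xi>) x)"
      using m(1) fin by (intro sum.mono_neutral_right) (auto simp del: letter_op.simps)
    then show ?thesis using lhs here by (simp del: letter_op.simps)
  next
    case False
    have "letter_op (\<mu>, True) (letter_op (\<nu>, False) \<xi>) x = 0"
      using False shift_zero[of "pcomp \<Lambda> \<mu> x" \<nu> \<xi>] unfolding shift_adj_apply by auto
    moreover have "letter_op (\<alpha>, False) (letter_op (\<beta>, True) \<xi>) x = 0" if m: "(\<alpha>, \<beta>) \<in> min_ext \<Lambda> \<mu> \<nu>" for \<alpha> \<beta>
    proof (rule shift_zero, rule notI)
      assume "x \<in> pcomp \<Lambda> \<alpha> ` extensions \<alpha>"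
      then obtain \<eta> where \<eta>: "\<eta> \<in> extensions \<alpha>" "x = pcomp \<Lambda> \<alpha> \<eta>" by auto
      note s = split[OF m \<eta>]
      then have "pcomp \<Lambda> \<mu> x \<in> pcomp \<Lambda> \<nu> ` extensions \<nu>" by (metis imageI)
      with s False show False by blast
    qed
    ultimately show ?thesis
      by (simp only:) (rule sum.neutral[symmetric], auto simp del: letter_op.simps)
  qed
qed

text \<open>This places \<open>rep_norm\<close> among the seminorms below the universal norm, so
  functionals built from matrix entries of the path representation extend to the Toeplitz
  algebra.\<close>

theorem rep_toeplitz_seminormed:
  assumes fin: "\<And>\<mu> \<nu>. \<mu> \<in> paths \<Lambda> \<Longrightarrow> \<nu> \<in> paths \<Lambda> \<Longrightarrow> finite (min_ext \<Lambda> \<mu> \<nu>)"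
  shows "toeplitz_seminormed \<Lambda> rep_norm"
proof -
  interpret cstar_seminormed "paths \<Lambda>" rep_norm by (rule rep_seminormed)
  have vertex_path: "z \<in> paths \<Lambda>" if "z \<in> paths_deg \<Lambda> 0" for z using that by (simp add: paths_deg_def)
  have "toeplitz_relations \<Lambda> rep_norm"
    unfolding toeplitz_relations_def
  proof (intro conjI ballI impI)
    fix z assume z: "z \<in> paths_deg \<Lambda> 0"
    show "rep_norm (padj (gen z) - gen z) = 0" "rep_norm (gen z * gen z - gen z) = 0"
      using vertex_path[OF z] z
      by (auto intro!: rep_norm_zeroI simp: rep_mult rep_gen rep_padj_gen shift_vertex simp del: letter_op.simps)
  next
    fix z x assume z: "z \<in> paths_deg \<Lambda> 0" "x \<in> paths_deg \<Lambda> 0" "z \<noteq> x"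
    have "rep_norm (gen z * gen x - 0) = 0"
      using vertex_path[OF z(1)] vertex_path[OF z(2)] z
      by (intro rep_norm_zeroI) (auto simp: rep_mult rep_gen shift_vertex simp del: letter_op.simps)
    then show "rep_norm (gen z * gen x) = 0" by simp
  next
    fix \<kappa> \<mu> assume "\<kappa> \<in> paths \<Lambda>" "\<mu> \<in> paths \<Lambda>" "src \<Lambda> \<kappa> = rng \<Lambda> \<mu>"
    then show "rep_norm (gen \<kappa> * gen \<mu> - gen (pcomp \<Lambda> \<kappa> \<mu>)) = 0"
      by (intro rep_norm_zeroI) (auto simp: rep_mult rep_gen shift_comp comp_closed simp del: letter_op.simps)
  next
    fix \<kappa> assume "\<kappa> \<in> paths \<Lambda>"
    then show "rep_norm (padj (gen \<kappa>) * gen \<kappa> - gen (src \<Lambda> \<kappa>)) = 0"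
      by (intro rep_norm_zeroI)
        (auto simp: rep_mult rep_gen rep_padj_gen shift_adj_shift src_closed simp del: letter_op.simps)
  next
    fix \<mu> \<nu> assume *: "\<mu> \<in> paths \<Lambda>" "\<nu> \<in> paths \<Lambda>"
    show "rep_norm (padj (gen \<mu>) * gen \<nu> - (\<Sum>(\<alpha>, \<beta>)\<in>min_ext \<Lambda> \<mu> \<nu>. gen \<alpha> * padj (gen \<beta>))) = 0"
    proof (rule rep_norm_zeroI)
      fix \<xi> :: "'p \<Rightarrow> complex" and x
      show "rep (padj (gen \<mu>) * gen \<nu>) \<xi> x = rep (\<Sum>(\<alpha>, \<beta>)\<in>min_ext \<Lambda> \<mu> \<nu>. gen \<alpha> * padj (gen \<beta>)) \<xi> x"
        unfolding rep_sum rep_mult rep_gen rep_padj_gen shift_adj_shift_min_ext[OF * fin[OF *]]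
        by (intro sum.cong) (auto simp: rep_mult rep_gen rep_padj_gen simp del: letter_op.simps)
      show "(\<Sum>(\<alpha>, \<beta>)\<in>min_ext \<Lambda> \<mu> \<nu>. gen \<alpha> * padj (gen \<beta>)) \<in> polys (paths \<Lambda>)"
        by (intro sum_polys) (auto simp: min_ext_def)
    qed (use * in auto)
  qed
  then show ?thesis by unfold_locales
qed

end

section \<open>Finiteness and weights\<close>

context two_graph
begin

lemma finite_paths_deg_add:
  assumes "finite (paths_deg \<Lambda> m)" "finite (paths_deg \<Lambda> n)"
  shows "finite (paths_deg \<Lambda> (m + n))"
proof (rule finite_subset)
  show "paths_deg \<Lambda> (m + n) \<subseteq> (\<lambda>(\<mu>, \<nu>). pcomp \<Lambda> \<mu> \<nu>) ` (paths_deg \<Lambda> m \<times> paths_deg \<Lambda> n)"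
  proof
    fix \<kappa> assume "\<kappa> \<in> paths_deg \<Lambda> (m + n)"
    then have "\<kappa> \<in> paths \<Lambda>" "deg \<Lambda> \<kappa> = m + n" by (auto simp: paths_deg_def)
    then obtain \<mu> \<nu> where "\<mu> \<in> paths \<Lambda>" "\<nu> \<in> paths \<Lambda>" "\<kappa> = pcomp \<Lambda> \<mu> \<nu>" "deg \<Lambda> \<mu> = m" "deg \<Lambda> \<nu> = n"
      by (rule factor_exists)
    then show "\<kappa> \<in> (\<lambda>(\<mu>, \<nu>). pcomp \<Lambda> \<mu> \<nu>) ` (paths_deg \<Lambda> m \<times> paths_deg \<Lambda> n)"
      by (auto simp: paths_deg_def)
  qed
qed (use assms in auto)

lemma finite_paths_deg:
  assumes "finite (paths_deg \<Lambda> 0)" "finite (paths_deg \<Lambda> (1, 0))" "finite (paths_deg \<Lambda> (0, 1))"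
  shows "finite (paths_deg \<Lambda> n)"
proof -
  have 1: "finite (paths_deg \<Lambda> (i, 0))" for i
  proof (induction i)
    case (Suc i)
    have "(Suc i, 0) = (1, 0) + (i, 0 :: nat)" by simp
    then show ?case using finite_paths_deg_add[OF assms(2) Suc] by simp
  qed (use assms in \<open>simp add: zero_prod_def\<close>)
  have 2: "finite (paths_deg \<Lambda> (0, j))" for j
  proof (induction j)
    case (Suc j)
    have "(0, Suc j) = (0, 1) + (0 :: nat, j)" by simp
    then show ?case using finite_paths_deg_add[OF assms(3) Suc] by simp
  qed (use assms in \<open>simp add: zero_prod_def\<close>)
  have "n = (fst n, 0) + (0, snd n)" by simp
  then show ?thesis using finite_paths_deg_add[OF 1 2] by metis
qed

text \<open>The degrees of \<alpha> and \<beta> are what is missing from the degrees of \<mu> and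
  \<nu> to their join, so each ranges over paths of one fixed degree.\<close>

lemma finite_min_ext:
  assumes fin: "\<And>n. finite (paths_deg \<Lambda> n)" and "\<mu> \<in> paths \<Lambda>" "\<nu> \<in> paths \<Lambda>"
  shows "finite (min_ext \<Lambda> \<mu> \<nu>)"
proof (rule finite_subset)
  let ?s = "sup (deg \<Lambda> \<mu>) (deg \<Lambda> \<nu>)"
  show "min_ext \<Lambda> \<mu> \<nu> \<subseteq> paths_deg \<Lambda> (?s - deg \<Lambda> \<mu>) \<times> paths_deg \<Lambda> (?s - deg \<Lambda> \<nu>)"
  proof clarify
    fix \<alpha> \<beta> assume "(\<alpha>, \<beta>) \<in> min_ext \<Lambda> \<mu> \<nu>"
    note d = min_extD[OF this]
    have "?s = deg \<Lambda> \<mu> + deg \<Lambda> \<alpha>" "?s = deg \<Lambda> \<nu> + deg \<Lambda> \<beta>"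
      using d assms deg_comp[of \<mu> \<alpha>] deg_comp[of \<nu> \<beta>] by auto
    then have "deg \<Lambda> \<alpha> = ?s - deg \<Lambda> \<mu>" "deg \<Lambda> \<beta> = ?s - deg \<Lambda> \<nu>"
      by (metis add_diff_cancel_left')+
    then show "\<alpha> \<in> paths_deg \<Lambda> (?s - deg \<Lambda> \<mu>) \<and> \<beta> \<in> paths_deg \<Lambda> (?s - deg \<Lambda> \<nu>)"
      using d(1,2) by (simp only: paths_deg_def mem_Collect_eq)
  qed
qed (use fin in auto)

end

section \<open>Weights of degrees and ratios of geometric sums\<close>

lemma deg_weight_add: "deg_weight r (m + n) = deg_weight r m + deg_weight r n"
  by (simp add: deg_weight_def algebra_simps)

text \<open>The coordinates of m - n are the coefficients of a rational linear relation between
  \<open>r\<^sub>1\<close> and \<open>r\<^sub>2\<close>.\<close>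

lemma deg_weight_inject:
  assumes "rationally_independent r\<^sub>1 r\<^sub>2" "deg_weight (r\<^sub>1, r\<^sub>2) m = deg_weight (r\<^sub>1, r\<^sub>2) n"
  shows "m = n"
proof -
  let ?p = "of_nat (fst m) - of_nat (fst n) :: rat" and ?q = "of_nat (snd m) - of_nat (snd n) :: rat"
  have "of_rat ?p * r\<^sub>1 + of_rat ?q * r\<^sub>2 = 0"
    using assms(2) by (simp add: deg_weight_def of_rat_diff algebra_simps)
  then have "?p = 0" "?q = 0" using assms(1) unfolding rationally_independent_def by blast+
  then show ?thesis by (simp add: prod_eq_iff)
qed

text \<open>For q < 1 both sums converge to the same nonzero limit. For q = 1, the critical case,
  they grow linearly and differ by at most k, so the ratio still tends to 1.\<close>

lemma geometric_ratio:
  fixes q :: real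
  assumes "0 < q" "q \<le> 1"
  shows "(\<lambda>N. (\<Sum>i\<le>N - k. q ^ i) / (\<Sum>i\<le>N. q ^ i)) \<longlonglongrightarrow> 1"
proof -
  have pos: "(\<Sum>i\<le>N. q ^ i) > 0" for N
    using assms by (intro sum_pos) auto
  have "(\<lambda>N. (\<Sum>i\<le>N. q ^ i) / (\<Sum>i\<le>N + k. q ^ i)) \<longlonglongrightarrow> 1"
  proof (cases "q = 1")
    case True
    have "(\<lambda>N. real (Suc N) / real (Suc (N + k))) \<longlonglongrightarrow> 1" by real_asymp
    then show ?thesis by (simp add: True)
  next
    case False
    then have q: "norm q < 1" using assms by simp
    have lim: "(\<lambda>N. \<Sum>i\<le>N. q ^ i) \<longlonglongrightarrow> 1 / (1 - q)"
      using geometric_sums[OF q] by (simp add: sums_def_le)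
    have "(\<lambda>N. (\<Sum>i\<le>N. q ^ i) / (\<Sum>i\<le>N + k. q ^ i)) \<longlonglongrightarrow> (1 / (1 - q)) / (1 / (1 - q))"
      using LIMSEQ_ignore_initial_segment[OF lim, of k] q False by (intro tendsto_divide lim) auto
    then show ?thesis using False by simp
  qed
  \<comment> \<open>Passing from N to N + k avoids the truncation of N - k for small N.\<close>
  then have "(\<lambda>N. (\<Sum>i\<le>N + k - k. q ^ i) / (\<Sum>i\<le>N + k. q ^ i)) \<longlonglongrightarrow> 1" by simp
  then show ?thesis by (rule LIMSEQ_offset)
qed

section \<open>The equilibrium functional\<close>

text \<open>
  On the path representation consider the weighted averages of the vector states \<open>\<langle>\<cdot> \<delta>\<^sub>\<kappa>, \<delta>\<^sub>\<kappa>\<rangle>\<close> over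
  the paths of degree at most \<open>(N, N)\<close>. Moving \<open>t\<^sub>\<kappa>\<close> around the trace only changes the terms near the
  boundary of this box, whose relative weight vanishes as \<open>N\<close> grows; this still works at the critical
  temperature, where the total weight diverges.
\<close>

locale one_vertex_graph = two_graph \<Lambda> for \<Lambda> :: "'p two_graph_data" +
  fixes u :: 'p and r :: "real \<times> real"
  assumes vertices: "paths_deg \<Lambda> 0 = {u}"
    and finite_edges: "finite (paths_deg \<Lambda> (1, 0))" "finite (paths_deg \<Lambda> (0, 1))"
    and edges: "paths_deg \<Lambda> (1, 0) \<noteq> {}" "paths_deg \<Lambda> (0, 1) \<noteq> {}"
    and subcritical: "real (card (paths_deg \<Lambda> (1, 0))) \<le> exp (fst r)"
      "real (card (paths_deg \<Lambda> (0, 1))) \<le> exp (snd r)"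
    and deg_weight_inj: "deg_weight r m = deg_weight r n \<Longrightarrow> m = n"
begin

lemma rng_u: "\<kappa> \<in> paths \<Lambda> \<Longrightarrow> rng \<Lambda> \<kappa> = u"
  using rng_vertex[of \<kappa>] by (simp add: vertices)

lemma src_u: "\<kappa> \<in> paths \<Lambda> \<Longrightarrow> src \<Lambda> \<kappa> = u"
  using src_vertex[of \<kappa>] by (simp add: vertices)

lemma u_path: "u \<in> paths \<Lambda>"
  using vertices by (auto simp: paths_deg_def)

lemma extensions_eq: "g \<in> paths \<Lambda> \<Longrightarrow> extensions g = paths \<Lambda>"
  by (auto simp: extensions_def rng_u src_u)

lemma fin_deg: "finite (paths_deg \<Lambda> n)"
  by (rule finite_paths_deg) (use finite_edges vertices in auto)

text \<open>With a single vertex any two paths are composable, so composition is a bijection by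
  unique factorisation.\<close>

lemma card_paths_deg_add: "card (paths_deg \<Lambda> (m + n)) = card (paths_deg \<Lambda> m) * card (paths_deg \<Lambda> n)"
proof -
  have "bij_betw (\<lambda>(\<mu>, \<nu>). pcomp \<Lambda> \<mu> \<nu>) (paths_deg \<Lambda> m \<times> paths_deg \<Lambda> n) (paths_deg \<Lambda> (m + n))"
  proof (rule bij_betwI')
    fix x y assume xy: "x \<in> paths_deg \<Lambda> m \<times> paths_deg \<Lambda> n" "y \<in> paths_deg \<Lambda> m \<times> paths_deg \<Lambda> n"
    obtain a b c d where [simp]: "x = (a, b)" "y = (c, d)" by (cases x; cases y)
    have *: "a \<in> paths \<Lambda>" "b \<in> paths \<Lambda>" "c \<in> paths \<Lambda>" "d \<in> paths \<Lambda>" "deg \<Lambda> a = deg \<Lambda> c"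
      using xy by (auto simp: paths_deg_def)
    show "((case x of (\<mu>, \<nu>) \<Rightarrow> pcomp \<Lambda> \<mu> \<nu>) = (case y of (\<mu>, \<nu>) \<Rightarrow> pcomp \<Lambda> \<mu> \<nu>)) = (x = y)"
      using factor_unique[of a b c d] * by (auto simp: rng_u src_u)
  next
    fix x assume x: "x \<in> paths_deg \<Lambda> m \<times> paths_deg \<Lambda> n"
    then show "(case x of (\<mu>, \<nu>) \<Rightarrow> pcomp \<Lambda> \<mu> \<nu>) \<in> paths_deg \<Lambda> (m + n)"
      by (auto simp: paths_deg_def comp_closed deg_comp rng_u src_u)
  next
    fix \<kappa> assume "\<kappa> \<in> paths_deg \<Lambda> (m + n)"
    then have "\<kappa> \<in> paths \<Lambda>" "deg \<Lambda> \<kappa> = m + n" by (auto simp: paths_deg_def)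
    then obtain \<mu> \<nu> where "\<mu> \<in> paths \<Lambda>" "\<nu> \<in> paths \<Lambda>" "\<kappa> = pcomp \<Lambda> \<mu> \<nu>" "deg \<Lambda> \<mu> = m" "deg \<Lambda> \<nu> = n"
      by (rule factor_exists)
    then show "\<exists>x\<in>paths_deg \<Lambda> m \<times> paths_deg \<Lambda> n. \<kappa> = (case x of (\<mu>, \<nu>) \<Rightarrow> pcomp \<Lambda> \<mu> \<nu>)"
      by (intro bexI[of _ "(\<mu>, \<nu>)"]) (auto simp: paths_deg_def)
  qed
  from bij_betw_same_card[OF this] show ?thesis by (simp add: card_cartesian_product)
qed

lemma card_paths_deg: "card (paths_deg \<Lambda> (i, j)) = card (paths_deg \<Lambda> (1, 0)) ^ i * card (paths_deg \<Lambda> (0, 1)) ^ j"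
proof -
  have 0: "card (paths_deg \<Lambda> (0, 0)) = 1" using vertices by (simp add: zero_prod_def)
  have 1: "card (paths_deg \<Lambda> (i, 0)) = card (paths_deg \<Lambda> (1, 0)) ^ i" for i
  proof (induction i)
    case (Suc i)
    then show ?case using card_paths_deg_add[of "(1, 0)" "(i, 0)"] by simp
  qed (use 0 in simp)
  have 2: "card (paths_deg \<Lambda> (0, j)) = card (paths_deg \<Lambda> (0, 1)) ^ j" for j
  proof (induction j)
    case (Suc j)
    then show ?case using card_paths_deg_add[of "(0, 1)" "(0, j)"] by simp
  qed (use 0 in simp)
  show ?thesis using card_paths_deg_add[of "(i, 0)" "(0, j)"] by (simp add: 1[of i] 2[of j])
qed

text \<open>The Gibbs weight of a path at inverse temperature 1.\<close>

definition weight :: "'p \<Rightarrow> real" where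
  "weight \<kappa> = exp (- deg_weight r (deg \<Lambda> \<kappa>))"

definition box :: "nat \<times> nat \<Rightarrow> 'p set" where
  "box m = {\<kappa> \<in> paths \<Lambda>. fst (deg \<Lambda> \<kappa>) \<le> fst m \<and> snd (deg \<Lambda> \<kappa>) \<le> snd m}"

definition mass :: "nat \<times> nat \<Rightarrow> real" where
  "mass m = sum weight (box m)"

definition avg :: "nat \<Rightarrow> 'p star_poly \<Rightarrow> complex" where
  "avg N x = (\<Sum>\<kappa>\<in>box (N, N). of_real (weight \<kappa>) * rep x (delta \<kappa>) \<kappa>) / of_real (mass (N, N))"

lemma weight_pos [simp]: "weight \<kappa> > 0"
  by (simp add: weight_def)

lemma weight_nonzero [simp]: "weight \<kappa> \<noteq> 0"
  by (simp add: weight_def)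

lemma weight_comp: "\<mu> \<in> paths \<Lambda> \<Longrightarrow> \<nu> \<in> paths \<Lambda> \<Longrightarrow> weight (pcomp \<Lambda> \<mu> \<nu>) = weight \<mu> * weight \<nu>"
  by (simp add: weight_def deg_comp rng_u src_u deg_weight_add exp_add[symmetric])

lemma finite_box: "finite (box m)"
proof (rule finite_subset)
  show "box m \<subseteq> (\<Union>n\<in>{..fst m} \<times> {..snd m}. paths_deg \<Lambda> n)"
    by (auto simp: box_def paths_deg_def mem_Times_iff)
qed (auto intro: fin_deg)

text \<open>The total weight of the edges of the first colour; \<open>q1 ^ i * q2 ^ j\<close> is
  then the total weight of all paths of degree (i, j). Subcriticality says that the ratio is at most
  1, with equality exactly at a critical coordinate.\<close>

definition q1 :: real where "q1 = real (card (paths_deg \<Lambda> (1, 0))) * exp (- fst r)"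
definition q2 :: real where "q2 = real (card (paths_deg \<Lambda> (0, 1))) * exp (- snd r)"

lemma q_bounds: "0 < q1" "q1 \<le> 1" "0 < q2" "q2 \<le> 1"
  using finite_edges edges subcritical
  by (auto simp: q1_def q2_def exp_minus field_simps card_gt_0_iff)

lemma mass_eq: "mass m = (\<Sum>i\<le>fst m. q1 ^ i) * (\<Sum>j\<le>snd m. q2 ^ j)"
proof -
  have "mass m = (\<Sum>n\<in>{..fst m} \<times> {..snd m}. sum weight {\<kappa> \<in> box m. deg \<Lambda> \<kappa> = n})"
    unfolding mass_def
    by (rule sum.group[symmetric]) (use finite_box in simp, simp, intro image_subsetI, simp add: box_def mem_Times_iff)
  also have "\<dots> = (\<Sum>(i, j)\<in>{..fst m} \<times> {..snd m}. q1 ^ i * q2 ^ j)"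
  proof (rule sum.cong[OF refl])
    fix n assume n: "n \<in> {..fst m} \<times> {..snd m}"
    obtain i j where nij: "n = (i, j)" by (cases n)
    have ij: "i \<le> fst m" "j \<le> snd m" using n by (auto simp: nij)
    have "{\<kappa> \<in> box m. deg \<Lambda> \<kappa> = (i, j)} = paths_deg \<Lambda> (i, j)"
      using ij by (auto simp: box_def paths_deg_def)
    moreover have "sum weight (paths_deg \<Lambda> (i, j)) =
        real (card (paths_deg \<Lambda> (i, j))) * exp (- deg_weight r (i, j))"
      by (subst sum_constant[symmetric], rule sum.cong) (auto simp: weight_def paths_deg_def)
    moreover have "exp (- deg_weight r (i, j)) = exp (- fst r) ^ i * exp (- snd r) ^ j"
      by (simp add: deg_weight_def exp_add[symmetric] exp_of_nat_mult[symmetric] mult.commute)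
    ultimately show "sum weight {\<kappa> \<in> box m. deg \<Lambda> \<kappa> = n} = (case n of (i, j) \<Rightarrow> q1 ^ i * q2 ^ j)"
      by (simp add: nij card_paths_deg[of i j] q1_def q2_def power_mult_distrib)
  qed
  finally show ?thesis by (simp add: sum_product sum.cartesian_product)
qed

lemma mass_pos: "mass m > 0"
  unfolding mass_eq using q_bounds by (intro mult_pos_pos sum_pos) auto

lemma mass_ratio: "(\<lambda>N. mass (N - i, N - j) / mass (N, N)) \<longlonglongrightarrow> 1"
proof -
  have "(\<lambda>N. ((\<Sum>i\<le>N - i. q1 ^ i) / (\<Sum>i\<le>N. q1 ^ i)) * ((\<Sum>i\<le>N - j. q2 ^ i) / (\<Sum>i\<le>N. q2 ^ i)))
      \<longlonglongrightarrow> 1 * 1"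
    using q_bounds by (intro tendsto_mult geometric_ratio)
  then show ?thesis by (simp add: mass_eq)
qed

section \<open>Averages of the vector states\<close>

lemma rep_entry_le:
  assumes "x \<in> polys (paths \<Lambda>)"
  shows "cmod (rep x (delta \<mu>) \<kappa>) \<le> rep_norm x"
  using norm_apply_le_vnorm[OF rep_finsupp[OF assms finsupp_delta]] rep_le[OF assms finsupp_delta[of \<mu>]]
  by (fastforce intro: order.trans)

lemma avg_add: "avg N (x + y) = avg N x + avg N y"
  by (simp add: avg_def rep_add distrib_left sum.distrib add_divide_distrib)

lemma avg_smul: "avg N (c \<cdot> x) = c * avg N x"
  by (simp add: avg_def rep_smul sum_distrib_left mult.left_commute)

lemma avg_diff: "avg N (x - y) = avg N x - avg N y"
  by (simp add: avg_def rep_diff right_diff_distrib sum_subtractf diff_divide_distrib)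

lemma avg_le:
  assumes x: "x \<in> polys (paths \<Lambda>)"
  shows "cmod (avg N x) \<le> rep_norm x"
proof -
  have "cmod (\<Sum>\<kappa>\<in>box (N, N). of_real (weight \<kappa>) * rep x (delta \<kappa>) \<kappa>) \<le> (\<Sum>\<kappa>\<in>box (N, N). weight \<kappa> * rep_norm x)"
    by (rule sum_norm_le) (auto simp: norm_mult less_imp_le intro!: mult_left_mono rep_entry_le[OF x])
  also have "\<dots> = mass (N, N) * rep_norm x" by (simp add: mass_def sum_distrib_right)
  finally show ?thesis
    using mass_pos[of "(N, N)"] by (simp add: avg_def norm_divide pos_divide_le_eq mult.commute)
qed

lemma avg_padj:
  assumes x: "x \<in> polys (paths \<Lambda>)"
  shows "avg N (padj x) = cnj (avg N x)"
proof -
  have "rep (padj x) (delta \<kappa>) \<kappa> = cnj (rep x (delta \<kappa>) \<kappa>)" for \<kappa>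
  proof -
    have "rep x (delta \<kappa>) \<kappa> = ip (delta \<kappa>) (rep (padj x) (delta \<kappa>))"
      using rep_adj[OF x, of "delta \<kappa>" "delta \<kappa>"] rep_finsupp[OF x, of "delta \<kappa>"] by (simp add: ip_delta)
    also have "\<dots> = cnj (rep (padj x) (delta \<kappa>) \<kappa>)"
      using rep_finsupp[OF padj_polys[OF x], of "delta \<kappa>"] ip_commute[of "rep (padj x) (delta \<kappa>)" "delta \<kappa>"]
      by (simp add: ip_delta)
    finally show ?thesis by simp
  qed
  then show ?thesis by (simp add: avg_def)
qed

text \<open>The diagonal entries of \<open>padj x * x\<close> are the squared norms of the columns
  of \<open>x\<close>.\<close>

lemma avg_nonneg:
  assumes x: "x \<in> polys (paths \<Lambda>)"
  shows "avg N (padj x * x) \<in> \<real>\<^sub>\<ge>\<^sub>0"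
proof -
  have "rep (padj x * x) (delta \<kappa>) \<kappa> = of_real ((vnorm (rep x (delta \<kappa>)))\<^sup>2)" for \<kappa>
  proof -
    have fs: "finsupp (rep x (delta \<kappa>))" by (intro rep_finsupp x finsupp_delta)
    have "rep (padj x * x) (delta \<kappa>) \<kappa> = ip (rep (padj x) (rep x (delta \<kappa>))) (delta \<kappa>)"
      using rep_finsupp[OF padj_polys[OF x] fs] by (simp add: rep_mult ip_delta)
    also have "\<dots> = ip (rep x (delta \<kappa>)) (rep x (delta \<kappa>))"
      using rep_adj[OF padj_polys[OF x] fs, of "delta \<kappa>"] by simp
    finally show ?thesis by (simp add: ip_self)
  qed
  then have "avg N (padj x * x) =
      of_real ((\<Sum>\<kappa>\<in>box (N, N). weight \<kappa> * (vnorm (rep x (delta \<kappa>)))\<^sup>2) / mass (N, N))"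
    by (simp add: avg_def)
  moreover have "(\<Sum>\<kappa>\<in>box (N, N). weight \<kappa> * (vnorm (rep x (delta \<kappa>)))\<^sup>2) / mass (N, N) \<ge> 0"
    using mass_pos[of "(N, N)"] by (intro divide_nonneg_pos sum_nonneg mult_nonneg_nonneg) (auto intro: less_imp_le)
  ultimately show ?thesis by (metis nonneg_Reals_of_real_iff)
qed

lemma avg_unit: "avg N (gen u) = 1"
proof -
  have "rep (gen u) (delta \<kappa>) \<kappa> = 1" if "\<kappa> \<in> box (N, N)" for \<kappa>
    using that shift_vertex[of u False "delta \<kappa>" \<kappa>] vertices
    by (simp add: rep_gen box_def rng_u delta_def del: letter_op.simps)
  then have "avg N (gen u) = of_real (mass (N, N)) / of_real (mass (N, N))"
    by (simp add: avg_def mass_def)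
  then show ?thesis using mass_pos[of "(N, N)"] by simp
qed

section \<open>Asymptotic commutation with generators\<close>

lemma shift_delta:
  assumes "g \<in> paths \<Lambda>" "\<kappa> \<in> paths \<Lambda>"
  shows "letter_op (g, False) (delta \<kappa>) = delta (pcomp \<Lambda> g \<kappa>)"
proof
  fix x
  show "letter_op (g, False) (delta \<kappa>) x = delta (pcomp \<Lambda> g \<kappa>) x"
  proof (cases "x \<in> pcomp \<Lambda> g ` paths \<Lambda>")
    case True
    then obtain \<beta> where \<beta>: "\<beta> \<in> paths \<Lambda>" "x = pcomp \<Lambda> g \<beta>" by auto
    have "letter_op (g, False) (delta \<kappa>) x = delta \<kappa> \<beta>"
      unfolding \<beta>(2) using \<beta>(1) assms by (intro shift_apply) (simp_all add: extensions_eq)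
    then show ?thesis
      using inj_onD[OF pcomp_inj[OF assms(1)], of \<beta> \<kappa>] \<beta> assms by (auto simp: delta_def extensions_eq)
  next
    case False
    then have "letter_op (g, False) (delta \<kappa>) x = 0"
      using assms by (intro shift_zero) (simp add: extensions_eq)
    then show ?thesis using False assms by (auto simp: delta_def)
  qed
qed

text \<open>Only paths that begin with g contribute. Stripping g off multiplies the weight by that
  of g and shrinks the box by the degree of g; the bounds on \<open>N\<close> make that subtraction
  genuine.\<close>

lemma avg_gen_left:
  assumes g: "g \<in> paths \<Lambda>" and N: "fst (deg \<Lambda> g) \<le> N" "snd (deg \<Lambda> g) \<le> N"
  shows "avg N (gen g * x) = of_real (weight g) *
    (\<Sum>\<kappa>\<in>box (N - fst (deg \<Lambda> g), N - snd (deg \<Lambda> g)). of_real (weight \<kappa>) * rep x (delta (pcomp \<Lambda> g \<kappa>)) \<kappa>)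
      / of_real (mass (N, N))"
proof -
  let ?A = "box (N - fst (deg \<Lambda> g), N - snd (deg \<Lambda> g))"
  let ?f = "\<lambda>\<kappa>. of_real (weight \<kappa>) * rep (gen g * x) (delta \<kappa>) \<kappa>"
  have in_box: "pcomp \<Lambda> g \<kappa> \<in> box (N, N) \<longleftrightarrow> \<kappa> \<in> ?A" if "\<kappa> \<in> paths \<Lambda>" for \<kappa>
    using that g N by (auto simp: box_def comp_closed deg_comp rng_u src_u)
  have A: "?A \<subseteq> paths \<Lambda>" by (auto simp: box_def)
  have inj: "inj_on (pcomp \<Lambda> g) ?A"
    using inj_on_subset[OF pcomp_inj[OF g]] A by (simp add: extensions_eq g)
  have "sum ?f (box (N, N)) = sum ?f (pcomp \<Lambda> g ` ?A)"
  proof (rule sum.mono_neutral_right[OF finite_box])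
    show "pcomp \<Lambda> g ` ?A \<subseteq> box (N, N)" using in_box A by auto
    show "\<forall>\<kappa>\<in>box (N, N) - pcomp \<Lambda> g ` ?A. ?f \<kappa> = 0"
    proof
      fix \<kappa> assume \<kappa>: "\<kappa> \<in> box (N, N) - pcomp \<Lambda> g ` ?A"
      have "\<kappa> \<notin> pcomp \<Lambda> g ` extensions g" using \<kappa> in_box g by (auto simp: extensions_eq)
      then have "rep (gen g * x) (delta \<kappa>) \<kappa> = 0"
        unfolding rep_mult rep_gen by (rule shift_zero)
      then show "?f \<kappa> = 0" by simp
    qed
  qed
  also have "\<dots> = (\<Sum>\<kappa>\<in>?A. ?f (pcomp \<Lambda> g \<kappa>))" by (simp add: sum.reindex[OF inj])
  also have "\<dots> = (\<Sum>\<kappa>\<in>?A. of_real (weight g) * (of_real (weight \<kappa>) * rep x (delta (pcomp \<Lambda> g \<kappa>)) \<kappa>))"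
  proof (rule sum.cong[OF refl])
    fix \<kappa> assume "\<kappa> \<in> ?A"
    then have \<kappa>: "\<kappa> \<in> paths \<Lambda>" "\<kappa> \<in> extensions g" using A g by (auto simp: extensions_eq)
    show "?f (pcomp \<Lambda> g \<kappa>) = of_real (weight g) * (of_real (weight \<kappa>) * rep x (delta (pcomp \<Lambda> g \<kappa>)) \<kappa>)"
      unfolding rep_mult rep_gen shift_apply[OF g \<kappa>(2)] by (simp add: weight_comp g \<kappa>)
  qed
  finally show ?thesis by (simp add: avg_def sum_distrib_left)
qed

lemma avg_gen_right:
  assumes g: "g \<in> paths \<Lambda>"
  shows "avg N (x * gen g) =
    (\<Sum>\<kappa>\<in>box (N, N). of_real (weight \<kappa>) * rep x (delta (pcomp \<Lambda> g \<kappa>)) \<kappa>) / of_real (mass (N, N))"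
proof -
  have "rep (x * gen g) (delta \<kappa>) \<kappa> = rep x (delta (pcomp \<Lambda> g \<kappa>)) \<kappa>" if "\<kappa> \<in> box (N, N)" for \<kappa>
    using that shift_delta[OF g] by (simp add: rep_mult rep_gen box_def del: letter_op.simps)
  then show ?thesis by (simp add: avg_def)
qed

text \<open>After rescaling, both averages sum the same matrix entries, one over the full box and
  one over the smaller box. The difference lives on the boundary layer, where every entry is at most
  \<open>rep_norm x\<close>.\<close>

lemma avg_commute_le:
  assumes g: "g \<in> paths \<Lambda>" and N: "fst (deg \<Lambda> g) \<le> N" "snd (deg \<Lambda> g) \<le> N" and x: "x \<in> polys (paths \<Lambda>)"
  shows "cmod (avg N (x * gen g) - avg N (gen g * x) / of_real (weight g)) \<le>
    rep_norm x * (1 - mass (N - fst (deg \<Lambda> g), N - snd (deg \<Lambda> g)) / mass (N, N))"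
proof -
  let ?m = "(N - fst (deg \<Lambda> g), N - snd (deg \<Lambda> g))"
  let ?f = "\<lambda>\<kappa>. of_real (weight \<kappa>) * rep x (delta (pcomp \<Lambda> g \<kappa>)) \<kappa>"
  have sub: "box ?m \<subseteq> box (N, N)" by (auto simp: box_def)
  have "avg N (x * gen g) - avg N (gen g * x) / of_real (weight g) =
      (sum ?f (box (N, N)) - sum ?f (box ?m)) / of_real (mass (N, N))"
    unfolding avg_gen_left[OF g N] avg_gen_right[OF g]
    using weight_pos[of g] by (simp add: diff_divide_distrib)
  also have "\<dots> = sum ?f (box (N, N) - box ?m) / of_real (mass (N, N))"
    by (simp add: sum_diff[OF finite_box sub])
  finally have "cmod (avg N (x * gen g) - avg N (gen g * x) / of_real (weight g)) =
      cmod (sum ?f (box (N, N) - box ?m)) / mass (N, N)"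
    using mass_pos[of "(N, N)"] by (simp add: norm_divide)
  also have "\<dots> \<le> (\<Sum>\<kappa>\<in>box (N, N) - box ?m. weight \<kappa> * rep_norm x) / mass (N, N)"
    using mass_pos[of "(N, N)"]
    by (intro divide_right_mono sum_norm_le)
      (auto simp: norm_mult less_imp_le intro!: mult_left_mono rep_entry_le[OF x])
  also have "(\<Sum>\<kappa>\<in>box (N, N) - box ?m. weight \<kappa> * rep_norm x) = (mass (N, N) - mass ?m) * rep_norm x"
    by (simp add: mass_def sum_diff[OF finite_box sub] sum_distrib_right left_diff_distrib)
  finally show ?thesis using mass_pos[of "(N, N)"] by (simp add: field_simps)
qed

lemma avg_commute:
  assumes g: "g \<in> paths \<Lambda>" and x: "x \<in> polys (paths \<Lambda>)"
  shows "(\<lambda>N. avg N (x * gen g) - avg N (gen g * x) / of_real (weight g)) \<longlonglongrightarrow> 0"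
proof (rule Lim_null_comparison)
  show "\<forall>\<^sub>F N in sequentially. cmod (avg N (x * gen g) - avg N (gen g * x) / of_real (weight g)) \<le>
      rep_norm x * (1 - mass (N - fst (deg \<Lambda> g), N - snd (deg \<Lambda> g)) / mass (N, N))"
    using eventually_ge_at_top[of "max (fst (deg \<Lambda> g)) (snd (deg \<Lambda> g))"]
    by eventually_elim (rule avg_commute_le[OF g _ _ x], auto)
  show "(\<lambda>N. rep_norm x * (1 - mass (N - fst (deg \<Lambda> g), N - snd (deg \<Lambda> g)) / mass (N, N))) \<longlonglongrightarrow> 0"
    using tendsto_mult_right_zero[OF tendsto_diff[OF tendsto_const[of 1] mass_ratio[of "fst (deg \<Lambda> g)" "snd (deg \<Lambda> g)"], simplified]]
    by simp
qed

section \<open>Convergence of the averages and the limit functional\<close>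

interpretation rep: toeplitz_seminormed \<Lambda> rep_norm
  by (rule rep_toeplitz_seminormed) (rule finite_min_ext[OF fin_deg])

lemma avg_eqv: "rep.eqv x y \<Longrightarrow> avg N x = avg N y"
  using avg_le[of "x - y" N] by (auto simp: rep.eqv_def avg_diff)

text \<open>Let A and B be the averages of t_\<mu> t_\<nu>^* and t_\<nu>^* t_\<mu>. Commutation ties
  B to A divided by the weight of \<mu>. For equal degrees B is constantly 1 or 0, which gives a
  limit for A. For different degrees a second relation, with the weight of \<nu>, forces A to tend
  to 0.\<close>

lemma avg_gen_adj_convergent:
  assumes \<mu>: "\<mu> \<in> paths \<Lambda>" and \<nu>: "\<nu> \<in> paths \<Lambda>"
  shows "convergent (\<lambda>N. avg N (gen \<mu> * padj (gen \<nu>)))"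
proof -
  let ?A = "\<lambda>N. avg N (gen \<mu> * padj (gen \<nu>))" and ?B = "\<lambda>N. avg N (padj (gen \<nu>) * gen \<mu>)"
  have 1: "(\<lambda>N. ?B N - ?A N / of_real (weight \<mu>)) \<longlonglongrightarrow> 0"
    using avg_commute[OF \<mu>, of "padj (gen \<nu>)"] \<nu> by simp
  show ?thesis
  proof (cases "deg \<Lambda> \<mu> = deg \<Lambda> \<nu>")
    case True
    obtain b where b: "\<And>N. ?B N = b"
    proof (cases "\<mu> = \<nu>")
      case True
      have "?B N = 1" for N
        using avg_eqv[OF rep.gen_adj_gen[OF \<mu>]] True \<mu> by (simp add: src_u avg_unit)
      then show ?thesis using that by blast
    next
      case False
      have "?B N = avg N 0" for N
        using avg_eqv[OF rep.gen_adj_gen_zero[OF \<nu> \<mu>]] True False by simp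
      then have "?B N = 0" for N by (simp add: avg_def[of _ 0])
      then show ?thesis using that by blast
    qed
    have "(\<lambda>N. (b - (?B N - ?A N / of_real (weight \<mu>))) * of_real (weight \<mu>)) \<longlonglongrightarrow> (b - 0) * of_real (weight \<mu>)"
      by (intro tendsto_mult tendsto_diff tendsto_const 1)
    then have "?A \<longlonglongrightarrow> b * of_real (weight \<mu>)"
      using weight_pos[of \<mu>] by (simp add: b)
    then show ?thesis by (rule convergentI)
  next
    case False
    then have ne: "weight \<mu> \<noteq> weight \<nu>" using deg_weight_inj[of "deg \<Lambda> \<mu>" "deg \<Lambda> \<nu>"] by (auto simp: weight_def)
    \<comment> \<open>Conjugating the commutation relation for \<nu> relates the same two averages,
      now through the weight of \<nu>.\<close>
    have "(\<lambda>N. cnj (avg N (padj (gen \<mu>) * gen \<nu>) - avg N (gen \<nu> * padj (gen \<mu>)) / of_real (weight \<nu>))) \<longlonglongrightarrow> 0"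
      using tendsto_cnj[OF avg_commute[OF \<nu>, of "padj (gen \<mu>)"]] \<mu> by simp
    moreover have "cnj (avg N (padj (gen \<mu>) * gen \<nu>)) = ?B N" "cnj (avg N (gen \<nu> * padj (gen \<mu>))) = ?A N" for N
      using avg_padj[of "padj (gen \<mu>) * gen \<nu>" N] avg_padj[of "gen \<nu> * padj (gen \<mu>)" N] \<mu> \<nu>
      by (simp_all add: padj_mult rep.gen_closed)
    ultimately have 2: "(\<lambda>N. ?B N - ?A N / of_real (weight \<nu>)) \<longlonglongrightarrow> 0" by simp
    \<comment> \<open>Subtracting the two relations eliminates B and leaves A times this constant,
      nonzero because the weights differ.\<close>
    define k where "k = complex_of_real (1 / weight \<mu> - 1 / weight \<nu>)"
    have k: "k \<noteq> 0"
      unfolding k_def of_real_eq_0_iff using ne weight_pos[of \<mu>] weight_pos[of \<nu>] by (simp add: field_simps)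
    have "(\<lambda>N. ((?B N - ?A N / of_real (weight \<nu>)) - (?B N - ?A N / of_real (weight \<mu>))) / k) \<longlonglongrightarrow> (0 - 0) / k"
      by (intro tendsto_divide tendsto_diff tendsto_const 1 2 k)
    moreover have "((?B N - ?A N / of_real (weight \<nu>)) - (?B N - ?A N / of_real (weight \<mu>))) / k = ?A N" for N
    proof -
      have "(?B N - ?A N / of_real (weight \<nu>)) - (?B N - ?A N / of_real (weight \<mu>)) = ?A N * k"
        by (simp add: k_def algebra_simps)
      then show ?thesis using k by simp
    qed
    ultimately show ?thesis by (auto intro: convergentI)
  qed
qed

lemma avg_convergent:
  assumes "x \<in> polys (paths \<Lambda>)"
  shows "convergent (\<lambda>N. avg N x)"
  using assms
proof (induction rule: rep.span_induct)
  case zero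
  show ?case by (simp add: avg_def convergent_const)
next
  case (step x \<mu> \<nu> c)
  then show ?case unfolding avg_add avg_smul
    by (intro convergent_add convergent_mult convergent_const avg_gen_adj_convergent)
next
  case (eqv x y)
  then show ?case using avg_eqv by simp
qed

definition equilibrium :: "'p star_poly \<Rightarrow> complex" where
  "equilibrium x = lim (\<lambda>N. avg N x)"

lemma equilibrium_lim: "x \<in> polys (paths \<Lambda>) \<Longrightarrow> (\<lambda>N. avg N x) \<longlonglongrightarrow> equilibrium x"
  unfolding equilibrium_def using avg_convergent by (simp add: convergent_LIMSEQ_iff)

text \<open>Each average is bounded by the operator norm of the path representation, which is a
  Toeplitz seminorm and so lies below the universal norm.\<close>

lemma equilibrium_dominated: "dominated_functional (paths \<Lambda>) (toeplitz_norm \<Lambda>) equilibrium"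
  unfolding dominated_functional_def
proof (intro conjI ballI allI)
  fix x y assume x: "x \<in> polys (paths \<Lambda>)" and y: "y \<in> polys (paths \<Lambda>)"
  show "equilibrium (x + y) = equilibrium x + equilibrium y"
    using tendsto_add[OF equilibrium_lim[OF x] equilibrium_lim[OF y]] equilibrium_lim[of "x + y"] x y
    by (intro LIMSEQ_unique) (auto simp: avg_add)
next
  fix c x assume x: "x \<in> polys (paths \<Lambda>)"
  show "equilibrium (c \<cdot> x) = c * equilibrium x"
    using tendsto_mult_left[OF equilibrium_lim[OF x], of c] equilibrium_lim[of "c \<cdot> x"] x
    by (intro LIMSEQ_unique) (auto simp: avg_smul)
next
  fix x assume x: "x \<in> polys (paths \<Lambda>)"
  have "cmod (equilibrium x) \<le> rep_norm x"
    by (rule LIMSEQ_le_const2[OF tendsto_norm[OF equilibrium_lim[OF x]]]) (use avg_le[OF x] in blast)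
  also have "\<dots> \<le> toeplitz_norm \<Lambda> x"
    using x rep.toeplitz_seminormed_axioms by (intro toeplitz_norm_upper) (simp_all add: toeplitz_seminorms_iff)
  finally show "cmod (equilibrium x) \<le> toeplitz_norm \<Lambda> x" .
qed

lemma equilibrium_padj:
  assumes x: "x \<in> polys (paths \<Lambda>)"
  shows "equilibrium (padj x) = cnj (equilibrium x)"
  using tendsto_cnj[OF equilibrium_lim[OF x]] equilibrium_lim[OF padj_polys[OF x]] x
  by (intro LIMSEQ_unique) (auto simp: avg_padj)

lemma equilibrium_nonneg:
  assumes x: "x \<in> polys (paths \<Lambda>)"
  shows "equilibrium (padj x * x) \<in> \<real>\<^sub>\<ge>\<^sub>0"
  using x by (intro Lim_in_closed_set[OF closed_nonneg_Reals_complex _ _ equilibrium_lim]) (auto simp: avg_nonneg)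

lemma equilibrium_unit: "equilibrium (gen u) = 1"
  using equilibrium_lim[of "gen u"] u_path by (simp add: avg_unit LIMSEQ_const_iff gen_polys)

lemma equilibrium_commute:
  assumes g: "g \<in> paths \<Lambda>" and x: "x \<in> polys (paths \<Lambda>)"
  shows "equilibrium (x * gen g) = exp (deg_weight r (deg \<Lambda> g)) * equilibrium (gen g * x)"
proof -
  have "(\<lambda>N. avg N (x * gen g) - avg N (gen g * x) / of_real (weight g)) \<longlonglongrightarrow>
      equilibrium (x * gen g) - equilibrium (gen g * x) / of_real (weight g)"
    using g x weight_pos[of g] by (intro tendsto_diff tendsto_divide equilibrium_lim tendsto_const) auto
  then have "equilibrium (x * gen g) - equilibrium (gen g * x) / of_real (weight g) = 0"
    using avg_commute[OF g x] LIMSEQ_unique by blast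
  then show ?thesis by (simp add: weight_def exp_minus exp_of_real field_simps)
qed

end

section \<open>KMS states\<close>

context cstar_seminormed
begin

section \<open>Algebra in the completion and functionals derived from a bounded one\<close>

lemma mult_add_right:
  "X \<in> carrier C \<Longrightarrow> Y \<in> carrier C \<Longrightarrow> Z \<in> carrier C \<Longrightarrow>
     X \<otimes>\<^bsub>C\<^esub> (Y \<oplus>\<^bsub>C\<^esub> Z) = (X \<otimes>\<^bsub>C\<^esub> Y) \<oplus>\<^bsub>C\<^esub> (X \<otimes>\<^bsub>C\<^esub> Z)"
  by (elim carrier_cases) (simp add: add_class mult_class cauchy_add cauchy_mult distrib_left)

lemma mult_add_left:
  "X \<in> carrier C \<Longrightarrow> Y \<in> carrier C \<Longrightarrow> Z \<in> carrier C \<Longrightarrow>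
     (Y \<oplus>\<^bsub>C\<^esub> Z) \<otimes>\<^bsub>C\<^esub> X = (Y \<otimes>\<^bsub>C\<^esub> X) \<oplus>\<^bsub>C\<^esub> (Z \<otimes>\<^bsub>C\<^esub> X)"
  by (elim carrier_cases) (simp add: add_class mult_class cauchy_add cauchy_mult distrib_right)

lemma mult_scale_right:
  "X \<in> carrier C \<Longrightarrow> Y \<in> carrier C \<Longrightarrow> X \<otimes>\<^bsub>C\<^esub> (c \<odot>\<^bsub>C\<^esub> Y) = c \<odot>\<^bsub>C\<^esub> (X \<otimes>\<^bsub>C\<^esub> Y)"
proof (elim carrier_cases, hypsubst)
  fix x y assume *: "x \<in> cauchy_seqs F" "y \<in> cauchy_seqs F"
  have "x n * (c \<cdot> y n) = c \<cdot> (x n * y n)" for n by (rule mult_smul)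
  then show "seq_class F x \<otimes>\<^bsub>C\<^esub> (c \<odot>\<^bsub>C\<^esub> seq_class F y) = c \<odot>\<^bsub>C\<^esub> (seq_class F x \<otimes>\<^bsub>C\<^esub> seq_class F y)"
    using * by (simp add: scale_class mult_class cauchy_smul cauchy_mult)
qed

lemma mult_scale_left:
  "X \<in> carrier C \<Longrightarrow> Y \<in> carrier C \<Longrightarrow> (c \<odot>\<^bsub>C\<^esub> Y) \<otimes>\<^bsub>C\<^esub> X = c \<odot>\<^bsub>C\<^esub> (Y \<otimes>\<^bsub>C\<^esub> X)"
  by (elim carrier_cases) (simp add: scale_class mult_class cauchy_smul cauchy_mult mult.assoc)

lemma bounded_functional_add:
  "bounded_functional C L \<Longrightarrow> X \<in> carrier C \<Longrightarrow> Y \<in> carrier C \<Longrightarrow> L (X \<oplus>\<^bsub>C\<^esub> Y) = L X + L Y"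
  and bounded_functional_scale:
  "bounded_functional C L \<Longrightarrow> X \<in> carrier C \<Longrightarrow> L (c \<odot>\<^bsub>C\<^esub> X) = c * L X"
  by (simp_all add: bounded_functional_def)

lemma bounded_functional_bound:
  assumes "bounded_functional C L"
  obtains K where "K \<ge> 0" "\<And>X. X \<in> carrier C \<Longrightarrow> cmod (L X) \<le> K * nrm C X"
  using assms by (auto simp: bounded_functional_def)

lemma bounded_functional_mult_left:
  assumes L: "bounded_functional C L" and A: "A \<in> carrier C"
  shows "bounded_functional C (\<lambda>X. L (A \<otimes>\<^bsub>C\<^esub> X))"
proof -
  obtain K where K: "K \<ge> 0" "\<And>X. X \<in> carrier C \<Longrightarrow> cmod (L X) \<le> K * nrm C X"
    using bounded_functional_bound[OF L] by blast
  have "cmod (L (A \<otimes>\<^bsub>C\<^esub> X)) \<le> K * nrm C A * nrm C X" if X: "X \<in> carrier C" for X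
    using K(2)[OF carrier_closed(2)[OF A X]] mult_left_mono[OF nrm_mult_le[OF A X] K(1)] by simp
  then show ?thesis
    using K(1) nrm_nonneg[OF A] A L
    by (auto simp: bounded_functional_def[of _ "\<lambda>X. L (A \<otimes>\<^bsub>C\<^esub> X)"] mult_add_right mult_scale_right bounded_functional_add
        bounded_functional_scale intro!: exI[of _ "K * nrm C A"])
qed

lemma bounded_functional_mult_right:
  assumes L: "bounded_functional C L" and A: "A \<in> carrier C"
  shows "bounded_functional C (\<lambda>X. L (X \<otimes>\<^bsub>C\<^esub> A))"
proof -
  obtain K where K: "K \<ge> 0" "\<And>X. X \<in> carrier C \<Longrightarrow> cmod (L X) \<le> K * nrm C X"
    using bounded_functional_bound[OF L] by blast
  have "cmod (L (X \<otimes>\<^bsub>C\<^esub> A)) \<le> K * nrm C A * nrm C X" if X: "X \<in> carrier C" for X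
    using K(2)[OF carrier_closed(2)[OF X A]] mult_left_mono[OF nrm_mult_le[OF X A] K(1)]
    by (simp add: mult_ac)
  then show ?thesis
    using K(1) nrm_nonneg[OF A] A L
    by (auto simp: bounded_functional_def[of _ "\<lambda>X. L (X \<otimes>\<^bsub>C\<^esub> A)"] mult_add_left mult_scale_left bounded_functional_add
        bounded_functional_scale intro!: exI[of _ "K * nrm C A"])
qed

lemma bounded_functional_smul:
  assumes L: "bounded_functional C L"
  shows "bounded_functional C (\<lambda>X. c * L X)"
proof -
  obtain K where K: "K \<ge> 0" "\<And>X. X \<in> carrier C \<Longrightarrow> cmod (L X) \<le> K * nrm C X"
    using bounded_functional_bound[OF L] by blast
  have "cmod (c * L X) \<le> cmod c * K * nrm C X" if "X \<in> carrier C" for X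
    using mult_left_mono[OF K(2)[OF that], of "cmod c"] by (simp add: norm_mult mult.assoc)
  then show ?thesis using K(1) L
    by (auto simp: bounded_functional_def[of _ "\<lambda>X. c * L X"] bounded_functional_add bounded_functional_scale
        distrib_left mult.left_commute intro!: exI[of _ "cmod c * K"])
qed

lemma bounded_functional_hom:
  assumes L: "bounded_functional C L" and \<pi>: "star_hom C C \<pi>"
  shows "bounded_functional C (\<lambda>X. L (\<pi> X))"
proof -
  obtain K where K: "K \<ge> 0" "\<And>X. X \<in> carrier C \<Longrightarrow> cmod (L X) \<le> K * nrm C X"
    using bounded_functional_bound[OF L] by blast
  have c: "\<pi> X \<in> carrier C" if "X \<in> carrier C" for X using \<pi> that by (auto simp: star_hom_def)
  have "cmod (L (\<pi> X)) \<le> K * nrm C X" if X: "X \<in> carrier C" for X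
  proof -
    have "nrm C (\<pi> X) \<le> nrm C X" using \<pi> X by (simp add: star_hom_def)
    then show ?thesis using K(2)[OF c[OF X]] mult_left_mono[OF _ K(1)] by fastforce
  qed
  then show ?thesis using K(1) L \<pi> c
    by (auto simp: bounded_functional_def[of _ "\<lambda>X. L (\<pi> X)"] star_hom_def bounded_functional_add bounded_functional_scale)
qed

text \<open>A bounded functional carries norm convergence of difference quotients to convergence of
  complex ones, so questions about entire functions into the completion become scalar.\<close>

lemma entire_functional:
  assumes f: "entire C f" and L: "bounded_functional C L"
  shows "(\<lambda>z. L (f z)) holomorphic_on UNIV"
proof -
  obtain K where K: "K \<ge> 0" "\<And>X. X \<in> carrier C \<Longrightarrow> cmod (L X) \<le> K * nrm C X"
    using bounded_functional_bound[OF L] by blast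
  have c: "f z \<in> carrier C" for z using f by (simp add: entire_def)
  have "\<exists>D. ((\<lambda>z. L (f z)) has_field_derivative D) (at z)" for z
  proof -
    obtain D where D: "D \<in> carrier C"
      "((\<lambda>h. nrm C (diff C ((1 / h) \<odot>\<^bsub>C\<^esub> diff C (f (z + h)) (f z)) D)) \<longlongrightarrow> 0) (at 0)"
      using f unfolding entire_def by blast
    have "((\<lambda>h. (L (f (z + h)) - L (f z)) / h - L D) \<longlongrightarrow> 0) (at 0)"
    proof (rule Lim_null_comparison)
      show "((\<lambda>h. K * nrm C (diff C ((1 / h) \<odot>\<^bsub>C\<^esub> diff C (f (z + h)) (f z)) D)) \<longlongrightarrow> 0) (at 0)"
        using tendsto_mult_right_zero[OF D(2), of K] by simp
      have "cmod ((L (f (z + h)) - L (f z)) / h - L D) \<le>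
          K * nrm C (diff C ((1 / h) \<odot>\<^bsub>C\<^esub> diff C (f (z + h)) (f z)) D)" for h
      proof -
        have d: "diff C (f (z + h)) (f z) \<in> carrier C" using c by blast
        then have s: "(1 / h) \<odot>\<^bsub>C\<^esub> diff C (f (z + h)) (f z) \<in> carrier C" by blast
        have "(L (f (z + h)) - L (f z)) / h - L D = L (diff C ((1 / h) \<odot>\<^bsub>C\<^esub> diff C (f (z + h)) (f z)) D)"
          using c d s D(1) by (simp add: bounded_functional_diff[OF L] bounded_functional_scale[OF L])
        then show ?thesis using K(2)[OF carrier_closed(3)[OF s D(1)]] by simp
      qed
      then show "\<forall>\<^sub>F h in at 0. cmod ((L (f (z + h)) - L (f z)) / h - L D) \<le>
          K * nrm C (diff C ((1 / h) \<odot>\<^bsub>C\<^esub> diff C (f (z + h)) (f z)) D)" by simp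
    qed
    then have "((\<lambda>h. (L (f (z + h)) - L (f z)) / h) \<longlongrightarrow> L D) (at 0)" by (rule LIM_zero_cancel)
    then show ?thesis by (auto simp: DERIV_def)
  qed
  then show ?thesis by (auto simp: holomorphic_on_def field_differentiable_def)
qed

lemma scale_diff: "X \<in> carrier C \<Longrightarrow> diff C (a \<odot>\<^bsub>C\<^esub> X) (b \<odot>\<^bsub>C\<^esub> X) = (a - b) \<odot>\<^bsub>C\<^esub> X"
  by (elim carrier_cases) (simp add: scale_class diff_class cauchy_smul smul_diff_left)

lemma scale_scale: "X \<in> carrier C \<Longrightarrow> a \<odot>\<^bsub>C\<^esub> b \<odot>\<^bsub>C\<^esub> X = (a * b) \<odot>\<^bsub>C\<^esub> X"
  by (elim carrier_cases) (simp add: scale_class cauchy_smul smul_smul)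

text \<open>These are the orbits of eigenvectors of the dynamics; they provide the analytic
  extensions of generators and their adjoints.\<close>

lemma entire_exp:
  assumes X: "X \<in> carrier C"
  shows "entire C (\<lambda>z. exp (\<i> * z * k) \<odot>\<^bsub>C\<^esub> X)"
  unfolding entire_def
proof (intro conjI allI bexI)
  fix z
  let ?d = "\<i> * k * exp (\<i> * z * k)"
  have "((\<lambda>z. exp (\<i> * z * k)) has_field_derivative ?d) (at z)"
    by (auto intro!: derivative_eq_intros)
  then have "((\<lambda>h. (exp (\<i> * (z + h) * k) - exp (\<i> * z * k)) / h - ?d) \<longlongrightarrow> 0) (at 0)"
    by (simp add: DERIV_def LIM_zero)
  then have "((\<lambda>h. cmod ((exp (\<i> * (z + h) * k) - exp (\<i> * z * k)) / h - ?d) * nrm C X) \<longlongrightarrow> 0) (at 0)"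
    by (intro tendsto_mult_left_zero tendsto_norm_zero)
  moreover have "nrm C (diff C ((1 / h) \<odot>\<^bsub>C\<^esub> diff C (exp (\<i> * (z + h) * k) \<odot>\<^bsub>C\<^esub> X) (exp (\<i> * z * k) \<odot>\<^bsub>C\<^esub> X)) (?d \<odot>\<^bsub>C\<^esub> X)) =
      cmod ((exp (\<i> * (z + h) * k) - exp (\<i> * z * k)) / h - ?d) * nrm C X" for h
    using X by (simp add: scale_diff scale_scale nrm_scale)
  ultimately show "((\<lambda>h. nrm C (diff C ((1 / h) \<odot>\<^bsub>C\<^esub> diff C (exp (\<i> * (z + h) * k) \<odot>\<^bsub>C\<^esub> X) (exp (\<i> * z * k) \<odot>\<^bsub>C\<^esub> X))
      (?d \<odot>\<^bsub>C\<^esub> X))) \<longlongrightarrow> 0) (at 0)" by simp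
qed (use X in blast)+

section \<open>States on the completion\<close>

lemma state_bounded:
  assumes \<psi>: "state C \<psi>"
  shows "X \<in> carrier C \<Longrightarrow> cmod (\<psi> X) \<le> nrm C X" "bounded_functional C \<psi>"
proof -
  have scale: "\<psi> (c \<odot>\<^bsub>C\<^esub> X) = c * \<psi> X" if "X \<in> carrier C" for c X
    using \<psi> that unfolding state_def by blast
  have ball: "cmod (\<psi> X) \<le> 1" if "X \<in> carrier C" "nrm C X \<le> 1" for X
  proof -
    have "cmod (\<psi> X) \<le> (SUP x\<in>{x \<in> carrier C. nrm C x \<le> 1}. cmod (\<psi> x))"
      using \<psi> that unfolding state_def by (intro cSUP_upper) auto
    also have "\<dots> = 1" using \<psi> unfolding state_def by blast
    finally show ?thesis .
  qed
  have le: "cmod (\<psi> X) \<le> nrm C X" if X: "X \<in> carrier C" for X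
  proof (rule field_le_epsilon)
    fix e :: real assume e: "e > 0"
    \<comment> \<open>Adding e makes the normalising factor positive even for elements of norm
      0.\<close>
    define k where "k = nrm C X + e"
    have k: "k > 0" using e nrm_nonneg[OF X] by (simp add: k_def)
    have nk: "cmod (of_real (1 / k)) = 1 / k" using k by (simp only: norm_of_real) simp
    have "nrm C X \<le> k" using e by (simp add: k_def)
    then have "cmod (\<psi> (of_real (1 / k) \<odot>\<^bsub>C\<^esub> X)) \<le> 1"
      using X k by (intro ball) (auto simp only: nrm_scale nk carrier_closed, simp)
    then have "(1 / k) * cmod (\<psi> X) \<le> 1" by (simp only: scale[OF X] norm_mult nk)
    then show "cmod (\<psi> X) \<le> nrm C X + e" using k by (simp add: k_def)
  qed
  then show "X \<in> carrier C \<Longrightarrow> cmod (\<psi> X) \<le> nrm C X" .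
  have add: "\<psi> (X \<oplus>\<^bsub>C\<^esub> Y) = \<psi> X + \<psi> Y" if "X \<in> carrier C" "Y \<in> carrier C" for X Y
    using \<psi> that unfolding state_def by blast
  show "bounded_functional C \<psi>"
    unfolding bounded_functional_def using le add scale by (auto intro!: exI[of _ "1::real"])
qed

lemma state_positive:
  assumes "state C \<psi>" "x \<in> polys G"
  shows "\<psi> (emb (padj x * x)) \<in> \<real>\<^sub>\<ge>\<^sub>0"
proof -
  have "emb (padj x * x) = adj C (emb x) \<otimes>\<^bsub>C\<^esub> emb x" "emb x \<in> carrier C" "emb (padj x * x) \<in> carrier C"
    using assms(2) by (auto simp: emb_adj emb_mult)
  then have "positive C (emb (padj x * x))" "emb (padj x * x) \<in> carrier C" unfolding positive_def by blast+
  then show ?thesis using assms(1) unfolding state_def by blast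
qed

text \<open>The element \<open>e\<close> attains the norm: it lies in the unit ball and has value 1,
  while domination bounds all other values there by 1. Positivity passes to the limit because the
  nonnegative reals are closed.\<close>

lemma state_ext_functional:
  assumes g: "dominated_functional G p g" and pos: "\<And>x. x \<in> polys G \<Longrightarrow> g (padj x * x) \<in> \<real>\<^sub>\<ge>\<^sub>0"
    and e: "e \<in> polys G" "p e \<le> 1" "g e = 1"
  shows "state C (ext_functional G p g)"
  unfolding state_def
proof (intro conjI ballI allI impI)
  let ?\<phi> = "ext_functional G p g"
  note L = ext_functional_bounded[OF g]
  show "?\<phi> \<in> extensional (carrier C)" by (simp add: ext_functional_def)
  show "?\<phi> (X \<oplus>\<^bsub>C\<^esub> Y) = ?\<phi> X + ?\<phi> Y" if "X \<in> carrier C" "Y \<in> carrier C" for X Y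
    using that by (rule bounded_functional_add[OF L])
  show "?\<phi> (c \<odot>\<^bsub>C\<^esub> X) = c * ?\<phi> X" if "X \<in> carrier C" for c X
    using that by (rule bounded_functional_scale[OF L])
  show "?\<phi> X \<in> \<real>\<^sub>\<ge>\<^sub>0" if X: "X \<in> carrier C \<and> positive C X" for X
  proof -
    obtain B where B: "B \<in> carrier C" "X = adj C B \<otimes>\<^bsub>C\<^esub> B" using X unfolding positive_def by blast
    obtain b where b: "b \<in> cauchy_seqs F" "B = seq_class F b" using B(1) by (rule carrier_cases)
    have X': "X = seq_class F (\<lambda>n. padj (b n) * b n)"
      using B(2) b by (simp add: adj_class mult_class cauchy_padj)
    show ?thesis unfolding X'
      by (rule Lim_in_closed_set[OF closed_nonneg_Reals_complex _ _
            ext_functional_lim[OF g cauchy_mult[OF cauchy_padj[OF b(1)] b(1)]]])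
        (use pos b(1) in \<open>auto intro!: always_eventually intro: cauchy_polys\<close>)
  qed
  have le: "cmod (?\<phi> X) \<le> 1" if "X \<in> {x \<in> carrier C. nrm C x \<le> 1}" for X
    using ext_functional_le[OF g, of X] that by auto
  show "bdd_above ((\<lambda>x. cmod (?\<phi> x)) ` {x \<in> carrier C. nrm C x \<le> 1})"
    using le by (intro bdd_aboveI2) auto
  show "(SUP x\<in>{x \<in> carrier C. nrm C x \<le> 1}. cmod (?\<phi> x)) = 1"
  proof (rule cSup_eq_maximum)
    have "emb e \<in> {x \<in> carrier C. nrm C x \<le> 1}" "cmod (?\<phi> (emb e)) = 1"
      using e by (auto simp: emb_nrm ext_functional_emb[OF g])
    then show "1 \<in> (\<lambda>x. cmod (?\<phi> x)) ` {x \<in> carrier C. nrm C x \<le> 1}"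
      by (intro image_eqI[of _ _ "emb e"]) simp_all
  qed (use le in auto)
qed

end

text \<open>The identity theorem: the real line has a limit point.\<close>

lemma entire_eq_on_reals:
  assumes "f holomorphic_on UNIV" "g holomorphic_on UNIV"
    and "\<And>t::real. f (of_real t) = g (of_real t)"
  shows "f z = g z"
proof -
  have "(0::complex) islimpt \<real>"
    unfolding islimpt_approachable
  proof (intro allI impI)
    fix e :: real assume "e > 0"
    then show "\<exists>x'\<in>\<real>. x' \<noteq> 0 \<and> dist x' (0::complex) < e"
      by (intro bexI[of _ "of_real (e / 2)"]) auto
  qed
  moreover have "(\<lambda>z. f z - g z) holomorphic_on UNIV" using assms by (intro holomorphic_on_diff)
  moreover have "f z - g z = 0" if "z \<in> \<real>" for z using that assms(3) by (auto elim!: Reals_cases)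
  ultimately have "f z - g z = 0"
    by (intro analytic_continuation[of "\<lambda>z. f z - g z" UNIV \<real> 0 z]) auto
  then show ?thesis by simp
qed

section \<open>The dynamics of the Toeplitz algebra\<close>

locale toeplitz_system = two_graph \<Lambda> for \<Lambda> :: "'p two_graph_data" +
  fixes r :: "real \<times> real"
  assumes min_exts_finite: "\<mu> \<in> paths \<Lambda> \<Longrightarrow> \<nu> \<in> paths \<Lambda> \<Longrightarrow> finite (min_ext \<Lambda> \<mu> \<nu>)"
    and deg_weight_inj: "deg_weight r m = deg_weight r n \<Longrightarrow> m = n"
begin

abbreviation "N \<equiv> toeplitz_norm \<Lambda>"

sublocale T: toeplitz_seminormed \<Lambda> "toeplitz_norm \<Lambda>"
  by (rule toeplitz_norm_seminormed)

lemma toeplitz_algebra_eq: "toeplitz_algebra \<Lambda> = T.C"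
  by (simp add: toeplitz_algebra_def toeplitz_free_eq)

lemma toeplitz_gen_eq: "toeplitz_gen \<Lambda> \<mu> = T.emb (gen \<mu>)"
  by (simp add: toeplitz_gen_def toeplitz_free_eq)

definition W :: "'p \<Rightarrow> real" where "W \<kappa> = deg_weight r (deg \<Lambda> \<kappa>)"

definition gauge :: "real \<Rightarrow> 'p \<Rightarrow> complex" where
  "gauge t \<kappa> = exp (\<i> * of_real (t * W \<kappa>))"

lemma gauge_cnj: "gauge t \<kappa> * cnj (gauge t \<kappa>) = 1" "cnj (gauge t \<kappa>) = exp (- (\<i> * of_real (t * W \<kappa>)))"
  by (simp_all add: gauge_def exp_cnj exp_minus)

lemma gauge_cocycle: "cocycle \<Lambda> (gauge t)"
proof
  fix \<kappa> assume "\<kappa> \<in> paths \<Lambda>"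
  then show "gauge t (src \<Lambda> \<kappa>) = gauge t \<kappa> * cnj (gauge t \<kappa>)"
    using gauge_cnj(1)[of t \<kappa>] deg_src[of \<kappa>] by (simp add: gauge_def W_def deg_weight_def)
qed (auto simp: gauge_def W_def deg_comp deg_weight_add min_exts_finite exp_add[symmetric] algebra_simps)

lemma gauge_support: "cocycle.support \<Lambda> (gauge t) = \<Lambda>"
  unfolding cocycle.support_def[OF gauge_cocycle] by (simp add: gauge_def)

lemma gauge_hom: "contractive_hom (paths \<Lambda>) N (paths \<Lambda>) N (twist (gauge t))"
proof -
  interpret cocycle \<Lambda> "gauge t" by (rule gauge_cocycle)
  show ?thesis using contractive_hom_twist by (simp only: gauge_support)
qed

definition dyn :: "real \<Rightarrow> (nat \<Rightarrow> 'p star_poly) set \<Rightarrow> (nat \<Rightarrow> 'p star_poly) set" where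
  "dyn t = ext_hom (paths \<Lambda>) N (paths \<Lambda>) N (twist (gauge t))"

lemma dyn_hom: "star_hom T.C T.C (dyn t)"
  unfolding dyn_def by (rule contractive_hom.star_hom_ext[OF gauge_hom])

lemma dyn_emb: "x \<in> polys (paths \<Lambda>) \<Longrightarrow> dyn t (T.emb x) = T.emb (twist (gauge t) x)"
  unfolding dyn_def by (rule contractive_hom.ext_emb[OF gauge_hom])

lemma dyn_inverse: "X \<in> carrier T.C \<Longrightarrow> dyn t (dyn (- t) X) = X"
proof (elim T.carrier_cases, hypsubst)
  fix x assume x: "x \<in> cauchy_seqs T.F"
  have "gauge t \<kappa> * gauge (- t) \<kappa> = 1" for \<kappa> by (simp add: gauge_def exp_minus)
  then show "dyn t (dyn (- t) (seq_class T.F x)) = seq_class T.F x"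
    unfolding dyn_def
    using contractive_hom.ext_class[OF gauge_hom x, of "- t"]
      contractive_hom.ext_class[OF gauge_hom contractive_hom.h_cauchy[OF gauge_hom x], of t "- t"]
    by (simp add: twist_twist)
qed

lemma gauge_gen_adj:
  "gauge t \<mu> * cnj (gauge t \<nu>) = exp (\<i> * of_real (t * (W \<mu> - W \<nu>)))"
  unfolding gauge_cnj(2) by (simp add: gauge_def exp_add[symmetric] algebra_simps)

text \<open>The extended gauge twist meets the description, its inverse being the twist for the
  opposite time. Any other candidate agrees with it on the spanning elements, hence
  everywhere.\<close>

lemma toeplitz_dynamics_eq: "toeplitz_dynamics \<Lambda> r t = dyn t"
  unfolding toeplitz_dynamics_def Let_def toeplitz_algebra_eq toeplitz_gen_eq
proof (rule the_equality)
  have "dyn t (T.emb (gen \<mu>) \<otimes>\<^bsub>T.C\<^esub> adj T.C (T.emb (gen \<nu>))) =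
      exp (\<i> * of_real (t * (W \<mu> - W \<nu>))) \<odot>\<^bsub>T.C\<^esub> (T.emb (gen \<mu>) \<otimes>\<^bsub>T.C\<^esub> adj T.C (T.emb (gen \<nu>)))"
    if "\<mu> \<in> paths \<Lambda>" "\<nu> \<in> paths \<Lambda>" for \<mu> \<nu>
    using that by (simp add: T.emb_adj T.emb_mult T.emb_scale dyn_emb twist_gen_adj gauge_gen_adj)
  moreover have "bij_betw (dyn t) (carrier T.C) (carrier T.C)"
  proof (rule bij_betwI)
    have *: "dyn s \<in> carrier T.C \<rightarrow> carrier T.C" for s using dyn_hom[of s] by (auto simp: star_hom_def)
    show "dyn t \<in> carrier T.C \<rightarrow> carrier T.C" "dyn (- t) \<in> carrier T.C \<rightarrow> carrier T.C" by (rule *)+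
    show "dyn (- t) (dyn t X) = X" if "X \<in> carrier T.C" for X
      using dyn_inverse[OF that, of "- t"] by simp
  qed (rule dyn_inverse)
  ultimately show "star_hom T.C T.C (dyn t) \<and> bij_betw (dyn t) (carrier T.C) (carrier T.C) \<and>
      (\<forall>\<mu>\<in>paths \<Lambda>. \<forall>\<nu>\<in>paths \<Lambda>. dyn t (T.emb (gen \<mu>) \<otimes>\<^bsub>T.C\<^esub> adj T.C (T.emb (gen \<nu>))) =
        exp (\<i> * of_real (t * (deg_weight r (deg \<Lambda> \<mu>) - deg_weight r (deg \<Lambda> \<nu>)))) \<odot>\<^bsub>T.C\<^esub>
          (T.emb (gen \<mu>) \<otimes>\<^bsub>T.C\<^esub> adj T.C (T.emb (gen \<nu>))))"
    using dyn_hom by (simp add: W_def)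
  then have formula: "\<forall>\<mu>\<in>paths \<Lambda>. \<forall>\<nu>\<in>paths \<Lambda>. dyn t (T.emb (gen \<mu>) \<otimes>\<^bsub>T.C\<^esub> adj T.C (T.emb (gen \<nu>))) =
        exp (\<i> * of_real (t * (deg_weight r (deg \<Lambda> \<mu>) - deg_weight r (deg \<Lambda> \<nu>)))) \<odot>\<^bsub>T.C\<^esub>
          (T.emb (gen \<mu>) \<otimes>\<^bsub>T.C\<^esub> adj T.C (T.emb (gen \<nu>)))" by blast
  fix \<alpha> assume \<alpha>: "star_hom T.C T.C \<alpha> \<and> bij_betw \<alpha> (carrier T.C) (carrier T.C) \<and>
      (\<forall>\<mu>\<in>paths \<Lambda>. \<forall>\<nu>\<in>paths \<Lambda>. \<alpha> (T.emb (gen \<mu>) \<otimes>\<^bsub>T.C\<^esub> adj T.C (T.emb (gen \<nu>))) =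
        exp (\<i> * of_real (t * (deg_weight r (deg \<Lambda> \<mu>) - deg_weight r (deg \<Lambda> \<nu>)))) \<odot>\<^bsub>T.C\<^esub>
          (T.emb (gen \<mu>) \<otimes>\<^bsub>T.C\<^esub> adj T.C (T.emb (gen \<nu>))))"
  show "\<alpha> = dyn t"
    by (rule T.star_hom_eq_on_span[OF T.cstar_seminormed_axioms])
      (use \<alpha> dyn_hom formula in auto)
qed

lemma dynamics_eq: "toeplitz_dynamics \<Lambda> r = dyn"
  by (rule ext) (rule toeplitz_dynamics_eq)

lemma analytic_extension_emb:
  assumes x: "x \<in> polys (paths \<Lambda>)" and "\<And>t. twist (gauge t) x = exp (\<i> * of_real t * of_real k) \<cdot> x"
  shows "analytic_extension T.C dyn (T.emb x) (\<lambda>z. exp (\<i> * z * of_real k) \<odot>\<^bsub>T.C\<^esub> T.emb x)"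
  unfolding analytic_extension_def using assms T.entire_exp[of "T.emb x" "of_real k"]
  by (auto simp: dyn_emb T.emb_scale)

lemma twist_gauge_gen: "twist (gauge t) (gen \<kappa>) = exp (\<i> * of_real t * of_real (W \<kappa>)) \<cdot> gen \<kappa>"
  by (simp add: twist_gen gauge_def mult.assoc)

lemma twist_gauge_padj_gen:
  "twist (gauge t) (padj (gen \<kappa>)) = exp (\<i> * of_real t * of_real (- W \<kappa>)) \<cdot> padj (gen \<kappa>)"
  by (simp add: twist_gen twist_padj padj_smul gauge_cnj(2) mult.assoc)

subsection \<open>Uniqueness\<close>

text \<open>Use the KMS condition for the pair t_\<mu>, t_\<nu>^* and for the pair in reverse.
  Continuation to the point \<i> multiplies t_\<mu> by e^(-W \<mu>) and t_\<nu>^* by e^(W \<nu>), so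
  the value is reproduced with factor e^(W \<nu> - W \<mu>) and vanishes unless the degrees agree.
  For equal degrees t_\<nu>^* t_\<mu> is 0 or a vertex projection.\<close>

lemma kms_values:
  assumes kms: "kms_state T.C dyn 1 \<psi>" and \<mu>: "\<mu> \<in> paths \<Lambda>" and \<nu>: "\<nu> \<in> paths \<Lambda>"
  shows "\<psi> (T.emb (gen \<mu> * padj (gen \<nu>))) =
    (if \<mu> = \<nu> then of_real (exp (- W \<mu>)) * \<psi> (T.emb (gen (src \<Lambda> \<mu>))) else 0)"
proof -
  have \<psi>: "state T.C \<psi>" using kms by (simp add: kms_state_def)
  note L = T.state_bounded(2)[OF \<psi>]
  let ?A = "\<psi> (T.emb (gen \<mu> * padj (gen \<nu>)))" and ?B = "\<psi> (T.emb (padj (gen \<nu>) * gen \<mu>))"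
  note ext\<mu> = analytic_extension_emb[OF T.gen_closed[OF \<mu>] twist_gauge_gen]
  note ext\<nu> = analytic_extension_emb[OF padj_polys[OF T.gen_closed[OF \<nu>]] twist_gauge_padj_gen]
  have kms': "\<psi> (a \<otimes>\<^bsub>T.C\<^esub> b) = \<psi> (b \<otimes>\<^bsub>T.C\<^esub> f (\<i> * of_real 1))"
    if "analytic_extension T.C dyn a f" "analytic_extension T.C dyn b g" for a b f g
    using kms that unfolding kms_state_def analytic_element_def by blast
  have A: "?A = of_real (exp (- W \<mu>)) * ?B"
    using kms'[OF ext\<mu> ext\<nu>] \<mu> \<nu>
    by (simp add: T.emb_mult T.emb_scale mult_smul[of "padj (gen \<nu>)"])
      (simp add: T.emb_scale[symmetric] T.bounded_functional_scale[OF L] exp_of_real[symmetric])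
  have B: "?B = of_real (exp (W \<nu>)) * ?A"
    using kms'[OF ext\<nu> ext\<mu>] \<mu> \<nu>
    by (simp add: T.emb_mult T.emb_scale mult_smul[of "gen \<mu>"])
      (simp add: T.emb_scale[symmetric] T.bounded_functional_scale[OF L] exp_of_real[symmetric])
  have emb_eqv: "\<psi> (T.emb x) = \<psi> (T.emb y)" if "T.eqv x y" for x y
    using that T.emb_eq_iff_eqv[of x y] T.eqv_polys[of x y] by simp
  have zero: "\<psi> (T.emb 0) = 0"
    using T.bounded_functional_scale[OF L, of "T.emb 0" 0] by (simp add: T.emb_scale)
  show ?thesis
  proof (cases "\<mu> = \<nu>")
    case True
    then show ?thesis using A emb_eqv[OF T.gen_adj_gen[OF \<mu>]] by simp
  next
    case False
    have "?A = 0"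
    proof (cases "deg \<Lambda> \<mu> = deg \<Lambda> \<nu>")
      case True
      then show ?thesis using A zero emb_eqv[OF T.gen_adj_gen_zero[OF \<nu> \<mu>]] False by simp
    next
      case False
      then have "W \<mu> \<noteq> W \<nu>" using deg_weight_inj[of "deg \<Lambda> \<mu>" "deg \<Lambda> \<nu>"] by (auto simp: W_def)
      moreover have "?A = of_real (exp (W \<nu> - W \<mu>)) * ?A"
        using A B by (simp add: exp_diff exp_minus field_simps exp_of_real)
      then have "of_real (exp (W \<nu> - W \<mu>) - 1) * ?A = 0" by (simp add: algebra_simps)
      ultimately show ?thesis by simp
    qed
    then show ?thesis using False by simp
  qed
qed

lemma vertex_value_nonneg:
  assumes "state T.C \<psi>" and z: "z \<in> paths_deg \<Lambda> 0"
  shows "\<psi> (T.emb (gen z)) \<in> \<real>\<^sub>\<ge>\<^sub>0"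
proof -
  have zp: "z \<in> paths \<Lambda>" using z by (simp add: paths_deg_def)
  have "T.emb (padj (gen z) * gen z) = T.emb (gen z)"
    using T.gen_adj_gen[OF zp] vertex_rng_src[OF z] zp by (simp add: T.emb_eq_iff_eqv)
  then show ?thesis using T.state_positive[OF assms(1) T.gen_closed[OF zp]] by simp
qed

text \<open>The values on spanning elements give \<psi> = c \<phi> with c = \<psi>(t_u). The norm of
  t_u is at most 1, so |c| \<le> 1; \<psi> has norm 1 and |\<phi>| \<le> 1 on the unit ball, so |c|
  \<ge> 1; positivity then gives c = 1.\<close>

lemma kms_unique:
  assumes \<psi>: "kms_state T.C dyn 1 \<psi>" and \<phi>: "kms_state T.C dyn 1 \<phi>"
    and u: "u \<in> paths_deg \<Lambda> 0" and one: "\<phi> (T.emb (gen u)) = 1"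
    and other: "\<And>z. z \<in> paths_deg \<Lambda> 0 \<Longrightarrow> z \<noteq> u \<Longrightarrow> \<psi> (T.emb (gen z)) = 0 \<and> \<phi> (T.emb (gen z)) = 0"
  shows "\<psi> = \<phi>"
proof -
  have s\<psi>: "state T.C \<psi>" and s\<phi>: "state T.C \<phi>" using \<psi> \<phi> by (simp_all add: kms_state_def)
  have up: "u \<in> paths \<Lambda>" using u by (simp add: paths_deg_def)
  define c where "c = \<psi> (T.emb (gen u))"
  have vertex: "\<psi> (T.emb (gen z)) = c * \<phi> (T.emb (gen z))" if "z \<in> paths_deg \<Lambda> 0" for z
    using other[OF that] one by (cases "z = u") (auto simp: c_def)
  have eq: "\<psi> X = c * \<phi> X" if "X \<in> carrier T.C" for X
  proof (rule T.bounded_functional_eq_on_span[OF T.state_bounded(2)[OF s\<psi>]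
        T.bounded_functional_smul[OF T.state_bounded(2)[OF s\<phi>]] _ that])
    fix \<mu> \<nu> assume "\<mu> \<in> paths \<Lambda>" "\<nu> \<in> paths \<Lambda>"
    then show "\<psi> (T.emb (gen \<mu>) \<otimes>\<^bsub>T.C\<^esub> adj T.C (T.emb (gen \<nu>))) =
        c * \<phi> (T.emb (gen \<mu>) \<otimes>\<^bsub>T.C\<^esub> adj T.C (T.emb (gen \<nu>)))"
      using vertex[OF src_vertex[of \<mu>]]
      by (auto simp: T.emb_adj T.emb_mult kms_values[OF \<psi>] kms_values[OF \<phi>])
  qed
  have "cmod c \<le> 1"
    using T.state_bounded(1)[OF s\<psi>, of "T.emb (gen u)"] T.norm_gen_le[OF up] up by (simp add: c_def T.emb_nrm)
  moreover have "1 \<le> cmod c"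
  proof -
    have "(SUP x\<in>{x \<in> carrier T.C. nrm T.C x \<le> 1}. cmod (\<psi> x)) \<le> cmod c"
    proof (rule cSUP_least)
      have "T.emb 0 \<in> {x \<in> carrier T.C. nrm T.C x \<le> 1}" by (simp add: T.emb_nrm)
      then show "{x \<in> carrier T.C. nrm T.C x \<le> 1} \<noteq> {}" by blast
    next
      fix X assume X: "X \<in> {x \<in> carrier T.C. nrm T.C x \<le> 1}"
      then have "cmod (\<phi> X) \<le> 1" using T.state_bounded(1)[OF s\<phi>, of X] by auto
      then show "cmod (\<psi> X) \<le> cmod c" using eq[of X] X by (simp add: norm_mult mult_left_le)
    qed
    then show ?thesis using s\<psi> by (simp add: state_def)
  qed
  moreover have "c \<in> \<real>\<^sub>\<ge>\<^sub>0" unfolding c_def by (rule vertex_value_nonneg[OF s\<psi> u])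
  ultimately have "c = 1" by (auto elim!: nonneg_Reals_cases)
  moreover have "\<psi> \<in> extensional (carrier T.C)" "\<phi> \<in> extensional (carrier T.C)"
    using s\<psi> s\<phi> by (simp_all add: state_def)
  ultimately show ?thesis using eq by (intro extensionalityI) auto
qed

subsection \<open>Existence\<close>

text \<open>The hypotheses give twisted commutation with generators only, whereas the KMS condition
  speaks of an arbitrary entire extension f of an orbit. The gap is closed by testing f against a
  spanning element y: invariance determines the scalar function on the real line, hence at
  \<i>.\<close>

lemma kms_of_functional:
  assumes g: "dominated_functional (paths \<Lambda>) N g"
    and pos: "\<And>x. x \<in> polys (paths \<Lambda>) \<Longrightarrow> g (padj x * x) \<in> \<real>\<^sub>\<ge>\<^sub>0"
    and herm: "\<And>x. x \<in> polys (paths \<Lambda>) \<Longrightarrow> g (padj x) = cnj (g x)"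
    and u: "u \<in> paths \<Lambda>" "g (gen u) = 1"
    and comm: "\<And>\<kappa> x. \<kappa> \<in> paths \<Lambda> \<Longrightarrow> x \<in> polys (paths \<Lambda>) \<Longrightarrow> g (x * gen \<kappa>) = of_real (exp (W \<kappa>)) * g (gen \<kappa> * x)"
  shows "kms_state T.C dyn 1 (ext_functional (paths \<Lambda>) N g)"
proof -
  let ?\<phi> = "ext_functional (paths \<Lambda>) N g"
  note L = T.ext_functional_bounded[OF g]
  have comm_adj: "g (x * padj (gen \<kappa>)) = of_real (exp (- W \<kappa>)) * g (padj (gen \<kappa>) * x)"
    if "\<kappa> \<in> paths \<Lambda>" "x \<in> polys (paths \<Lambda>)" for \<kappa> x
  proof -
    have "g (padj x * gen \<kappa>) = of_real (exp (W \<kappa>)) * g (gen \<kappa> * padj x)"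
      using that by (intro comm) auto
    then have "cnj (g (padj x * gen \<kappa>)) = of_real (exp (W \<kappa>)) * cnj (g (gen \<kappa> * padj x))"
      by simp
    then have "g (padj (gen \<kappa>) * x) = of_real (exp (W \<kappa>)) * g (x * padj (gen \<kappa>))"
      using that herm[of "padj x * gen \<kappa>"] herm[of "gen \<kappa> * padj x"] by (simp add: padj_mult)
    then show ?thesis by (simp add: exp_minus exp_of_real field_simps)
  qed
  \<comment> \<open>First the adjoint factor and then the generator is moved around the functional;
    each contributes its own exponential.\<close>
  have span_comm: "?\<phi> (X \<otimes>\<^bsub>T.C\<^esub> T.emb (gen \<sigma> * padj (gen \<tau>))) =
      of_real (exp (W \<sigma> - W \<tau>)) * ?\<phi> (T.emb (gen \<sigma> * padj (gen \<tau>)) \<otimes>\<^bsub>T.C\<^esub> X)"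
    if st: "\<sigma> \<in> paths \<Lambda>" "\<tau> \<in> paths \<Lambda>" and X: "X \<in> carrier T.C" for \<sigma> \<tau> X
  proof (rule T.bounded_functional_eqI[OF T.bounded_functional_mult_right[OF L]
        T.bounded_functional_smul[OF T.bounded_functional_mult_left[OF L]] _ X])
    fix x assume x: "x \<in> polys (paths \<Lambda>)"
    have "g (x * gen \<sigma> * padj (gen \<tau>)) = of_real (exp (- W \<tau>)) * g (padj (gen \<tau>) * x * gen \<sigma>)"
      using comm_adj[of \<tau> "x * gen \<sigma>"] st x by (simp add: mult.assoc)
    also have "\<dots> = of_real (exp (- W \<tau>)) * (of_real (exp (W \<sigma>)) * g (gen \<sigma> * padj (gen \<tau>) * x))"
      using comm[of \<sigma> "padj (gen \<tau>) * x"] st x by (simp add: mult.assoc)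
    finally have "g (x * gen \<sigma> * padj (gen \<tau>)) = of_real (exp (W \<sigma> - W \<tau>)) * g (gen \<sigma> * padj (gen \<tau>) * x)"
      by (simp add: exp_diff exp_minus exp_of_real field_simps)
    then show "?\<phi> (T.emb x \<otimes>\<^bsub>T.C\<^esub> T.emb (gen \<sigma> * padj (gen \<tau>))) =
        of_real (exp (W \<sigma> - W \<tau>)) * ?\<phi> (T.emb (gen \<sigma> * padj (gen \<tau>)) \<otimes>\<^bsub>T.C\<^esub> T.emb x)"
      using st x by (simp add: T.emb_mult T.ext_functional_emb[OF g] mult.assoc)
  qed (use st in auto)
  \<comment> \<open>Moving both factors around returns the same value times e^(W \<mu> - W \<nu>),
    so the value is 0 unless the two weights agree; in that case the gauge phase is 1.\<close>
  have invariant: "?\<phi> (dyn t X) = ?\<phi> X" if "X \<in> carrier T.C" for t X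
  proof (rule T.bounded_functional_eq_on_span[OF T.bounded_functional_hom[OF L dyn_hom] L _ that])
    fix \<mu> \<nu> assume *: "\<mu> \<in> paths \<Lambda>" "\<nu> \<in> paths \<Lambda>"
    let ?g = "g (gen \<mu> * padj (gen \<nu>))"
    have "?g = of_real (exp (- W \<nu>)) * g (padj (gen \<nu>) * gen \<mu>)"
      using comm_adj[of \<nu> "gen \<mu>"] * by simp
    also have "\<dots> = of_real (exp (- W \<nu>)) * (of_real (exp (W \<mu>)) * ?g)"
      using comm[of \<mu> "padj (gen \<nu>)"] * by simp
    also have "\<dots> = of_real (exp (W \<mu> - W \<nu>)) * ?g"
      by (simp add: exp_diff exp_minus exp_of_real divide_inverse mult_ac)
    finally have "?g = of_real (exp (W \<mu> - W \<nu>)) * ?g" .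
    then have "of_real (exp (W \<mu> - W \<nu>) - 1) * ?g = 0" by (simp add: algebra_simps)
    then have "W \<mu> = W \<nu> \<or> ?g = 0" by simp
    then have "exp (\<i> * of_real (t * (W \<mu> - W \<nu>))) * ?g = ?g" by auto
    moreover have "g (c \<cdot> x) = c * g x" if "x \<in> polys (paths \<Lambda>)" for c x
      using g that by (simp add: dominated_functional_def)
    ultimately show "?\<phi> (dyn t (T.emb (gen \<mu>) \<otimes>\<^bsub>T.C\<^esub> adj T.C (T.emb (gen \<nu>)))) =
        ?\<phi> (T.emb (gen \<mu>) \<otimes>\<^bsub>T.C\<^esub> adj T.C (T.emb (gen \<nu>)))"
      using * by (simp add: T.emb_adj T.emb_mult dyn_emb twist_gen_adj gauge_gen_adj T.ext_functional_emb[OF g]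
          del: of_real_mult of_real_diff)
  qed
  have "state T.C ?\<phi>"
    by (rule T.state_ext_functional[OF g pos, of "gen u"]) (use u T.norm_gen_le in auto)
  moreover have "?\<phi> (a \<otimes>\<^bsub>T.C\<^esub> b) = ?\<phi> (b \<otimes>\<^bsub>T.C\<^esub> f (\<i> * of_real 1))"
    if f: "analytic_extension T.C dyn a f" and b: "b \<in> carrier T.C" for a b f
  proof -
    have a: "a \<in> carrier T.C" and ent: "entire T.C f" and f_real: "\<And>t. f (of_real t) = dyn t a"
      and fc: "\<And>z. f z \<in> carrier T.C"
      using f by (auto simp: analytic_extension_def entire_def)
    show ?thesis
    proof (rule T.bounded_functional_eq_on_span[OF T.bounded_functional_mult_left[OF L a]
          T.bounded_functional_mult_right[OF L fc] _ b])
      fix \<sigma> \<tau> assume st: "\<sigma> \<in> paths \<Lambda>" "\<tau> \<in> paths \<Lambda>"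
      define y where "y = T.emb (gen \<sigma> * padj (gen \<tau>))"
      have y: "y \<in> carrier T.C" using st by (auto simp: y_def)
      define w where "w = W \<sigma> - W \<tau>"
      have dy: "dyn t y = exp (\<i> * of_real (t * w)) \<odot>\<^bsub>T.C\<^esub> y" for t
        using st by (simp add: y_def w_def dyn_emb twist_gen_adj gauge_gen_adj T.emb_scale)
      \<comment> \<open>At real t invariance gives the value at y a as that at (dyn t y)(dyn t a),
        and dyn t y is a phase times y.\<close>
      have "?\<phi> (y \<otimes>\<^bsub>T.C\<^esub> f z) = exp (- (\<i> * z * of_real w)) * ?\<phi> (y \<otimes>\<^bsub>T.C\<^esub> a)" for z
      proof (rule entire_eq_on_reals[of "\<lambda>z. ?\<phi> (y \<otimes>\<^bsub>T.C\<^esub> f z)"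
            "\<lambda>z. exp (- (\<i> * z * of_real w)) * ?\<phi> (y \<otimes>\<^bsub>T.C\<^esub> a)"])
        show "(\<lambda>z. ?\<phi> (y \<otimes>\<^bsub>T.C\<^esub> f z)) holomorphic_on UNIV"
          by (rule T.entire_functional[OF ent T.bounded_functional_mult_left[OF L y]])
        show "(\<lambda>z. exp (- (\<i> * z * of_real w)) * ?\<phi> (y \<otimes>\<^bsub>T.C\<^esub> a)) holomorphic_on UNIV"
          by (intro holomorphic_intros)
        fix t :: real
        have d: "dyn t a \<in> carrier T.C" using fc[of "of_real t"] by (simp add: f_real)
        have "?\<phi> (y \<otimes>\<^bsub>T.C\<^esub> a) = ?\<phi> (dyn t (y \<otimes>\<^bsub>T.C\<^esub> a))"
          using y a by (intro invariant[symmetric]) auto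
        also have "dyn t (y \<otimes>\<^bsub>T.C\<^esub> a) = dyn t y \<otimes>\<^bsub>T.C\<^esub> dyn t a"
          using dyn_hom[of t] y a by (simp add: star_hom_def)
        also have "?\<phi> \<dots> = exp (\<i> * of_real (t * w)) * ?\<phi> (y \<otimes>\<^bsub>T.C\<^esub> dyn t a)"
          using y d by (simp add: dy T.mult_scale_left T.bounded_functional_scale[OF L] del: of_real_mult)
        finally show "?\<phi> (y \<otimes>\<^bsub>T.C\<^esub> f (of_real t)) = exp (- (\<i> * of_real t * of_real w)) * ?\<phi> (y \<otimes>\<^bsub>T.C\<^esub> a)"
          by (simp add: f_real exp_minus mult.assoc)
      qed
      \<comment> \<open>At the point \<i> the factor e^(-\<i> z w) equals e^w, the very factor
        produced by moving y around in \<open>span_comm\<close>.\<close>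
      from this[of "\<i> * of_real 1"] have "?\<phi> (y \<otimes>\<^bsub>T.C\<^esub> f (\<i> * of_real 1)) = of_real (exp w) * ?\<phi> (y \<otimes>\<^bsub>T.C\<^esub> a)"
        by (simp add: exp_of_real)
      also have "\<dots> = ?\<phi> (a \<otimes>\<^bsub>T.C\<^esub> y)"
        using span_comm[OF st a] by (simp add: y_def w_def)
      finally show "?\<phi> (a \<otimes>\<^bsub>T.C\<^esub> (T.emb (gen \<sigma>) \<otimes>\<^bsub>T.C\<^esub> adj T.C (T.emb (gen \<tau>)))) =
          ?\<phi> ((T.emb (gen \<sigma>) \<otimes>\<^bsub>T.C\<^esub> adj T.C (T.emb (gen \<tau>))) \<otimes>\<^bsub>T.C\<^esub> f (\<i> * of_real 1))"
        using st by (simp add: y_def T.emb_adj T.emb_mult)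
    qed
  qed
  ultimately show ?thesis
    by (auto simp: kms_state_def analytic_element_def analytic_extension_def)
qed

end

section \<open>Vanishing at the removed vertex in the critical case\<close>

context toeplitz_system
begin

text \<open>At a critical degree the paths from u to u already use up all of \<psi>(t_u), so the gap
  projection has value -k \<psi>(t_v) with k > 0. This is nonnegative, and so is
  \<psi>(t_v).\<close>

lemma kms_critical_vanish:
  assumes kms: "kms_state T.C dyn 1 \<psi>"
    and vertices: "paths_deg \<Lambda> 0 = {u, v}" "u \<noteq> v"
    and fin: "finite (paths_to \<Lambda> u n)"
    and critical: "exp (deg_weight r n) = real (card (paths_between \<Lambda> u n u))"
    and v: "paths_between \<Lambda> u n v \<noteq> {}"
  shows "\<psi> (T.emb (gen v)) = 0"
proof -
  have \<psi>: "state T.C \<psi>" using kms by (simp add: kms_state_def)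
  note L = T.state_bounded(2)[OF \<psi>]
  let ?S = "paths_to \<Lambda> u n" and ?U = "paths_between \<Lambda> u n u" and ?V = "paths_between \<Lambda> u n v"
  define e where "e = gen u - (\<Sum>\<kappa>\<in>?S. gen \<kappa> * padj (gen \<kappa>))"
  define w where "w = exp (- deg_weight r n)"
  have up: "u \<in> paths \<Lambda>" "u \<in> paths_deg \<Lambda> 0" using vertices by (auto simp: paths_deg_def)
  have S: "\<kappa> \<in> paths \<Lambda>" "deg \<Lambda> \<kappa> = n" if "\<kappa> \<in> ?S" for \<kappa>
    using that by (auto simp: paths_to_def paths_deg_def)
  have e: "e \<in> polys (paths \<Lambda>)" using S up by (auto simp: e_def)
  have sum: "\<psi> (T.emb (\<Sum>\<kappa>\<in>I. gen \<kappa> * padj (gen \<kappa>))) = (\<Sum>\<kappa>\<in>I. \<psi> (T.emb (gen \<kappa> * padj (gen \<kappa>))))"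
    if "I \<subseteq> ?S" for I
    using finite_subset[OF that fin] that
  proof (induction I rule: finite_induct)
    case empty
    show ?case using T.bounded_functional_scale[OF L, of "T.emb 0" 0] by (simp add: T.emb_scale)
  next
    case (insert \<kappa> I)
    then have "gen \<kappa> * padj (gen \<kappa>) \<in> polys (paths \<Lambda>)" "(\<Sum>\<kappa>\<in>I. gen \<kappa> * padj (gen \<kappa>)) \<in> polys (paths \<Lambda>)"
      using S by (auto intro!: sum_polys)
    then show ?case
      using insert T.bounded_functional_add[OF L] by (simp add: T.emb_add[symmetric])
  qed
  have split: "?S = ?U \<union> ?V" "?U \<inter> ?V = {}"
    using src_vertex vertices by (auto simp: paths_between_def paths_to_def paths_deg_def)
  have fin': "finite ?U" "finite ?V" using fin split by auto
  have summand: "\<psi> (T.emb (gen \<kappa> * padj (gen \<kappa>))) = of_real w * \<psi> (T.emb (gen (src \<Lambda> \<kappa>)))" if "\<kappa> \<in> ?S" for \<kappa>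
    using kms_values[OF kms, of \<kappa> \<kappa>] S[OF that] by (simp add: W_def w_def)
  have "(\<Sum>\<kappa>\<in>?S. \<psi> (T.emb (gen \<kappa> * padj (gen \<kappa>)))) = (\<Sum>\<kappa>\<in>?S. of_real w * \<psi> (T.emb (gen (src \<Lambda> \<kappa>))))"
    using summand by (intro sum.cong) auto
  also have "\<dots> = (\<Sum>\<kappa>\<in>?U. of_real w * \<psi> (T.emb (gen u))) + (\<Sum>\<kappa>\<in>?V. of_real w * \<psi> (T.emb (gen v)))"
    unfolding split(1) sum.union_disjoint[OF fin' split(2)]
    by (intro arg_cong2[of _ _ _ _ "(+)"] sum.cong) (auto simp: paths_between_def)
  also have "\<dots> = of_real (w * real (card ?U)) * \<psi> (T.emb (gen u)) + of_real (w * real (card ?V)) * \<psi> (T.emb (gen v))"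
    by (simp add: mult_ac)
  \<comment> \<open>Criticality enters here: the number of loops at u of degree \<open>n\<close>
    cancels the Gibbs weight exactly.\<close>
  also have "w * real (card ?U) = 1"
    using critical[symmetric] by (simp add: w_def exp_minus)
  finally have total: "(\<Sum>\<kappa>\<in>?S. \<psi> (T.emb (gen \<kappa> * padj (gen \<kappa>)))) =
      \<psi> (T.emb (gen u)) + of_real (w * real (card ?V)) * \<psi> (T.emb (gen v))" by simp
  have "\<psi> (T.emb e) = \<psi> (T.emb (gen u)) - \<psi> (T.emb (\<Sum>\<kappa>\<in>?S. gen \<kappa> * padj (gen \<kappa>)))"
  proof -
    have "T.emb (\<Sum>\<kappa>\<in>?S. gen \<kappa> * padj (gen \<kappa>)) \<in> carrier T.C" "T.emb (gen u) \<in> carrier T.C"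
      using S up by (auto intro!: T.emb_carrier sum_polys)
    moreover have "T.emb e = diff T.C (T.emb (gen u)) (T.emb (\<Sum>\<kappa>\<in>?S. gen \<kappa> * padj (gen \<kappa>)))"
      unfolding e_def using S up by (intro T.emb_diff[symmetric]) (auto intro!: sum_polys)
    ultimately show ?thesis by (simp add: T.bounded_functional_diff[OF L])
  qed
  then have "\<psi> (T.emb e) = - (of_real (w * real (card ?V)) * \<psi> (T.emb (gen v)))"
    by (simp add: sum[OF order.refl] total)
  moreover have "\<psi> (T.emb e) \<in> \<real>\<^sub>\<ge>\<^sub>0"
  proof -
    have "T.emb (padj e * e) = T.emb e"
      using T.gap_projection[OF up(2) fin order.refl] e by (simp add: T.emb_eq_iff_eqv e_def[symmetric])
    then show ?thesis using T.state_positive[OF \<psi> e] by simp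
  qed
  ultimately have nonneg: "- (of_real (w * real (card ?V)) * \<psi> (T.emb (gen v))) \<in> \<real>\<^sub>\<ge>\<^sub>0" by simp
  have "\<psi> (T.emb (gen v)) \<in> \<real>\<^sub>\<ge>\<^sub>0"
    using vertices by (intro vertex_value_nonneg \<psi>) simp
  then obtain a where a: "a \<ge> 0" "\<psi> (T.emb (gen v)) = of_real a" by (rule nonneg_Reals_cases)
  define k where "k = w * real (card ?V)"
  have k: "k > 0"
    using v fin'(2) by (simp add: k_def w_def card_gt_0_iff)
  have "complex_of_real (- (k * a)) \<in> \<real>\<^sub>\<ge>\<^sub>0"
    using nonneg unfolding a(2) k_def[symmetric] by simp
  then have "- (k * a) \<ge> 0" by (simp only: nonneg_Reals_of_real_iff)
  then have "a = 0" using a(1) k by (simp add: mult_le_0_iff)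
  then show ?thesis by (simp add: a(2))
qed

end

section \<open>Removing a source vertex\<close>

text \<open>A path of nonzero degree begins with an edge of one of the two colours, and no edge has
  range v; so only the vertex v itself has range v.\<close>

lemma (in two_graph) src_eq_of_source:
  assumes v: "paths_to \<Lambda> v (1, 0) = {}" "paths_to \<Lambda> v (0, 1) = {}"
    and \<kappa>: "\<kappa> \<in> paths \<Lambda>" "rng \<Lambda> \<kappa> = v"
  shows "src \<Lambda> \<kappa> = v"
proof (cases "deg \<Lambda> \<kappa> = 0")
  case True
  then show ?thesis using vertex_rng_src[of \<kappa>] \<kappa> by (simp add: paths_deg_def)
next
  case False
  have no: False if "deg \<Lambda> \<kappa> = m + n" "paths_to \<Lambda> v m = {}" for m n
  proof -
    obtain \<mu> \<nu> where "\<mu> \<in> paths \<Lambda>" "\<nu> \<in> paths \<Lambda>" "src \<Lambda> \<mu> = rng \<Lambda> \<nu>" "\<kappa> = pcomp \<Lambda> \<mu> \<nu>" "deg \<Lambda> \<mu> = m"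
      using factor_exists[OF \<kappa>(1) \<open>deg \<Lambda> \<kappa> = m + n\<close>] by metis
    then have "\<mu> \<in> paths_to \<Lambda> v m" using \<kappa>(2) rng_comp[of \<mu> \<nu>] by (simp add: paths_to_def paths_deg_def)
    then show False using that(2) by simp
  qed
  obtain i j where ij: "deg \<Lambda> \<kappa> = (i, j)" by (cases "deg \<Lambda> \<kappa>")
  show ?thesis
  proof (cases i)
    case (Suc i')
    then have "deg \<Lambda> \<kappa> = (1, 0) + (i', j)" by (simp add: ij)
    then show ?thesis using no v(1) by blast
  next
    case 0
    then obtain j' where "j = Suc j'" using False ij by (cases j) (auto simp: zero_prod_def)
    then have "deg \<Lambda> \<kappa> = (0, 1) + (i, j')" by (simp add: ij)
    then show ?thesis using no v(2) by blast
  qed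
qed

locale source_removal = two_graph \<Lambda> for \<Lambda> :: "'p two_graph_data" +
  fixes v :: 'p
  assumes src_source: "\<kappa> \<in> paths \<Lambda> \<Longrightarrow> rng \<Lambda> \<kappa> = v \<Longrightarrow> src \<Lambda> \<kappa> = v"
    and min_exts_finite: "\<mu> \<in> paths \<Lambda> \<Longrightarrow> \<nu> \<in> paths \<Lambda> \<Longrightarrow> finite (min_ext \<Lambda> \<mu> \<nu>)"
begin

text \<open>Multiplicative because a path with source v composes on the right only with paths of
  range v, and these have source v again.\<close>

definition cut :: "'p \<Rightarrow> complex" where
  "cut \<kappa> = (if src \<Lambda> \<kappa> = v then 0 else 1)"

sublocale cut: cocycle \<Lambda> cut
proof
  fix \<kappa> \<mu> assume "\<kappa> \<in> paths \<Lambda>" "\<mu> \<in> paths \<Lambda>" "src \<Lambda> \<kappa> = rng \<Lambda> \<mu>"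
  then show "cut (pcomp \<Lambda> \<kappa> \<mu>) = cut \<kappa> * cut \<mu>"
    using src_source[of \<mu>] by (simp add: cut_def src_comp)
qed (simp_all add: cut_def src_src min_exts_finite)

abbreviation "\<Gamma> \<equiv> remove_vertex \<Lambda> v"

lemma support_cut: "cut.support = \<Gamma>"
proof -
  have "{\<kappa> \<in> paths \<Lambda>. cut \<kappa> \<noteq> 0} = {\<mu> \<in> paths \<Lambda>. src \<Lambda> \<mu> \<noteq> v}" by (auto simp: cut_def)
  then show ?thesis by (simp only: cut.support_def remove_vertex_def)
qed

lemma paths_removed: "paths \<Gamma> = {\<kappa> \<in> paths \<Lambda>. src \<Lambda> \<kappa> \<noteq> v}"
  by (simp add: remove_vertex_def)

lemma two_graph_removed: "two_graph \<Gamma>"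
  using cut.two_graph_support by (simp only: support_cut)

lemma cut_hom: "contractive_hom (paths \<Lambda>) (toeplitz_norm \<Lambda>) (paths \<Gamma>) (toeplitz_norm \<Gamma>) (twist cut)"
  using cut.contractive_hom_twist by (simp only: support_cut)

lemma twist_cut_gen: "twist cut (gen \<mu>) = (if src \<Lambda> \<mu> = v then 0 else gen \<mu>)"
  by (simp add: twist_gen cut_def)

text \<open>A *-homomorphism with prescribed values on generators has prescribed values on all
  t_\<mu> t_\<nu>^*, so the definite description can only denote the extended twist.\<close>

lemma remove_vertex_hom_eq:
  "remove_vertex_hom \<Lambda> v = ext_hom (paths \<Lambda>) (toeplitz_norm \<Lambda>) (paths \<Gamma>) (toeplitz_norm \<Gamma>) (twist cut)"
proof -
  interpret h: contractive_hom "paths \<Lambda>" "toeplitz_norm \<Lambda>" "paths \<Gamma>" "toeplitz_norm \<Gamma>" "twist cut"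
    by (rule cut_hom)
  interpret T: toeplitz_seminormed \<Lambda> "toeplitz_norm \<Lambda>" by (rule toeplitz_norm_seminormed)
  have alg: "toeplitz_algebra \<Lambda> = h.dom.C" "toeplitz_algebra \<Gamma> = h.cod.C"
    by (simp_all add: toeplitz_algebra_def toeplitz_free_eq)
  have tg: "toeplitz_gen \<Lambda> \<mu> = h.dom.emb (gen \<mu>)" "toeplitz_gen \<Gamma> \<mu> = h.cod.emb (gen \<mu>)" for \<mu>
    by (simp_all add: toeplitz_gen_def toeplitz_free_eq)
  show ?thesis
    unfolding remove_vertex_hom_def Let_def alg tg
  proof (rule the_equality)
    show ext: "star_hom h.dom.C h.cod.C h.ext \<and>
        (\<forall>\<mu>\<in>paths \<Lambda>. h.ext (h.dom.emb (gen \<mu>)) = (if src \<Lambda> \<mu> = v then \<zero>\<^bsub>h.cod.C\<^esub> else h.cod.emb (gen \<mu>)))"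
      using h.star_hom_ext by (simp add: h.ext_emb twist_cut_gen h.cod.zero_class)
    fix q assume q: "star_hom h.dom.C h.cod.C q \<and>
        (\<forall>\<mu>\<in>paths \<Lambda>. q (h.dom.emb (gen \<mu>)) = (if src \<Lambda> \<mu> = v then \<zero>\<^bsub>h.cod.C\<^esub> else h.cod.emb (gen \<mu>)))"
    have split: "\<sigma> (h.dom.emb (gen \<mu>) \<otimes>\<^bsub>h.dom.C\<^esub> adj h.dom.C (h.dom.emb (gen \<nu>))) =
        \<sigma> (h.dom.emb (gen \<mu>)) \<otimes>\<^bsub>h.cod.C\<^esub> adj h.cod.C (\<sigma> (h.dom.emb (gen \<nu>)))"
      if "star_hom h.dom.C h.cod.C \<sigma>" "\<mu> \<in> paths \<Lambda>" "\<nu> \<in> paths \<Lambda>" for \<sigma> \<mu> \<nu>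
    proof -
      have "h.dom.emb (gen \<mu>) \<in> carrier h.dom.C" "h.dom.emb (gen \<nu>) \<in> carrier h.dom.C"
        "adj h.dom.C (h.dom.emb (gen \<nu>)) \<in> carrier h.dom.C"
        using that by (auto intro!: h.dom.carrier_closed)
      then show ?thesis using that(1) unfolding star_hom_def by simp
    qed
    show "q = h.ext"
      by (rule T.star_hom_eq_on_span[OF h.cod.cstar_seminormed_axioms])
        (use q ext in \<open>simp_all add: split\<close>)
  qed
qed

lemma dominated_cut:
  assumes g: "dominated_functional (paths \<Gamma>) (toeplitz_norm \<Gamma>) g"
  shows "dominated_functional (paths \<Lambda>) (toeplitz_norm \<Lambda>) (\<lambda>x. g (twist cut x))"
proof -
  interpret h: contractive_hom "paths \<Lambda>" "toeplitz_norm \<Lambda>" "paths \<Gamma>" "toeplitz_norm \<Gamma>" "twist cut"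
    by (rule cut_hom)
  show ?thesis
    using g order.trans[OF _ h.h_le] h.h_polys unfolding dominated_functional_def
    by (simp add: h.h_add h.h_smul)
qed

text \<open>Along a representative x of X, both sides are the limit of
  \<open>g (twist cut (x n))\<close>. Hence the composite with the quotient map can be treated as a
  functional built on polynomials.\<close>

lemma compose_remove_vertex_hom:
  assumes g: "dominated_functional (paths \<Gamma>) (toeplitz_norm \<Gamma>) g"
  shows "compose (carrier (toeplitz_algebra \<Lambda>)) (ext_functional (paths \<Gamma>) (toeplitz_norm \<Gamma>) g) (remove_vertex_hom \<Lambda> v) =
    ext_functional (paths \<Lambda>) (toeplitz_norm \<Lambda>) (\<lambda>x. g (twist cut x))"
proof -
  interpret h: contractive_hom "paths \<Lambda>" "toeplitz_norm \<Lambda>" "paths \<Gamma>" "toeplitz_norm \<Gamma>" "twist cut"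
    by (rule cut_hom)
  have alg: "toeplitz_algebra \<Lambda> = h.dom.C"
    by (simp add: toeplitz_algebra_def toeplitz_free_eq)
  show ?thesis
  proof (rule extensionalityI[of _ "carrier h.dom.C"])
    fix X assume X: "X \<in> carrier h.dom.C"
    then obtain x where x: "x \<in> cauchy_seqs h.dom.F" "X = seq_class h.dom.F x" by (rule h.dom.carrier_cases)
    have "ext_functional (paths \<Gamma>) (toeplitz_norm \<Gamma>) g (h.ext X) =
        ext_functional (paths \<Lambda>) (toeplitz_norm \<Lambda>) (\<lambda>x. g (twist cut x)) X"
      using h.cod.ext_functional_lim[OF g h.h_cauchy[OF x(1)]] h.dom.ext_functional_lim[OF dominated_cut[OF g] x(1)]
      unfolding x(2) h.ext_class[OF x(1)] by (rule LIMSEQ_unique)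
    then show "compose (carrier (toeplitz_algebra \<Lambda>)) (ext_functional (paths \<Gamma>) (toeplitz_norm \<Gamma>) g) (remove_vertex_hom \<Lambda> v) X =
        ext_functional (paths \<Lambda>) (toeplitz_norm \<Lambda>) (\<lambda>x. g (twist cut x)) X"
      using X by (simp add: compose_def alg remove_vertex_hom_eq)
  qed (simp_all add: alg compose_def ext_functional_def)
qed

end

theorem proposition4p1:
  fixes \<Lambda> :: "'p two_graph_data" and u v :: 'p
    and a\<^sub>1 a\<^sub>2 d\<^sub>1 d\<^sub>2 :: nat and r\<^sub>1 r\<^sub>2 :: real
  defines "A \<equiv> toeplitz_algebra \<Lambda>"
    and "B \<equiv> toeplitz_algebra (remove_vertex \<Lambda> v)"
    and "\<alpha>A \<equiv> toeplitz_dynamics \<Lambda> (r\<^sub>1, r\<^sub>2)"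
    and "\<alpha>B \<equiv> toeplitz_dynamics (remove_vertex \<Lambda> v) (r\<^sub>1, r\<^sub>2)"
  assumes "two_graph \<Lambda>"
    and "a\<^sub>1 > 0" "a\<^sub>2 > 0" "d\<^sub>1 > 0" "d\<^sub>2 > 0"
    and "paths_deg \<Lambda> 0 = {u, v}" "u \<noteq> v"
    and "card (paths_between \<Lambda> u (1, 0) u) = d\<^sub>1" "card (paths_between \<Lambda> u (0, 1) u) = d\<^sub>2"
    and "card (paths_between \<Lambda> u (1, 0) v) = a\<^sub>1" "card (paths_between \<Lambda> u (0, 1) v) = a\<^sub>2"
    and "paths_to \<Lambda> v (1, 0) = {}" "paths_to \<Lambda> v (0, 1) = {}"
    and "r\<^sub>1 > 0" "r\<^sub>2 > 0"
    and "r\<^sub>1 \<ge> ln (real d\<^sub>1)" "r\<^sub>2 \<ge> ln (real d\<^sub>2)"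
    and "r\<^sub>1 = ln (real d\<^sub>1) \<or> r\<^sub>2 = ln (real d\<^sub>2)"
    and "rationally_independent r\<^sub>1 r\<^sub>2"
  shows "\<exists>\<phi>. (\<forall>\<psi>. kms_state B \<alpha>B 1 \<psi> \<longleftrightarrow> \<psi> = \<phi>) \<and>
    (\<forall>\<psi>. kms_state A \<alpha>A 1 \<psi> \<longleftrightarrow> \<psi> = compose (carrier A) \<phi> (remove_vertex_hom \<Lambda> v))"
proof -
  interpret L: two_graph \<Lambda> by fact
  have between: "paths_to \<Lambda> u n = paths_between \<Lambda> u n u \<union> paths_between \<Lambda> u n v" for n
    using L.src_vertex assms(10) by (auto simp: paths_between_def paths_to_def paths_deg_def)
  have by_range: "paths_deg \<Lambda> n = paths_to \<Lambda> u n \<union> paths_to \<Lambda> v n" for n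
    using L.rng_vertex assms(10) by (auto simp: paths_to_def paths_deg_def)
  \<comment> \<open>Infinite sets have cardinality 0, so the positivity of the four edge counts
    yields finiteness.\<close>
  have fin_u: "finite (paths_to \<Lambda> u (1, 0))" "finite (paths_to \<Lambda> u (0, 1))"
    unfolding between by (rule finite_UnI; rule card_ge_0_finite; use assms in simp)+
  have fin: "finite (paths_deg \<Lambda> n)" for n
  proof (rule L.finite_paths_deg)
    show "finite (paths_deg \<Lambda> (1, 0))" "finite (paths_deg \<Lambda> (0, 1))"
      unfolding by_range assms(16,17) using fin_u by simp_all
  qed (simp add: assms(10))
  have inj: "m = n" if "deg_weight (r\<^sub>1, r\<^sub>2) m = deg_weight (r\<^sub>1, r\<^sub>2) n" for m n
    using that assms by (intro deg_weight_inject)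
  interpret S: source_removal \<Lambda> v
    using L.src_eq_of_source[OF assms(16,17)] L.finite_min_ext[OF fin] by unfold_locales
  let ?\<Gamma> = "remove_vertex \<Lambda> v"
  have \<Gamma>_simps: "rng ?\<Gamma> = rng \<Lambda>" "src ?\<Gamma> = src \<Lambda>" "deg ?\<Gamma> = deg \<Lambda>"
    by (simp_all add: remove_vertex_def)
  interpret \<Gamma>: two_graph ?\<Gamma> by (rule S.two_graph_removed)
  have uv: "u \<in> paths_deg \<Lambda> 0" "v \<in> paths_deg \<Lambda> 0" "u \<in> paths \<Lambda>" "v \<in> paths \<Lambda>"
    using assms(10) by (auto simp: paths_deg_def)
  note ends = L.vertex_rng_src[OF uv(1)] L.vertex_rng_src[OF uv(2)]
  have \<Gamma>_deg: "paths_deg ?\<Gamma> n = {\<kappa> \<in> paths_deg \<Lambda> n. src \<Lambda> \<kappa> \<noteq> v}" for n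
    by (auto simp: paths_deg_def S.paths_removed \<Gamma>_simps)
  \<comment> \<open>A path whose source is not v cannot have range v, so in the smaller graph every
    path runs from u to u.\<close>
  have \<Gamma>_edges: "paths_deg ?\<Gamma> n = paths_between \<Lambda> u n u" for n
    unfolding \<Gamma>_deg using L.src_vertex L.rng_vertex S.src_source assms(10,11)
    by (fastforce simp: paths_between_def paths_to_def paths_deg_def)
  have exp_bounds: "real d\<^sub>1 \<le> exp r\<^sub>1" "real d\<^sub>2 \<le> exp r\<^sub>2"
    using assms(8,9,20,21) by (metis exp_le_cancel_iff exp_ln of_nat_0_less_iff)+
  interpret G: one_vertex_graph ?\<Gamma> u "(r\<^sub>1, r\<^sub>2)"
  proof
    show "paths_deg ?\<Gamma> 0 = {u}" unfolding \<Gamma>_deg using assms(10,11) ends by auto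
    show "finite (paths_deg ?\<Gamma> (1, 0))" "finite (paths_deg ?\<Gamma> (0, 1))"
      using fin by (simp_all add: \<Gamma>_deg)
    show "paths_deg ?\<Gamma> (1, 0) \<noteq> {}" "paths_deg ?\<Gamma> (0, 1) \<noteq> {}"
      unfolding \<Gamma>_edges using assms(8,9,12,13) by force+
    show "real (card (paths_deg ?\<Gamma> (1, 0))) \<le> exp (fst (r\<^sub>1, r\<^sub>2))"
      "real (card (paths_deg ?\<Gamma> (0, 1))) \<le> exp (snd (r\<^sub>1, r\<^sub>2))"
      unfolding \<Gamma>_edges assms(12,13) using exp_bounds by simp_all
  qed (rule inj)
  interpret TA: toeplitz_system \<Lambda> "(r\<^sub>1, r\<^sub>2)"
    by unfold_locales (use L.finite_min_ext[OF fin] inj in blast)+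
  interpret TB: toeplitz_system ?\<Gamma> "(r\<^sub>1, r\<^sub>2)"
    by unfold_locales (use \<Gamma>.finite_min_ext[OF G.fin_deg] inj in blast)+
  have A: "A = TA.T.C" "\<alpha>A = TA.dyn" and B: "B = TB.T.C" "\<alpha>B = TB.dyn"
    by (simp_all add: assms(1-4) TA.toeplitz_algebra_eq TA.dynamics_eq TB.toeplitz_algebra_eq TB.dynamics_eq)
  define g where "g = G.equilibrium"
  note g = G.equilibrium_dominated[folded g_def]
  define \<phi> where "\<phi> = ext_functional (paths ?\<Gamma>) (toeplitz_norm ?\<Gamma>) g"
  define \<phi>' where "\<phi>' = ext_functional (paths \<Lambda>) (toeplitz_norm \<Lambda>) (\<lambda>x. g (twist S.cut x))"
  have \<phi>': "compose (carrier A) \<phi> (remove_vertex_hom \<Lambda> v) = \<phi>'"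
    unfolding assms(1) \<phi>_def \<phi>'_def by (rule S.compose_remove_vertex_hom[OF g])
  have WB: "TB.W \<kappa> = deg_weight (r\<^sub>1, r\<^sub>2) (deg ?\<Gamma> \<kappa>)" for \<kappa> by (simp add: TB.W_def)
  have kms_\<phi>: "kms_state TB.T.C TB.dyn 1 \<phi>"
    unfolding \<phi>_def
    by (rule TB.kms_of_functional[OF g, of u])
      (simp_all add: g_def G.equilibrium_nonneg G.equilibrium_padj G.equilibrium_unit G.u_path G.equilibrium_commute WB)
  have \<phi>_u: "\<phi> (TB.T.emb (gen u)) = 1"
    unfolding \<phi>_def TB.T.ext_functional_emb[OF g gen_polys[OF G.u_path]]
    by (simp add: g_def G.equilibrium_unit)
  have cut_closed: "twist S.cut x \<in> polys (paths ?\<Gamma>)" if "x \<in> polys (paths \<Lambda>)" for x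
    using S.cut.twist_closed[OF that] by (simp only: S.support_cut)
  have g0: "g 0 = 0"
    using g unfolding dominated_functional_def by (metis mult_zero_left smul_zero zero_polys)
  have kms_\<phi>': "kms_state TA.T.C TA.dyn 1 \<phi>'"
    unfolding \<phi>'_def
  proof (rule TA.kms_of_functional[OF S.dominated_cut[OF g], of u])
    show "g (twist S.cut (gen u)) = 1"
      using ends assms(11) by (simp add: S.twist_cut_gen g_def G.equilibrium_unit)
    fix x assume x: "x \<in> polys (paths \<Lambda>)"
    show "g (twist S.cut (padj x * x)) \<in> \<real>\<^sub>\<ge>\<^sub>0"
      using G.equilibrium_nonneg[OF cut_closed[OF x]] by (simp add: twist_mult twist_padj g_def)
    show "g (twist S.cut (padj x)) = cnj (g (twist S.cut x))"
      using G.equilibrium_padj[OF cut_closed[OF x]] by (simp add: twist_padj g_def)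
    fix \<kappa> assume \<kappa>: "\<kappa> \<in> paths \<Lambda>"
    show "g (twist S.cut (x * gen \<kappa>)) = of_real (exp (TA.W \<kappa>)) * g (twist S.cut (gen \<kappa> * x))"
    \<comment> \<open>The cut annihilates a generator with source v, so both sides are 0; any other
      generator already belongs to the smaller graph.\<close>
    proof (cases "src \<Lambda> \<kappa> = v")
      case True
      then show ?thesis by (simp add: twist_mult S.twist_cut_gen g0)
    next
      case False
      then have "\<kappa> \<in> paths ?\<Gamma>" using \<kappa> by (simp add: S.paths_removed)
      from G.equilibrium_commute[OF this cut_closed[OF x]] False show ?thesis
        by (simp add: twist_mult S.twist_cut_gen g_def TA.W_def \<Gamma>_simps)
    qed
  qed (rule uv)
  have \<phi>'_u: "\<phi>' (TA.T.emb (gen u)) = 1" and \<phi>'_v: "\<phi>' (TA.T.emb (gen v)) = 0"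
    unfolding \<phi>'_def using uv ends assms(11)
    by (simp_all add: TA.T.ext_functional_emb[OF S.dominated_cut[OF g]] S.twist_cut_gen g_def[symmetric] g0)
      (simp add: g_def G.equilibrium_unit)
  \<comment> \<open>The smaller graph has u as its only vertex, so the condition at the remaining
    vertices is vacuous.\<close>
  have unique_B: "\<psi> = \<phi>" if "kms_state TB.T.C TB.dyn 1 \<psi>" for \<psi>
    by (rule TB.kms_unique[OF that kms_\<phi> _ \<phi>_u]) (simp_all add: G.vertices)
  \<comment> \<open>The degree is the unit vector of whichever coordinate is critical; the positive
    number of edges of that colour from v to u makes the argument strict.\<close>
  have vanish: "\<psi> (TA.T.emb (gen v)) = 0" if "kms_state TA.T.C TA.dyn 1 \<psi>" for \<psi>
    using assms(22)
  proof
    assume "r\<^sub>1 = ln (real d\<^sub>1)"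
    then show ?thesis
      using assms(6,8,10,11,12,14) fin[of "(1, 0)"]
      by (intro TA.kms_critical_vanish[OF that, of u v "(1, 0)"])
        (auto simp: deg_weight_def paths_to_def)
  next
    assume "r\<^sub>2 = ln (real d\<^sub>2)"
    then show ?thesis
      using assms(7,9,10,11,13,15) fin[of "(0, 1)"]
      by (intro TA.kms_critical_vanish[OF that, of u v "(0, 1)"])
        (auto simp: deg_weight_def paths_to_def)
  qed
  have unique_A: "\<psi> = \<phi>'" if "kms_state TA.T.C TA.dyn 1 \<psi>" for \<psi>
    by (rule TA.kms_unique[OF that kms_\<phi>' uv(1) \<phi>'_u]) (use vanish[OF that] \<phi>'_v assms(10) in auto)
  show ?thesis
  proof (intro exI[of _ \<phi>] conjI allI)
    fix \<psi>
    show "kms_state B \<alpha>B 1 \<psi> \<longleftrightarrow> \<psi> = \<phi>"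
      unfolding B using unique_B kms_\<phi> by blast
    show "kms_state A \<alpha>A 1 \<psi> \<longleftrightarrow> \<psi> = compose (carrier A) \<phi> (remove_vertex_hom \<Lambda> v)"
      unfolding \<phi>' unfolding A using unique_A kms_\<phi>' by blast
  qed
qed

end
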